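(* There are absolute constants $C_1,C_2>0$ such that the following holds. Let $\mathbf{X}=\{X_1,\dots,X_n\}$ be independent non-negative random variables and let $\varepsilon>0$. Then there exists a subset $\mathbf{X}'\subseteq\mathbf{X}$, obtained from $\mathbf{X}$ by removing at most $C_1\varepsilon^{-2}\log(1/\varepsilon)$ of the variables, such that $$\mathsf{OPT}(\mathbf{X}) \geq (\beta - C_2\varepsilon)\cdot \mathsf{MAX}(\mathbf{X}').$$ Moreover, such a subset $\mathbf{X}'$ and a random-order stopping policy on $\mathbf{X}$ achieving this guarantee can be constructed in polynomial time.
   Context: For a finite collection $\mathbf{X}$ of independent non-negative random variables with known distributions, $\mathsf{MAX}(\mathbf{X})=\mathbb{E}[\max_i X_i]$, and $\mathsf{OPT}(\mathbf{X})$ is the largest expected reward achievable by an online stopping policy when the variables of $\mathbf{X}$ are presented one at a time in a uniformly random order: upon each arrival the policy learns which variable it is and its realized value, and irrevocably either stops and receives that value or discards it and continues. The Kertz constant $\beta\approx 0.745$ is the solution of $\int_0^1 [(\beta^{-1}-1) - y(\log y - 1)]^{-1}\,dy = 1$.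
   Formalization: For ε > 1 the bound on removed variables is negative and cannot hold, so log(1/ε) is replaced by max(0, log(1/ε)); the polynomial-time claim is read for explicitly listed finitely supported rational distributions and rational ε, since arbitrary distributions have no finite encoding. *)

theory Defs
  imports "HOL-Probability.Probability" "HOL-Library.Log_Nat"
begin

section \<open>Random-order stopping\<close>

text \<open>
  A finite collection of independent random variables is given by a finite index set \<open>I\<close> and
  the family \<open>D\<close> of laws; the joint law of the values is the product measure. The lemmas
  \<open>(in prob_space) EMAX_distr\<close> and \<open>(in prob_space) expected_reward_distr\<close> below show that this
  is what one obtains from independent random variables on an arbitrary probability space.
\<close>

definition EMAX :: "(nat \<Rightarrow> real measure) \<Rightarrow> nat set \<Rightarrow> ennreal" where
  "EMAX D J = (\<integral>\<^sup>+x. (SUP i\<in>J. ennreal (x i)) \<partial>(\<Pi>\<^sub>M i\<in>J. D i))"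

text \<open>
  The history lists the (identity, value) pairs in order of arrival, the current arrival
  being its last entry; \<open>True\<close> means to stop and take the current value.
\<close>

type_synonym 'v history = "(nat \<times> 'v) list"

fun reward :: "(real history \<Rightarrow> bool) \<Rightarrow> real history \<Rightarrow> real history \<Rightarrow> real" where
  "reward d h [] = 0"
| "reward d h (a # as) = (if d (h @ [a]) then snd a else reward d (h @ [a]) as)"

text \<open>
  Policies may be randomized: the random seed \<open>s\<close> is drawn from \<open>Q\<close>, independently of the
  arrival order and of the values.
\<close>

definition expected_reward ::
  "(nat \<Rightarrow> real measure) \<Rightarrow> nat set \<Rightarrow> 's measure \<Rightarrow> ('s \<Rightarrow> real history \<Rightarrow> bool) \<Rightarrow> ennreal" where
  "expected_reward D I Q d =
     (\<integral>\<^sup>+\<pi>. (\<integral>\<^sup>+s. (\<integral>\<^sup>+x. ennreal (reward (d s) [] (map (\<lambda>i. (i, x i)) \<pi>))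
        \<partial>(\<Pi>\<^sub>M i\<in>I. D i)) \<partial>Q) \<partial>measure_pmf (pmf_of_set (permutations_of_set I)))"

definition policy :: "'s measure \<Rightarrow> ('s \<Rightarrow> real history \<Rightarrow> bool) \<Rightarrow> bool" where
  "policy Q d \<longleftrightarrow> (\<forall>is. (\<lambda>(s, v). d s (map (\<lambda>k. (is ! k, v k)) [0..<length is]))
     \<in> Q \<Otimes>\<^sub>M (\<Pi>\<^sub>M k\<in>{..<length is}. borel) \<rightarrow>\<^sub>M count_space UNIV)"

definition uniform_seed :: "real measure" where
  "uniform_seed = uniform_measure lborel {0..1}"

definition OPT :: "(nat \<Rightarrow> real measure) \<Rightarrow> nat set \<Rightarrow> ennreal" where
  "OPT D I = (SUP d\<in>Collect (policy uniform_seed). expected_reward D I uniform_seed d)"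

definition kertz :: real where
  "kertz = (THE b. 0 < b \<and> b < 1 \<and>
     ((\<lambda>y. inverse ((inverse b - 1) - y * (ln y - 1))) has_integral 1) {0..1})"

lemma policy_measurable_fixed_seed:
  assumes "policy Q d" "s \<in> space Q"
  shows "(\<lambda>v. d s (map (\<lambda>k. (is ! k, v k)) [0..<length is]))
     \<in> (\<Pi>\<^sub>M k\<in>{..<length is}. borel) \<rightarrow>\<^sub>M count_space UNIV"
proof -
  have "(\<lambda>(s, v). d s (map (\<lambda>k. (is ! k, v k)) [0..<length is]))
     \<in> Q \<Otimes>\<^sub>M (\<Pi>\<^sub>M k\<in>{..<length is}. borel) \<rightarrow>\<^sub>M count_space UNIV"
    using assms(1) by (auto simp: policy_def)
  from measurable_Pair2[OF this assms(2)] show ?thesis by simp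
qed

lemma measurable_policy_history:
  assumes d: "policy Q d" "s \<in> space Q" and "set is \<subseteq> I"
  shows "(\<lambda>x. d s (map (\<lambda>i. (i, x i)) is)) \<in> (\<Pi>\<^sub>M i\<in>I. borel) \<rightarrow>\<^sub>M count_space UNIV"
proof -
  have "(\<lambda>x. \<lambda>k\<in>{..<length is}. x (is ! k))
      \<in> (\<Pi>\<^sub>M i\<in>I. borel) \<rightarrow>\<^sub>M (\<Pi>\<^sub>M k\<in>{..<length is}. (borel :: real measure))"
    using assms(3) by (intro measurable_restrict measurable_component_singleton) auto
  from measurable_compose[OF this policy_measurable_fixed_seed[OF d, of "is"]]
  have "(\<lambda>x. d s (map (\<lambda>k. (is ! k, (\<lambda>k\<in>{..<length is}. x (is ! k)) k)) [0..<length is]))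
     \<in> (\<Pi>\<^sub>M i\<in>I. borel) \<rightarrow>\<^sub>M count_space UNIV" .
  also have "(\<lambda>x. d s (map (\<lambda>k. (is ! k, (\<lambda>k\<in>{..<length is}. x (is ! k)) k)) [0..<length is]))
      = (\<lambda>x. d s (map (\<lambda>i. (i, x i)) is))"
    by (intro ext arg_cong[where f = "d s"] nth_equalityI) auto
  finally show ?thesis .
qed

lemma measurable_reward:
  assumes d: "policy Q d" "s \<in> space Q" and "set is \<subseteq> I" "set js \<subseteq> I"
  shows "(\<lambda>x. reward (d s) (map (\<lambda>i. (i, x i)) js) (map (\<lambda>i. (i, x i)) is))
    \<in> borel_measurable (\<Pi>\<^sub>M i\<in>I. borel)"
  using assms(3,4)
proof (induction "is" arbitrary: js)
  case (Cons a "is")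
  have m1: "(\<lambda>x. d s (map (\<lambda>i. (i, x i)) (js @ [a]))) \<in> (\<Pi>\<^sub>M i\<in>I. borel) \<rightarrow>\<^sub>M count_space UNIV"
    by (rule measurable_policy_history[OF d]) (use Cons.prems in auto)
  have m2: "(\<lambda>x. x a) \<in> borel_measurable (\<Pi>\<^sub>M i\<in>I. borel)"
    using Cons.prems by (intro measurable_component_singleton) auto
  have m3: "(\<lambda>x. reward (d s) (map (\<lambda>i. (i, x i)) (js @ [a])) (map (\<lambda>i. (i, x i)) is))
    \<in> borel_measurable (\<Pi>\<^sub>M i\<in>I. borel)"
    by (rule Cons.IH) (use Cons.prems in auto)
  have "(\<lambda>x. if d s (map (\<lambda>i. (i, x i)) (js @ [a])) then x a
      else reward (d s) (map (\<lambda>i. (i, x i)) (js @ [a])) (map (\<lambda>i. (i, x i)) is))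
    \<in> borel_measurable (\<Pi>\<^sub>M i\<in>I. borel)"
    using m1 m2 m3 by measurable
  then show ?case by (simp only: list.map reward.simps map_append append_Nil snd_conv append_Cons)
qed simp

context prob_space
begin

lemma PiM_distr_indep:
  fixes X :: "'i \<Rightarrow> 'a \<Rightarrow> real"
  assumes "indep_vars (\<lambda>_. borel) X I" "finite I"
  shows "(\<Pi>\<^sub>M i\<in>I. distr M borel (X i)) =
    distr M (\<Pi>\<^sub>M i\<in>I. (borel :: real measure)) (\<lambda>\<omega>. \<lambda>i\<in>I. X i \<omega>)"
proof (cases "I = {}")
  case True
  have "distr M (count_space {\<lambda>_. undefined}) (\<lambda>\<omega>. \<lambda>_. undefined)
      = count_space {\<lambda>_ :: 'i. undefined :: real}" (is "?L = _")
  proof (rule measure_eqI)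
    fix A assume "A \<in> sets ?L"
    then have "A = {} \<or> A = {\<lambda>_. undefined}" by auto
    then show "emeasure ?L A = emeasure (count_space {\<lambda>_. undefined}) A"
      by (auto simp: emeasure_distr emeasure_space_1)
  qed simp
  then show ?thesis unfolding True PiM_empty restrict_def by (simp only: empty_iff if_False)
next
  case False
  have "random_variable borel (X i)" if "i \<in> I" for i
    using assms(1) that by (auto simp: indep_vars_def)
  from indep_vars_iff_distr_eq_PiM'[OF False this] assms(1) show ?thesis by simp
qed

lemma EMAX_distr:
  assumes X: "indep_vars (\<lambda>_. borel) X I" and J: "J \<subseteq> I" "finite J"
  shows "EMAX (\<lambda>i. distr M borel (X i)) J = (\<integral>\<^sup>+\<omega>. (SUP i\<in>J. ennreal (X i \<omega>)) \<partial>M)"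
proof -
  have XJ: "indep_vars (\<lambda>_. borel) X J"
    using X J by (rule_tac indep_vars_subset)
  have rv: "random_variable borel (X i)" if "i \<in> J" for i
    using XJ that by (auto simp: indep_vars_def)
  have m: "(\<lambda>x. SUP i\<in>J. ennreal (x i)) \<in> borel_measurable (\<Pi>\<^sub>M i\<in>J. borel)"
    using J(2) by (intro borel_measurable_SUP countable_finite) auto
  show ?thesis
    unfolding EMAX_def PiM_distr_indep[OF XJ J(2)]
    by (subst nn_integral_distr)
       (use m in \<open>auto intro!: measurable_restrict rv nn_integral_cong SUP_cong\<close>)
qed

lemma expected_reward_distr:
  assumes X: "indep_vars (\<lambda>_. borel) X I" and I: "finite I" and d: "policy Q d"
  shows "expected_reward (\<lambda>i. distr M borel (X i)) I Q d =
    (\<integral>\<^sup>+\<pi>. (\<integral>\<^sup>+s. (\<integral>\<^sup>+\<omega>. ennreal (reward (d s) [] (map (\<lambda>i. (i, X i \<omega>)) \<pi>)) \<partial>M) \<partial>Q)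
       \<partial>measure_pmf (pmf_of_set (permutations_of_set I)))"
proof -
  have rv: "random_variable borel (X i)" if "i \<in> I" for i
    using X that by (auto simp: indep_vars_def)
  have eq: "(\<integral>\<^sup>+x. ennreal (reward (d s) [] (map (\<lambda>i. (i, x i)) \<pi>))
        \<partial>(\<Pi>\<^sub>M i\<in>I. distr M borel (X i)))
      = (\<integral>\<^sup>+\<omega>. ennreal (reward (d s) [] (map (\<lambda>i. (i, X i \<omega>)) \<pi>)) \<partial>M)"
    if "set \<pi> = I" "s \<in> space Q" for \<pi> s
  proof -
    have m: "(\<lambda>x. reward (d s) [] (map (\<lambda>i. (i, x i)) \<pi>)) \<in> borel_measurable (\<Pi>\<^sub>M i\<in>I. borel)"
      using measurable_reward[OF d that(2), of \<pi> I "[]"] that(1) by simp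
    have e: "map (\<lambda>i. (i, (\<lambda>i\<in>I. X i \<omega>) i)) \<pi> = map (\<lambda>i. (i, X i \<omega>)) \<pi>" for \<omega>
      using that(1) by auto
    have r: "(\<lambda>\<omega>. \<lambda>i\<in>I. X i \<omega>) \<in> M \<rightarrow>\<^sub>M (\<Pi>\<^sub>M i\<in>I. borel)"
      by (intro measurable_restrict rv)
    show ?thesis
      unfolding PiM_distr_indep[OF X I]
      by (subst nn_integral_distr[OF r])
         (use measurable_compose[OF m measurable_ennreal] in \<open>simp_all only: e measurable_distr_eq1\<close>)
  qed
  show ?thesis
    unfolding expected_reward_def
  proof (rule nn_integral_cong_AE, unfold AE_measure_pmf_iff, safe)
    fix \<pi> assume "\<pi> \<in> set_pmf (pmf_of_set (permutations_of_set I))"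
    then have "set \<pi> = I"
      using I by (auto dest: permutations_of_setD)
    then show "(\<integral>\<^sup>+s. (\<integral>\<^sup>+x. ennreal (reward (d s) [] (map (\<lambda>i. (i, x i)) \<pi>))
        \<partial>(\<Pi>\<^sub>M i\<in>I. distr M borel (X i))) \<partial>Q)
      = (\<integral>\<^sup>+s. (\<integral>\<^sup>+\<omega>. ennreal (reward (d s) [] (map (\<lambda>i. (i, X i \<omega>)) \<pi>)) \<partial>M) \<partial>Q)"
      by (intro nn_integral_cong eq)
  qed
qed

end

section \<open>Polynomial time\<close>

text \<open>
  A random access machine with the logarithmic cost criterion, programmed in a structured
  language. Memory cells hold natural numbers; \<open>Ld e\<close> reads the cell whose address is the value
  of \<open>e\<close> and \<open>St a e\<close> writes the value of \<open>e\<close> to the cell with address \<open>a\<close>. Every evaluated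
  subexpression costs one plus the bit length of its value; this charges for operands, for
  results, and (in \<open>Ld\<close> and \<open>St\<close>) for addresses.
\<close>

type_synonym mem = "nat \<Rightarrow> nat"

datatype rexp = Cn nat | Ld rexp | Plus rexp rexp | Minus rexp rexp | Times rexp rexp
  | Quot rexp rexp

datatype rcom = Nop | St rexp rexp | Then rcom rcom | Cond rexp rcom rcom | Loop rexp rcom

fun rval :: "rexp \<Rightarrow> mem \<Rightarrow> nat" where
  "rval (Cn k) m = k"
| "rval (Ld e) m = m (rval e m)"
| "rval (Plus a b) m = rval a m + rval b m"
| "rval (Minus a b) m = rval a m - rval b m"
| "rval (Times a b) m = rval a m * rval b m"
| "rval (Quot a b) m = rval a m div rval b m"

abbreviation bits :: "nat \<Rightarrow> nat" where
  "bits \<equiv> floorlog 2"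

fun rcost :: "rexp \<Rightarrow> mem \<Rightarrow> nat" where
  "rcost (Cn k) m = 1 + bits k"
| "rcost (Ld e) m = 1 + bits (rval (Ld e) m) + rcost e m"
| "rcost (Plus a b) m = 1 + bits (rval (Plus a b) m) + rcost a m + rcost b m"
| "rcost (Minus a b) m = 1 + bits (rval (Minus a b) m) + rcost a m + rcost b m"
| "rcost (Times a b) m = 1 + bits (rval (Times a b) m) + rcost a m + rcost b m"
| "rcost (Quot a b) m = 1 + bits (rval (Quot a b) m) + rcost a m + rcost b m"

text \<open>\<open>exec c m t m'\<close>: started in memory \<open>m\<close>, program \<open>c\<close> halts at cost \<open>t\<close> with memory \<open>m'\<close>.\<close>

inductive exec :: "rcom \<Rightarrow> mem \<Rightarrow> nat \<Rightarrow> mem \<Rightarrow> bool" where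
  Nop: "exec Nop m 1 m"
| St: "exec (St a e) m (1 + rcost a m + rcost e m) (m(rval a m := rval e m))"
| Then: "exec c m t m' \<Longrightarrow> exec c' m' t' m'' \<Longrightarrow> exec (Then c c') m (t + t') m''"
| Cond_True: "rval e m \<noteq> 0 \<Longrightarrow> exec c m t m' \<Longrightarrow> exec (Cond e c c') m (1 + rcost e m + t) m'"
| Cond_False: "rval e m = 0 \<Longrightarrow> exec c' m t m' \<Longrightarrow> exec (Cond e c c') m (1 + rcost e m + t) m'"
| Loop_True: "rval e m \<noteq> 0 \<Longrightarrow> exec c m t m' \<Longrightarrow> exec (Loop e c) m' t' m'' \<Longrightarrow>
    exec (Loop e c) m (1 + rcost e m + t + t') m''"
| Loop_False: "rval e m = 0 \<Longrightarrow> exec (Loop e c) m (1 + rcost e m) m"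

definition input_mem :: "nat list \<Rightarrow> mem" where
  "input_mem xs = (\<lambda>a. if a = 0 then length xs else if a \<le> length xs then xs ! (a - 1) else 0)"

definition out_list :: "mem \<Rightarrow> nat list" where
  "out_list m = map m [1..<Suc (m 0)]"

definition input_size :: "nat list \<Rightarrow> nat" where
  "input_size xs = (\<Sum>x\<leftarrow>xs. bits x + 1)"

definition polytime_on ::
  "'x set \<Rightarrow> ('x \<Rightarrow> nat list) \<Rightarrow> ('y \<Rightarrow> nat list) \<Rightarrow> ('x \<Rightarrow> 'y) \<Rightarrow> bool" where
  "polytime_on A enc_in enc_out f \<longleftrightarrow> (\<exists>c (p :: nat poly). \<forall>x\<in>A. \<exists>t m.
     exec c (input_mem (enc_in x)) t m \<and> out_list m = enc_out (f x) \<and>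
     t \<le> poly p (input_size (enc_in x)))"

section \<open>Explicitly given distributions\<close>

text \<open>
  As an input to an algorithm, each random variable is the list of the (value, probability)
  pairs of a finitely supported law with rational data.
\<close>

type_synonym instance_data = "(rat \<times> rat) list list"

definition valid_instance :: "instance_data \<Rightarrow> bool" where
  "valid_instance E \<longleftrightarrow> (\<forall>ps\<in>set E. (\<forall>(v, p)\<in>set ps. 0 \<le> v) \<and>
     pmf_of_list_wf (map (map_prod real_of_rat real_of_rat) ps))"

definition laws :: "instance_data \<Rightarrow> nat \<Rightarrow> real measure" where
  "laws E i = distr (measure_pmf (pmf_of_list (map (map_prod real_of_rat real_of_rat) (E ! i))))
     borel (\<lambda>x. x)"

definition feasible_history :: "instance_data \<Rightarrow> rat history \<Rightarrow> bool" where
  "feasible_history E h \<longleftrightarrow> distinct (map fst h) \<and>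
     (\<forall>(i, v)\<in>set h. i < length E \<and> v \<in> fst ` set (E ! i))"

text \<open>
  Realized values of \<^term>\<open>laws E\<close> are rational, so a policy for \<open>E\<close> only has to be
  specified on rational histories.
\<close>

definition real_policy :: "(rat history \<Rightarrow> bool) \<Rightarrow> real history \<Rightarrow> bool" where
  "real_policy d h = d (map (map_prod id (inv real_of_rat)) h)"

definition bit_seed :: "nat \<Rightarrow> nat measure" where
  "bit_seed l = measure_pmf (pmf_of_set {..<2 ^ l})"

lemma measurable_inv_rat: "inv real_of_rat \<in> borel \<rightarrow>\<^sub>M count_space UNIV"
proof -
  have Q: "countable (\<rat> :: real set)"
    by (simp add: Rats_def)
  have S: "A \<in> sets borel" if "A \<subseteq> \<rat>" for A :: "real set"
    by (rule sets.countable[OF _ countable_subset[OF that Q]]) simp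
  define c where "c = (SOME r :: rat. False)"
  define g where "g = (\<lambda>x. if x \<in> \<rat> then inv real_of_rat x else c)"
  have "inv real_of_rat x = g x" for x
  proof (cases "x \<in> \<rat>")
    case False
    then have "(\<lambda>r. real_of_rat r = x) = (\<lambda>_. False)"
      by (auto simp: Rats_def)
    then show ?thesis using False by (simp add: inv_into_def g_def c_def)
  qed (simp add: g_def)
  then have "inv real_of_rat = g" by (rule ext)
  moreover have "g \<in> borel \<rightarrow>\<^sub>M count_space UNIV"
  proof (rule measurableI)
    fix A :: "rat set"
    have "- \<rat> \<in> sets (borel :: real measure)"
      by (rule borel_comp[OF S[OF subset_refl]])
    moreover have "g -` A \<inter> \<rat> \<in> sets borel"
      by (rule S) blast
    ultimately have "(g -` A \<inter> \<rat>) \<union> (if c \<in> A then - \<rat> else {}) \<in> sets borel"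
      by (intro sets.Un) (simp_all split: if_split)
    also have "(g -` A \<inter> \<rat>) \<union> (if c \<in> A then - \<rat> else {}) = g -` A"
      by (auto simp: g_def split: if_splits)
    finally have "g -` A \<in> sets borel" .
    then show "g -` A \<inter> space borel \<in> sets borel" by simp
  qed simp
  ultimately show ?thesis by (simp only:)
qed

lemma policy_real_policy: "policy (bit_seed l) (\<lambda>s. real_policy (d s))"
  unfolding policy_def
proof
  fix "is" :: "nat list"
  define N where "N = bit_seed l \<Otimes>\<^sub>M (\<Pi>\<^sub>M k\<in>{..<length is}. (borel :: real measure))"
  define F where "F = (\<lambda>(s :: nat, v). map (\<lambda>k. (is ! k, inv real_of_rat (v k))) [0..<length is])"
  have fst: "fst \<in> N \<rightarrow>\<^sub>M count_space UNIV"
    unfolding N_def bit_seed_def by measurable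
  have F: "F \<in> N \<rightarrow>\<^sub>M count_space UNIV"
  proof (subst measurable_count_space_eq_countable, safe)
    fix h
    have 1: "(\<lambda>z. inv real_of_rat (snd z k)) \<in> N \<rightarrow>\<^sub>M count_space UNIV" if "k < length is" for k
      unfolding N_def
      by (rule measurable_compose[OF _ measurable_inv_rat],
          rule measurable_compose[OF measurable_snd measurable_component_singleton])
         (use that in auto)
    have "F -` {h} \<inter> space N = (if map fst h = is
        then {z \<in> space N. \<forall>k\<in>{..<length is}. inv real_of_rat (snd z k) = snd (h ! k)} else {})"
    proof (cases "map fst h = is")
      case True
      then have l: "length h = length is" and f: "\<And>k. k < length is \<Longrightarrow> fst (h ! k) = is ! k"
        by auto
      have "F z = h \<longleftrightarrow> (\<forall>k\<in>{..<length is}. inv real_of_rat (snd z k) = snd (h ! k))" for z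
        unfolding F_def list_eq_iff_nth_eq split_beta using l f by (auto simp: prod_eq_iff)
      then have "F -` {h} \<inter> space N =
          {z \<in> space N. \<forall>k\<in>{..<length is}. inv real_of_rat (snd z k) = snd (h ! k)}"
        by blast
      then show ?thesis by (simp only: True simp_thms if_True)
    next
      case False
      have "map fst (F z) = is" for z
        by (cases z) (simp add: F_def comp_def map_nth)
      then have "F z \<noteq> h" for z using False by metis
      then have "F -` {h} \<inter> space N = {}" by blast
      then show ?thesis by (simp only: False if_False)
    qed
    also have "\<dots> \<in> sets N"
    proof -
      have "{z \<in> space N. inv real_of_rat (snd z k) = snd (h ! k)} \<in> sets N"
        if "k < length is" for k
        using measurable_sets[OF 1[OF that], of "{snd (h ! k)}"]
        by (simp add: vimage_def Int_def conj_commute)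
      then have "{z \<in> space N. \<forall>k\<in>{..<length is}. inv real_of_rat (snd z k) = snd (h ! k)} \<in> sets N"
        by (intro sets.sets_Collect_finite_All) auto
      then show ?thesis by simp
    qed
    finally show "F -` {h} \<inter> space N \<in> sets N" .
  qed auto
  have "(\<lambda>z. d (fst z) (F z)) \<in> N \<rightarrow>\<^sub>M count_space UNIV"
    by (rule measurable_compose_countable[OF _ fst], rule measurable_compose[OF F]) simp
  moreover have "(\<lambda>z. d (fst z) (F z)) =
      (\<lambda>(s, v). real_policy (d s) (map (\<lambda>k. (is ! k, v k)) [0..<length is]))"
    by (auto simp: F_def real_policy_def fun_eq_iff comp_def intro!: arg_cong2[where f = d])
  ultimately show "(\<lambda>(s, v). real_policy (d s) (map (\<lambda>k. (is ! k, v k)) [0..<length is]))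
     \<in> bit_seed l \<Otimes>\<^sub>M (\<Pi>\<^sub>M k\<in>{..<length is}. borel) \<rightarrow>\<^sub>M count_space UNIV"
    by (simp add: N_def)
qed

definition enc_rat :: "rat \<Rightarrow> nat list" where
  "enc_rat r = [nat (fst (quotient_of r)), nat (snd (quotient_of r))]"

definition enc_list :: "('b \<Rightarrow> nat list) \<Rightarrow> 'b list \<Rightarrow> nat list" where
  "enc_list enc xs = length xs # concat (map enc xs)"

definition enc_input :: "rat \<times> instance_data \<Rightarrow> nat list" where
  "enc_input = (\<lambda>(\<epsilon>, E). enc_rat \<epsilon> @ enc_list (enc_list (\<lambda>(v, p). enc_rat v @ enc_rat p)) E)"

definition enc_query :: "(rat \<times> instance_data) \<times> nat \<times> rat history \<Rightarrow> nat list" where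
  "enc_query = (\<lambda>(inp, s, h). enc_input inp @ [s] @ enc_list (\<lambda>(i, v). i # enc_rat v) h)"

definition inputs :: "(rat \<times> instance_data) set" where
  "inputs = {(\<epsilon>, E). 0 < \<epsilon> \<and> valid_instance E}"

text \<open>The polynomial \<open>q\<close> bounds the number of random bits available to the policy.\<close>

definition seed_bits :: "nat poly \<Rightarrow> rat \<times> instance_data \<Rightarrow> nat" where
  "seed_bits q inp = poly q (input_size (enc_input inp))"

definition queries :: "nat poly \<Rightarrow> ((rat \<times> instance_data) \<times> nat \<times> rat history) set" where
  "queries q = {(inp, s, h). inp \<in> inputs \<and> s < 2 ^ seed_bits q inp \<and>
     feasible_history (snd inp) h}"

text \<open>
  A bound on the number of removed variables. It is truncated at \<open>0\<close> because \<open>ln (1 / \<epsilon>)\<close> is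
  negative for \<open>\<epsilon> > 1\<close>, where no number of removals satisfies the untruncated bound.
\<close>

definition removal_bound :: "real \<Rightarrow> real \<Rightarrow> real" where
  "removal_bound C \<epsilon> = C * (1 / \<epsilon>\<^sup>2) * max 0 (ln (1 / \<epsilon>))"

end

theory Submission
  imports Defs "HOL-Real_Asymp.Real_Asymp"
begin

text \<open>
  Let \<open>K = 2\<^sup>k\<close> be of order \<open>1 / \<epsilon>\<close> and \<open>N = 2 k K\<^sup>2\<close>. Let \<open>T\<close> be the largest threshold that at
  least \<open>N\<close> of the variables reach with probability at least \<open>1 / K\<close>; the at most \<open>N\<close> variables
  exceeding \<open>T\<close> with probability more than \<open>1 / K\<close> are removed.

  The policy treats the last arrivals, roughly a fraction \<open>1 / K\<close> of all, as a safety net: there it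
  accepts every value that is at least \<open>T\<close>. About \<open>N / K\<close> of the \<open>N\<close> variables above arrive in this
  phase, and each is accepted with probability at least \<open>1 / K\<close>, so by Chebyshev's inequality \<open>T\<close> is
  secured up to a factor \<open>1 - O(1 / K)\<close>. At position \<open>m\<close> of the first phase, of length
  \<open>M \<le> (1 - 1 / K) (n - 1)\<close>, it accepts a value of a remaining variable if it exceeds
  \<open>T + Z\<^bsub>m+1\<^esub>\<close>, where the \<open>Z\<^bsub>m\<^esub>\<close> solve the dynamic program
  \<open>Z\<^bsub>m\<^esub> = Z\<^bsub>m+1\<^esub> + (\<Sum>i. E (X\<^sub>i - T - Z\<^bsub>m+1\<^esub>)\<^sup>+) / M\<close>. The acceptance probabilities are at most
  \<open>1 / K\<close>, and therefore the probability of reaching a position in a random order is at least the one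
  that the dynamic program assumes; the gain over \<open>T\<close> is at least \<open>M / n\<close> times \<open>Z\<^sub>0\<close>. Finally
  \<open>Z\<^sub>0\<close> is at least \<open>\<beta>\<close> times the expected excess of the maximum over \<open>T\<close>, by a discretization of the
  differential equation behind the Kertz constant.

  The policy needs no randomness. For explicitly given laws it is evaluated in integer arithmetic,
  after multiplication with a common denominator, on numbers with polynomially many bits.
\<close>

section \<open>The Kertz constant\<close>

text \<open>The maximum is at most \<open>T\<close> plus its excess over \<open>T\<close>, and the
  two parts are paid for separately: \<open>T\<close> by the event that anything is accepted at all,
  the excess by the dynamic program, where alone the factor \<beta> is lost. The recursion for
  \<open>Z\<close> treats every step as a fresh draw that meets each variable at rate
  \<open>1 / M\<close>. Two things separate it from the problem at hand: a random order draws
  without replacement, and the maximum has tail one minus a product of factors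
  \<open>1 - q i\<close>, where the Kertz bound has \<open>1 - exp (- L)\<close>. Both gaps close
  only if the single probabilities are small, which is what the removal achieves. The first loss is
  absorbed by keeping \<open>M\<close> below \<open>(1 - 1 / K) * (n - 1)\<close>; the price is the
  factor \<open>M / n\<close>, at least \<open>1 - 2 / K\<close>. The logarithm in \<open>N\<close>
  stems from the safety net: the acceptance probabilities met there add up to at least
  \<open>2 * k\<close> on average, and \<open>exp (- k) \<le> 1 / K\<close>. Fluctuations around the
  average cost only \<open>4 / K\<close> more, so second moments suffice.\<close>

definition kf :: "real \<Rightarrow> real \<Rightarrow> real" where
  "kf c y = c - y * (ln y - 1)"

lemma kf_0 [simp]: "kf c 0 = c" and kf_1 [simp]: "kf c 1 = c + 1"
  by (simp_all add: kf_def)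

lemma continuous_on_kf: "continuous_on {0..1} (kf c)"
proof -
  have "((\<lambda>y::real. y * ln y) \<longlongrightarrow> 0) (at_right 0)"
    by real_asymp
  then have "((\<lambda>y::real. y * ln y) \<longlongrightarrow> 0 * ln 0) (at 0 within {0..1})"
    by (simp add: at_within_Icc_at_right)
  moreover have "((\<lambda>y::real. y * ln y) \<longlongrightarrow> x * ln x) (at x within {0..1})"
    if "0 < x" for x :: real
    using that by (auto intro!: tendsto_eq_intros)
  ultimately have "continuous_on {0..1} (\<lambda>y::real. y * ln y)"
    unfolding continuous_on_def by (metis atLeastAtMost_iff order_le_less)
  from continuous_on_diff[OF continuous_on_add[OF continuous_on_const continuous_on_id] this, of c]
  show ?thesis
    by (rule continuous_on_eq) (simp add: kf_def algebra_simps)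
qed

lemma kf_ge:
  assumes "0 \<le> y" "y \<le> 1"
  shows "kf c y \<ge> c + y"
proof (cases "y = 0")
  case False
  then have "y * ln y \<le> 0"
    using assms by (intro mult_nonneg_nonpos) auto
  then show ?thesis by (simp add: kf_def algebra_simps)
qed simp

lemma kf_pos:
  assumes "0 < c" "0 \<le> y" "y \<le> 1"
  shows "kf c y > 0"
  using kf_ge[of y c] assms by linarith

lemma has_real_derivative_kf:
  assumes "0 < y"
  shows "(kf c has_real_derivative - ln y) (at y)"
  unfolding kf_def using assms by (auto intro!: derivative_eq_intros)

text \<open>\<open>kA\<close> has a kink at \<open>exp (- l)\<close>, and \<open>ln\<close> has no
  derivative at \<open>0\<close>. The derivative is therefore asked for only in the open interval
  and away from one point, and the mean value theorem is applied on both sides of that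
  point.\<close>

lemma mono_if_derivative_nonneg_except:
  fixes f :: "real \<Rightarrow> real"
  assumes "a \<le> b" "continuous_on {a..b} f"
    and der: "\<And>x. a < x \<Longrightarrow> x < b \<Longrightarrow> x \<noteq> c \<Longrightarrow> \<exists>d\<ge>0. (f has_real_derivative d) (at x)"
  shows "f a \<le> f b"
proof -
  have mono: "f u \<le> f v" if uv: "a \<le> u" "u \<le> v" "v \<le> b" "c \<le> u \<or> v \<le> c" for u v
  proof (cases "u = v")
    case False
    then have "u < v" using uv by simp
    moreover have cont: "continuous_on {u..v} f"
      by (rule continuous_on_subset[OF assms(2)]) (use uv in auto)
    moreover have d: "\<exists>d\<ge>0. (f has_real_derivative d) (at x)" if "u < x" "x < v" for x
      by (rule der) (use that uv in auto)
    moreover have "f differentiable (at x)" if "u < x" "x < v" for x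
      using d[OF that] real_differentiable_def by blast
    ultimately obtain l z where z: "u < z" "z < v" "(f has_real_derivative l) (at z)"
        "f v - f u = (v - u) * l"
      using MVT by blast
    from d[OF z(1,2)] z(3) have "0 \<le> l" using DERIV_unique by blast
    with z(4) \<open>u < v\<close> show ?thesis by (metis diff_ge_0_iff_ge less_imp_le mult_nonneg_nonneg)
  qed simp
  show ?thesis
  proof (cases "a \<le> c \<and> c \<le> b")
    case True
    with mono[of a c] mono[of c b] show ?thesis by simp
  next
    case False
    with mono[of a b] assms(1) show ?thesis by auto
  qed
qed

lemma kf_mono:
  assumes "0 \<le> x" "x \<le> y" "y \<le> 1"
  shows "kf c x \<le> kf c y"
proof (rule mono_if_derivative_nonneg_except[where c = y and f = "kf c"])
  fix z assume "x < z" "z < y"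
  then show "\<exists>d\<ge>0. (kf c has_real_derivative d) (at z)"
    using has_real_derivative_kf[of z c] assms by (intro exI[of _ "- ln z"]) auto
qed (use assms in \<open>auto intro!: continuous_on_subset[OF continuous_on_kf]\<close>)

text \<open>Links \<open>kf\<close> to the definition of \<open>kertz\<close>: \<open>c\<close>
  stands for \<open>1 / \<beta> - 1\<close>, and \<open>kf c\<close> is \<open>c\<close> plus the
  primitive of \<open>- ln\<close>, so that the Kertz integrand is its reciprocal.\<close>

lemma kf_integrand_eq: "inverse ((inverse b - 1) - y * (ln y - 1)) = inverse (kf (inverse b - 1) y)"
  by (simp add: kf_def)

section \<open>Existence and uniqueness of the Kertz constant\<close>

definition kI :: "real \<Rightarrow> real" where
  "kI c = integral {0..1} (\<lambda>y. inverse (kf c y))"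

lemma continuous_on_inverse_kf:
  "0 < c \<Longrightarrow> continuous_on {0..1} (\<lambda>y. inverse (kf c y))"
  using kf_pos[of c] by (intro continuous_intros continuous_on_kf) force

lemma integrable_inverse_kf: "0 < c \<Longrightarrow> (\<lambda>y. inverse (kf c y)) integrable_on {0..1}"
  by (intro integrable_continuous_interval continuous_on_inverse_kf)

lemma inverse_kf_diff:
  assumes "0 < c" "c \<le> c'" "0 \<le> y" "y \<le> 1"
  shows "inverse (kf c y) - inverse (kf c' y) = (c' - c) * inverse (kf c y) * inverse (kf c' y)"
proof -
  have "kf c' y - kf c y = c' - c" by (simp add: kf_def)
  moreover have "kf c y > 0" "kf c' y > 0" using kf_pos assms by auto
  ultimately show ?thesis by (simp add: field_simps)
qed

text \<open>Since \<open>kf a\<close> is at most \<open>a + 1\<close> on the unit interval, the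
  integrands differ by at least a constant \<open>d\<close>; a uniform gap survives
  integration.\<close>

lemma kI_strict_antimono:
  assumes "0 < c" "c < c'"
  shows "kI c' < kI c"
proof -
  define d where "d = (c' - c) * inverse (c + 1) * inverse (c' + 1)"
  have d: "0 < d" using assms by (simp add: d_def)
  have kf_le: "kf a y \<le> a + 1" if "0 \<le> y" "y \<le> 1" for a y
    using kf_mono[of y 1 a] that by simp
  have "inverse (kf c' y) + d \<le> inverse (kf c y)" if y: "y \<in> {0..1}" for y
  proof -
    have "inverse (c + 1) \<le> inverse (kf c y)" "inverse (c' + 1) \<le> inverse (kf c' y)"
      using kf_le kf_pos[of c y] kf_pos[of c' y] y assms by (auto intro!: le_imp_inverse_le)
    then have "d \<le> (c' - c) * inverse (kf c y) * inverse (kf c' y)"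
      unfolding d_def using assms y kf_pos[of c y] kf_pos[of c' y]
      by (intro mult_mono) (auto intro!: mult_nonneg_nonneg simp: less_imp_le)
    with inverse_kf_diff[of c c' y] assms y show ?thesis by simp
  qed
  then have "integral {0..1} (\<lambda>y. inverse (kf c' y) + d) \<le> kI c"
    unfolding kI_def using assms
    by (intro integral_le integrable_add integrable_inverse_kf integrable_const_ivl) auto
  also have "integral {0..1} (\<lambda>y. inverse (kf c' y) + d) = kI c' + d"
    unfolding kI_def using assms by (subst integral_add) (auto intro!: integrable_inverse_kf)
  finally show ?thesis using d by linarith
qed

text \<open>The constant is \<open>10 * 10\<close>: for \<open>c\<close> at least
  \<open>1/10\<close>, both reciprocals are at most \<open>10\<close>.\<close>

lemma kI_lipschitz:
  assumes "1/10 \<le> c" "c \<le> c'"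
  shows "kI c - kI c' \<le> 100 * (c' - c)"
proof -
  have "inverse (kf c y) \<le> inverse (kf c' y) + 100 * (c' - c)" if y: "y \<in> {0..1}" for y
  proof -
    have "inverse (kf c y) \<le> 10" "inverse (kf c' y) \<le> 10"
      using kf_ge[of y c] kf_ge[of y c'] y assms
        le_imp_inverse_le[of "1/10" "kf c y"] le_imp_inverse_le[of "1/10" "kf c' y"] by auto
    then have "(c' - c) * inverse (kf c y) * inverse (kf c' y) \<le> (c' - c) * 10 * 10"
      using kf_pos[of c y] kf_pos[of c' y] assms y by (intro mult_mono) (auto simp: less_imp_le)
    with inverse_kf_diff[of c c' y] assms y show ?thesis by simp
  qed
  then have "kI c \<le> integral {0..1} (\<lambda>y. inverse (kf c' y) + 100 * (c' - c))"
    unfolding kI_def using assms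
    by (intro integral_le integrable_add integrable_inverse_kf integrable_const_ivl) auto
  also have "\<dots> = kI c' + 100 * (c' - c)"
    unfolding kI_def using assms by (subst integral_add) (auto intro!: integrable_inverse_kf)
  finally show ?thesis by linarith
qed

lemma continuous_on_kI: "continuous_on {1/10..1} kI"
proof -
  have "100-lipschitz_on {1/10..1} kI"
  proof (rule lipschitz_onI)
    fix x y :: real assume "x \<in> {1/10..1}" "y \<in> {1/10..1}"
    then show "dist (kI x) (kI y) \<le> 100 * dist x y"
      using kI_lipschitz[of x y] kI_lipschitz[of y x]
        kI_strict_antimono[of x y] kI_strict_antimono[of y x]
      by (cases x y rule: linorder_cases) (auto simp: dist_real_def)
  qed simp
  then show ?thesis by (rule lipschitz_on_continuous_on)
qed

lemma kI_1: "kI 1 \<le> 1"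
proof -
  have "kI 1 \<le> integral {0..1} (\<lambda>y::real. 1::real)"
    unfolding kI_def
  proof (intro integral_le integrable_inverse_kf)
    fix y :: real assume "y \<in> {0..1}"
    then show "inverse (kf 1 y) \<le> 1"
      using kf_ge[of y 1] by (simp add: inverse_le_1_iff)
  qed (auto intro: integrable_const_ivl)
  then show ?thesis by simp
qed

text \<open>The integrand decreases, and its lower Riemann sum with the nodes \<open>1/8\<close>,
  \<open>1/4\<close>, \<open>1/2\<close>, \<open>1\<close> already exceeds \<open>1\<close>.\<close>

lemma kI_tenth: "1 \<le> kI (1/10)"
proof -
  let ?g = "\<lambda>y. inverse (kf (1/10) y)"
  have int: "?g integrable_on {a..b}" if "0 \<le> a" "b \<le> 1" for a b
    by (rule integrable_subinterval_real[OF integrable_inverse_kf]) (use that in auto)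
  have lower: "(b - a) * ?g b \<le> integral {a..b} ?g" if "0 \<le> a" "a \<le> b" "b \<le> 1" for a b
  proof -
    have "integral {a..b} (\<lambda>y. ?g b) \<le> integral {a..b} ?g"
      by (intro integral_le integrable_const_ivl int)
         (use that kf_mono[of _ b "1/10"] kf_pos[of "1/10"] in
           \<open>auto intro!: le_imp_inverse_le\<close>)
    then show ?thesis using that by simp
  qed
  \<comment> \<open>Leads to \<open>ln 2 \<le> 7/10\<close>, which evaluates \<open>kf\<close> at
    the dyadic nodes: the seventh power of \<open>1.105\<close> exceeds \<open>2\<close>.\<close>
  have e1: "1105/1000 \<le> exp (1/10 :: real)"
    using exp_lower_Taylor_quadratic[of "1/10 :: real"] by (simp add: power2_eq_square)
  have "2 \<le> (1105/1000 :: real) ^ 7" by (simp add: power_numeral_reduce)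
  also have "\<dots> \<le> exp (1/10) ^ 7" by (intro power_mono e1) simp
  also have "\<dots> = exp (7/10 :: real)" by (simp flip: exp_of_nat_mult)
  finally have l2: "ln 2 \<le> (7/10 :: real)"
    using ln_le_cancel_iff[of 2 "exp (7/10)"] by simp
  have l4: "ln 4 = 2 * ln (2 :: real)" using ln_realpow[of 2 2] by simp
  have l8: "ln 8 = 3 * ln (2 :: real)" using ln_realpow[of 2 3] by simp
  have "kf (1/10) (1/2) \<le> 95/100" "kf (1/10) (1/4) \<le> 7/10" "kf (1/10) (1/8) \<le> 4875/10000"
    unfolding kf_def using l2 l4 l8 ln_div[of 1 "2 :: real"] ln_div[of 1 "4 :: real"] ln_div[of 1 "8 :: real"]
    by (simp_all add: algebra_simps)
  then have "100/95 \<le> ?g (1/2)" "10/7 \<le> ?g (1/4)" "10000/4875 \<le> ?g (1/8)" "?g 1 = 10/11"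
    using kf_pos[of "1/10" "1/2"] kf_pos[of "1/10" "1/4"] kf_pos[of "1/10" "1/8"]
      le_imp_inverse_le[of "kf (1/10) (1/2)" "95/100"] le_imp_inverse_le[of "kf (1/10) (1/4)" "7/10"]
      le_imp_inverse_le[of "kf (1/10) (1/8)" "4875/10000"]
    by simp_all
  moreover have "kI (1/10) = integral {0..1/8} ?g + integral {1/8..1/4} ?g
      + integral {1/4..1/2} ?g + integral {1/2..1} ?g"
    unfolding kI_def by (simp add: Henstock_Kurzweil_Integration.integral_combine int)
  ultimately show ?thesis
    using lower[of 0 "1/8"] lower[of "1/8" "1/4"] lower[of "1/4" "1/2"] lower[of "1/2" 1] by simp
qed

text \<open>\<open>kI\<close> decreases continuously through \<open>1\<close> between
  \<open>1/10\<close> and \<open>1\<close>, which yields a solution. Strict monotonicity on all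
  positive \<open>c\<close> makes it the only one with \<open>b\<close> between \<open>0\<close> and
  \<open>1\<close>, so the definite description denotes it.\<close>

lemma kertz_works:
  shows "0 < kertz" "kertz < 1" "kI (inverse kertz - 1) = 1"
proof -
  let ?P = "\<lambda>b. 0 < b \<and> b < 1 \<and>
     ((\<lambda>y. inverse ((inverse b - 1) - y * (ln y - 1))) has_integral 1) {0..1}"
  have P_iff: "?P b \<longleftrightarrow> 0 < b \<and> b < 1 \<and> kI (inverse b - 1) = 1" for b :: real
  proof (cases "0 < b \<and> b < 1")
    case True
    then have "0 < inverse b - 1" by (simp add: field_simps)
    from integrable_inverse_kf[OF this] True show ?thesis
      by (simp add: kf_integrand_eq kI_def has_integral_iff)
  qed blast
  obtain c where c: "1/10 \<le> c" "c \<le> 1" "kI c = 1"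
    using IVT2'[of kI 1 1 "1/10"] kI_1 kI_tenth continuous_on_kI by auto
  have "?P (inverse (c + 1))"
    unfolding P_iff using c by (simp add: field_simps)
  moreover have "b = b'" if "?P b" "?P b'" for b b' :: real
  proof -
    have "0 < inverse b - 1" "0 < inverse b' - 1" "kI (inverse b - 1) = 1" "kI (inverse b' - 1) = 1"
      using that unfolding P_iff by (simp_all add: one_less_inverse)
    then have "inverse b - 1 = inverse b' - 1"
      using kI_strict_antimono[of "inverse b - 1" "inverse b' - 1"]
        kI_strict_antimono[of "inverse b' - 1" "inverse b - 1"]
      by (cases "inverse b - 1" "inverse b' - 1" rule: linorder_cases) auto
    then show ?thesis by simp
  qed
  ultimately have "?P kertz"
    unfolding kertz_def using theI'[of ?P] by blast
  then show "0 < kertz" "kertz < 1" "kI (inverse kertz - 1) = 1"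
    unfolding P_iff by auto
qed

section \<open>The value of the threshold policy at a fixed level\<close>

text \<open>
  The primitive of \<open>\<lambda>y. min (- ln y) l\<close> that vanishes at \<open>0\<close>, in a form without case distinction.
\<close>

definition kA :: "real \<Rightarrow> real \<Rightarrow> real" where
  "kA l y = (let w = max y (exp (- l)) in w * (1 - ln w) - exp (- l) - l * (w - y))"

lemma kA_high: "exp (- l) \<le> y \<Longrightarrow> kA l y = y * (1 - ln y) - exp (- l)"
  by (simp add: kA_def max_def)

lemma kA_low: "y \<le> exp (- l) \<Longrightarrow> kA l y = l * y"
  by (simp add: kA_def max_def algebra_simps)

lemma continuous_on_kA: "continuous_on S (kA l)"
proof -
  have pos: "0 < max y (exp (- l))" for y using exp_gt_zero[of "- l"] by (metis max.strict_coboundedI2)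
  then have "max y (exp (- l)) \<noteq> 0" for y by (metis less_irrefl)
  with pos show ?thesis
    unfolding kA_def Let_def by (intro continuous_intros) auto
qed

lemma has_real_derivative_kA:
  assumes "0 < y" "y \<noteq> exp (- l)"
  shows "(kA l has_real_derivative min (- ln y) l) (at y)"
proof (cases "exp (- l) < y")
  case True
  then have "- l < ln y" using assms(1) ln_less_cancel_iff[of "exp (- l)" y] by simp
  then have m: "min (- ln y) l = - ln y" by simp
  have "((\<lambda>y. y * (1 - ln y) - exp (- l)) has_real_derivative - ln y) (at y)"
    using assms(1) by (auto intro!: derivative_eq_intros)
  then show ?thesis unfolding m
    by (rule has_field_derivative_transform_within_open[where S = "{exp (- l)<..}"])
       (use True in \<open>auto simp: kA_high\<close>)
next
  case False
  then have "y < exp (- l)" using assms by simp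
  then have "ln y < - l" using assms(1) ln_less_cancel_iff[of y "exp (- l)"] by simp
  then have m: "min (- ln y) l = l" by simp
  have "((\<lambda>y. l * y) has_real_derivative l) (at y)"
    by (auto intro!: derivative_eq_intros)
  then show ?thesis unfolding m
    by (rule has_field_derivative_transform_within_open[where S = "{..<exp (- l)}"])
       (use \<open>y < exp (- l)\<close> in \<open>auto simp: kA_low\<close>)
qed

lemma kA_0 [simp]: "kA l 0 = 0"
  by (simp add: kA_low)

lemma kA_1: "0 \<le> l \<Longrightarrow> kA l 1 = 1 - exp (- l)"
  by (simp add: kA_high)

lemma kA_nonneg:
  assumes "0 \<le> l" "0 \<le> y" "y \<le> 1"
  shows "0 \<le> kA l y"
proof -
  have "kA l 0 \<le> kA l y"
  proof (rule mono_if_derivative_nonneg_except[where f = "kA l" and c = "exp (- l)"])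
    fix x assume "0 < x" "x < y" "x \<noteq> exp (- l)"
    with has_real_derivative_kA[of x l] assms show "\<exists>d\<ge>0. (kA l has_real_derivative d) (at x)"
      by (intro exI[of _ "min (- ln x) l"]) auto
  qed (use assms continuous_on_kA in auto)
  then show ?thesis by simp
qed

text \<open>The sign condition behind the monotonicity of \<open>kPhi\<close>. On either side of
  \<open>exp (- l)\<close> a factor cancels: above it \<open>- ln y\<close>, leaving
  \<open>kA l y \<le> kf c y\<close>; below it \<open>l\<close>, leaving
  \<open>- ln y * y \<le> kf c y\<close>.\<close>

lemma ln_times_kA_le:
  assumes "0 < c" "0 \<le> l" "0 < y" "y \<le> 1"
  shows "- ln y * kA l y \<le> min (- ln y) l * kf c y"
proof (cases "exp (- l) \<le> y")
  case True
  then have "- l \<le> ln y" using assms ln_le_cancel_iff[of "exp (- l)" y] by simp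
  then have m: "min (- ln y) l = - ln y" by simp
  have "kA l y \<le> kf c y" using True assms by (simp add: kA_high kf_def algebra_simps add_increasing2)
  then show ?thesis unfolding m using assms by (intro mult_left_mono) auto
next
  case False
  then have y: "y < exp (- l)" by simp
  then have "ln y < - l" using assms(3) ln_less_cancel_iff[of y "exp (- l)"] by simp
  then have m: "min (- ln y) l = l" by simp
  have "- ln y * y \<le> kf c y" using assms by (simp add: kf_def algebra_simps)
  then have "l * (- ln y * y) \<le> l * kf c y" using assms by (intro mult_left_mono) auto
  with y show ?thesis unfolding m by (simp add: kA_low mult.left_commute)
qed

lemma kA_le_kf:
  assumes "0 < c" "0 \<le> l" "0 \<le> y" "y \<le> 1"
  shows "kA l y \<le> kf c y"
proof -
  have "kf c 0 - kA l 0 \<le> kf c y - kA l y"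
  proof (rule mono_if_derivative_nonneg_except[where f = "\<lambda>y. kf c y - kA l y" and c = "exp (- l)"])
    fix x assume x: "0 < x" "x < y" "x \<noteq> exp (- l)"
    have "((\<lambda>y. kf c y - kA l y) has_real_derivative (- ln x - min (- ln x) l)) (at x)"
      by (intro DERIV_diff has_real_derivative_kA has_real_derivative_kf x)
    then show "\<exists>d\<ge>0. ((\<lambda>y. kf c y - kA l y) has_real_derivative d) (at x)"
      by (intro exI[of _ "- ln x - min (- ln x) l"]) auto
  qed (use assms continuous_on_kA in \<open>auto intro!: continuous_intros continuous_on_subset[OF continuous_on_kf]\<close>)
  then show ?thesis using assms by simp
qed

text \<open>Let \<open>kH c y\<close> be the time that is left and \<open>r = - ln y\<close>. In
  this time \<open>kPhi\<close> solves \<open>Phi' = min r l - r * Phi\<close> and vanishes at time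
  \<open>0\<close>: it is the probability that a policy accepting at rate \<open>r\<close> ends with
  a value above a level that is exceeded at rate \<open>l\<close>. At \<open>y = 1\<close> it equals
  \<open>(1 - exp (- l)) / (c + 1)\<close>, and \<open>1 / (c + 1)\<close> is \<beta>.\<close>

definition kPhi :: "real \<Rightarrow> real \<Rightarrow> real \<Rightarrow> real" where
  "kPhi c l y = kA l y / kf c y"

lemma kPhi_bounds:
  assumes "0 < c" "0 \<le> l" "0 \<le> y" "y \<le> 1"
  shows "0 \<le> kPhi c l y" "kPhi c l y \<le> 1"
  using kA_nonneg[of l y] kA_le_kf[of c l y] kf_pos[of c y] assms by (auto simp: kPhi_def)

lemma continuous_on_kPhi:
  assumes "0 < c"
  shows "continuous_on {0..1} (kPhi c l)"
  unfolding kPhi_def using kf_pos[OF assms]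
  by (intro continuous_intros continuous_on_kA continuous_on_kf) force

lemma has_real_derivative_kPhi:
  assumes "0 < c" "0 < y" "y < 1" "y \<noteq> exp (- l)"
  shows "(kPhi c l has_real_derivative (min (- ln y) l + ln y * kPhi c l y) / kf c y) (at y)"
proof -
  have f: "kf c y > 0" using kf_pos assms by simp
  show ?thesis unfolding kPhi_def
    using f assms
    by (auto intro!: derivative_eq_intros has_real_derivative_kA has_real_derivative_kf
        simp: field_simps)
qed

lemma kPhi_mono:
  assumes "0 < c" "0 \<le> l" "0 \<le> a" "a \<le> b" "b \<le> 1"
  shows "kPhi c l a \<le> kPhi c l b"
proof (rule mono_if_derivative_nonneg_except[where f = "kPhi c l" and c = "exp (- l)"])
  fix x assume x: "a < x" "x < b" "x \<noteq> exp (- l)"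
  have f: "kf c x > 0" using kf_pos[of c x] x assms by simp
  have "- ln x * kA l x \<le> min (- ln x) l * kf c x"
    using ln_times_kA_le[of c l x] assms x by simp
  then have "- ln x * kA l x / kf c x \<le> min (- ln x) l"
    unfolding pos_divide_le_eq[OF f] .
  then have "- ln x * kPhi c l x \<le> min (- ln x) l"
    by (simp add: kPhi_def)
  then have "0 \<le> (min (- ln x) l + ln x * kPhi c l x) / kf c x"
    using f by (intro divide_nonneg_pos) auto
  then show "\<exists>d\<ge>0. (kPhi c l has_real_derivative d) (at x)"
    using has_real_derivative_kPhi[of c x l] x assms by auto
qed (use assms continuous_on_subset[OF continuous_on_kPhi] in auto)

section \<open>The time change and the discrete step\<close>

definition kH :: "real \<Rightarrow> real \<Rightarrow> real" where
  "kH c y = integral {0..y} (\<lambda>y. inverse (kf c y))"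

lemma kH_0 [simp]: "kH c 0 = 0"
  by (simp add: kH_def)

lemma kH_1: "kH c 1 = kI c"
  by (simp add: kH_def kI_def)

lemma continuous_on_kH: "0 < c \<Longrightarrow> continuous_on {0..1} (kH c)"
  unfolding kH_def by (intro indefinite_integral_continuous_1 integrable_inverse_kf)

lemma has_real_derivative_kH:
  assumes "0 < c" "0 < y" "y < 1"
  shows "(kH c has_real_derivative inverse (kf c y)) (at y)"
proof -
  have "(kH c has_real_derivative inverse (kf c y)) (at y within {0..1})"
    unfolding kH_def using assms
    by (intro integral_has_real_derivative continuous_on_inverse_kf) auto
  then show ?thesis using assms by (simp add: at_within_Icc_at)
qed

text \<open>An Euler step without discretization error. As \<open>kPhi\<close> increases, its value
  in the loss term may be frozen at the left end. The gain \<open>min (- ln x) l\<close> is at most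
  either of its arguments, and both resulting bounds have explicit primitives,
  \<open>l * kH c x\<close> and \<open>ln (kf c x)\<close>.\<close>

lemma kPhi_step:
  assumes c: "0 < c" and l: "0 \<le> l" and ab: "0 \<le> a" "a \<le> b" "b \<le> 1"
  shows "kPhi c l b \<le> (1 - (ln (kf c b) - ln (kf c a))) * kPhi c l a
      + min (l * (kH c b - kH c a)) (ln (kf c b) - ln (kf c a))"
proof -
  define p where "p = kPhi c l a"
  have sub: "continuous_on {a..b} f" if "continuous_on {0..1} f" for f :: "real \<Rightarrow> real"
    by (rule continuous_on_subset[OF that]) (use ab in auto)
  have "continuous_on {0..1} (\<lambda>y. ln (kf c y))"
    using kf_pos[OF c] by (intro continuous_on_ln continuous_on_kf) (metis atLeastAtMost_iff less_irrefl)
  note cont = this[THEN sub] continuous_on_kH[OF c, THEN sub] continuous_on_kPhi[OF c, THEN sub]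
  have dln: "((\<lambda>y. ln (kf c y)) has_real_derivative - ln x / kf c x) (at x)" if "a < x" "x < b" for x
    using kf_pos[of c x] that ab c
    by (auto intro!: derivative_eq_intros has_real_derivative_kf simp: field_simps)
  have pm: "p \<le> kPhi c l x" if "a < x" "x < b" for x
    unfolding p_def using kPhi_mono[of c l a x] that assms by simp
  have "l * kH c a - p * ln (kf c a) - kPhi c l a \<le> l * kH c b - p * ln (kf c b) - kPhi c l b"
  proof (rule mono_if_derivative_nonneg_except[where f = "\<lambda>x. l * kH c x - p * ln (kf c x) - kPhi c l x" and c = "exp (- l)"])
    fix x assume x: "a < x" "x < b" "x \<noteq> exp (- l)"
    have f: "kf c x > 0" using kf_pos[of c x] x assms by simp
    let ?d = "l * inverse (kf c x) - p * (- ln x / kf c x)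
        - (min (- ln x) l + ln x * kPhi c l x) / kf c x"
    have "((\<lambda>x. l * kH c x - p * ln (kf c x) - kPhi c l x) has_real_derivative ?d) (at x)"
      by (intro DERIV_diff DERIV_cmult dln has_real_derivative_kH has_real_derivative_kPhi c)
         (use x ab in auto)
    moreover have "?d = (l - min (- ln x) l + (- ln x) * (kPhi c l x - p)) / kf c x"
      using f by (simp add: field_simps)
    moreover have "0 \<le> \<dots>"
      using f pm[OF x(1,2)] x ab by (intro divide_nonneg_pos add_nonneg_nonneg mult_nonneg_nonneg) auto
    ultimately show "\<exists>d\<ge>0. ((\<lambda>x. l * kH c x - p * ln (kf c x) - kPhi c l x)
        has_real_derivative d) (at x)" by (intro exI[of _ ?d]) (simp only: simp_thms)
  qed (use ab in \<open>auto intro!: continuous_on_diff continuous_on_mult_left cont\<close>)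
  moreover have "(1 - p) * ln (kf c a) - kPhi c l a \<le> (1 - p) * ln (kf c b) - kPhi c l b"
  proof (rule mono_if_derivative_nonneg_except[where f = "\<lambda>x. (1 - p) * ln (kf c x) - kPhi c l x" and c = "exp (- l)"])
    fix x assume x: "a < x" "x < b" "x \<noteq> exp (- l)"
    have f: "kf c x > 0" using kf_pos[of c x] x assms by simp
    let ?d = "(1 - p) * (- ln x / kf c x) - (min (- ln x) l + ln x * kPhi c l x) / kf c x"
    have "((\<lambda>x. (1 - p) * ln (kf c x) - kPhi c l x) has_real_derivative ?d) (at x)"
      by (intro DERIV_diff DERIV_cmult dln has_real_derivative_kPhi c)
         (use x ab in auto)
    moreover have "?d = (- ln x - min (- ln x) l + (- ln x) * (kPhi c l x - p)) / kf c x"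
      using f by (simp add: field_simps)
    moreover have "0 \<le> \<dots>"
      using f pm[OF x(1,2)] x ab by (intro divide_nonneg_pos add_nonneg_nonneg mult_nonneg_nonneg) auto
    ultimately show "\<exists>d\<ge>0. ((\<lambda>x. (1 - p) * ln (kf c x) - kPhi c l x)
        has_real_derivative d) (at x)" by (intro exI[of _ ?d]) (simp only: simp_thms)
  qed (use ab in \<open>auto intro!: continuous_on_diff continuous_on_mult_left cont\<close>)
  ultimately show ?thesis
    unfolding p_def by (cases "l * (kH c b - kH c a) \<le> ln (kf c b) - ln (kf c a)") (simp_all add: algebra_simps)
qed

lemma borel_measurable_kPhi [measurable]: "(\<lambda>l. kPhi c l y) \<in> borel_measurable borel"
  unfolding kPhi_def kA_def Let_def by measurable

text \<open>
  The functions are \<open>P k l = kPhi c l (y k)\<close> for levels \<open>y k\<close> with \<open>kH c (y k) = 1 - k / M\<close>, that is,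
  the differential equation of the Kertz constant is sampled at equidistant times.
\<close>

lemma kertz_levels:
  fixes M :: nat
  assumes "0 < M"
  obtains lam :: "nat \<Rightarrow> real" and P :: "nat \<Rightarrow> real \<Rightarrow> real" where
    "\<forall>k<M. 0 \<le> lam k"
    "\<forall>k<M. \<forall>l\<ge>0. P k l \<le> (1 - lam k / M) * P (Suc k) l + min l (lam k) / M"
    "\<forall>l\<ge>0. P 0 l = kertz * (1 - exp (- l))" "\<forall>l\<ge>0. P M l = 0"
    "\<forall>k\<le>M. \<forall>l\<ge>0. 0 \<le> P k l \<and> P k l \<le> 1"
    "\<forall>k. P k \<in> borel_measurable borel"
proof -
  define c where "c = inverse kertz - 1"
  have c: "0 < c" "kI c = 1"
    using kertz_works by (auto simp: c_def field_simps)
  have "\<exists>y. 0 \<le> y \<and> y \<le> 1 \<and> kH c y = 1 - real k / M \<and> (k = 0 \<longrightarrow> y = 1) \<and> (k = M \<longrightarrow> y = 0)"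
    if "k \<le> M" for k
  proof -
    consider "k = 0" | "k = M" | "0 < k" "k < M" using \<open>k \<le> M\<close> by linarith
    then show ?thesis
    proof cases
      case 3
      have "\<exists>y\<ge>0. y \<le> 1 \<and> kH c y = 1 - real k / M"
        by (rule IVT') (use 3 c continuous_on_kH[OF c(1)] in \<open>auto simp: kH_1\<close>)
      with 3 show ?thesis by auto
    qed (use c assms in \<open>auto simp: kH_1 intro: exI[of _ "1 :: real"] exI[of _ "0 :: real"]\<close>)
  qed
  then obtain y where y: "\<And>k. k \<le> M \<Longrightarrow> 0 \<le> y k \<and> y k \<le> 1 \<and> kH c (y k) = 1 - real k / M \<and>
      (k = 0 \<longrightarrow> y k = 1) \<and> (k = M \<longrightarrow> y k = 0)"
    by metis
  have H_mono: "kH c a \<le> kH c b" if "0 \<le> a" "a \<le> b" "b \<le> 1" for a b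
  proof (rule mono_if_derivative_nonneg_except[where f = "kH c" and c = a])
    fix x assume "a < x" "x < b"
    then show "\<exists>d\<ge>0. (kH c has_real_derivative d) (at x)"
      using has_real_derivative_kH[OF c(1), of x] kf_pos[OF c(1), of x] that
      by (intro exI[of _ "inverse (kf c x)"]) auto
  qed (use that continuous_on_subset[OF continuous_on_kH[OF c(1)]] in auto)
  have y_le: "y (Suc k) \<le> y k" if "k < M" for k
  proof (rule ccontr)
    assume "\<not> ?thesis"
    then have "kH c (y k) \<le> kH c (y (Suc k))"
      using y[of k] y[of "Suc k"] that by (intro H_mono) auto
    then show False
      using y[of k] y[of "Suc k"] that by (simp add: divide_le_cancel)
  qed
  \<comment> \<open>The increase of \<open>ln (kf c y)\<close> is the integral of the acceptance
    rate \<open>- ln y\<close> over a time step of length \<open>1 / M\<close>, so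
    \<open>lam k\<close> is the mean rate in that step.\<close>
  show ?thesis
  proof (rule that[where P = "\<lambda>k l. kPhi c l (y k)"
        and lam = "\<lambda>k. real M * (ln (kf c (y k)) - ln (kf c (y (Suc k))))"]; (intro allI impI)?)
    fix k assume k: "k < M"
    have "kf c (y (Suc k)) \<le> kf c (y k)"
      using y_le[OF k] y[of k] y[of "Suc k"] k by (intro kf_mono) auto
    then have "ln (kf c (y (Suc k))) \<le> ln (kf c (y k))"
      using y[of k] y[of "Suc k"] k kf_pos[OF c(1)] by (subst ln_le_cancel_iff) auto
    then show "0 \<le> real M * (ln (kf c (y k)) - ln (kf c (y (Suc k))))" by simp
  next
    fix k and l :: real assume k: "k < M" and l: "0 \<le> l"
    have H: "kH c (y k) - kH c (y (Suc k)) = 1 / M"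
      using y[of k] y[of "Suc k"] k assms by (simp add: diff_divide_distrib[symmetric])
    have "min l (real M * d) / M = min (l / M) d" for d
      using assms by (simp add: min_def field_simps)
    moreover have "kPhi c l (y k) \<le> (1 - (ln (kf c (y k)) - ln (kf c (y (Suc k))))) * kPhi c l (y (Suc k))
      + min (l * (1 / M)) (ln (kf c (y k)) - ln (kf c (y (Suc k))))"
      using kPhi_step[OF c(1) l, of "y (Suc k)" "y k"] y_le[OF k] y[of k] y[of "Suc k"] k
      unfolding H by simp
    ultimately show "kPhi c l (y k) \<le> (1 - real M * (ln (kf c (y k)) - ln (kf c (y (Suc k)))) / real M) *
        kPhi c l (y (Suc k)) + min l (real M * (ln (kf c (y k)) - ln (kf c (y (Suc k))))) / real M"
      using assms by simp
  next
    show "kPhi c l (y 0) = kertz * (1 - exp (- l))" if "0 \<le> l" for l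
      using that y[of 0] by (simp add: kPhi_def kA_1 c_def field_simps)
    show "kPhi c l (y M) = 0" for l using y[of M] by (simp add: kPhi_def)
  qed (use y kPhi_bounds[OF c(1)] in auto)
qed

section \<open>The dynamic program\<close>

lemma integrable_bounded_Icc:
  fixes g :: "real \<Rightarrow> real"
  assumes [measurable]: "g \<in> borel_measurable borel" and b: "\<And>v. v \<in> {a..b} \<Longrightarrow> \<bar>g v\<bar> \<le> C"
  shows "integrable lborel (\<lambda>v. indicator {a..b} v * g v)"
proof (rule Bochner_Integration.integrable_bound)
  show "integrable lborel (\<lambda>v. indicator {a..b} v *\<^sub>R C)"
    by (cases "a \<le> b") auto
  show "AE v in lborel. norm (indicator {a..b} v * g v) \<le> norm (indicator {a..b} v *\<^sub>R C)"
    using b by (intro AE_I2) (force simp: indicator_def)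
qed measurable

lemma borel_measurable_antimono:
  fixes L :: "real \<Rightarrow> real"
  assumes "antimono L"
  shows "L \<in> borel_measurable borel"
proof -
  have "mono (\<lambda>v. - L v)" using assms by (auto simp: mono_def antimono_def)
  then have "(\<lambda>v. - (- L v)) \<in> borel_measurable borel"
    by (intro borel_measurable_uminus borel_measurable_mono)
  then show ?thesis by simp
qed

text \<open>
  By backward induction, \<open>Z k\<close> is at least the integral of \<open>P k (L v)\<close> over \<open>v \<in> {0..B}\<close>.
\<close>

lemma kertz_dp:
  fixes L :: "real \<Rightarrow> real" and Z :: "nat \<Rightarrow> real" and M :: nat
  assumes M: "0 < M" and B: "0 \<le> B" and anti: "antimono L"
    and L0: "\<And>v. 0 \<le> L v" and LM: "\<And>v. 0 \<le> v \<Longrightarrow> L v \<le> M"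
    and Z_M: "Z M = 0"
    and Z: "\<And>k. k < M \<Longrightarrow> Z k = Z (Suc k) + (LINT v|lborel. indicator {Z (Suc k)..B} v * L v) / M"
  shows "kertz * (LINT v|lborel. indicator {0..B} v * (1 - exp (- L v))) \<le> Z 0"
    and "\<And>k. k \<le> M \<Longrightarrow> 0 \<le> Z k" and "\<And>k. k \<le> M \<Longrightarrow> Z k \<le> B"
proof -
  note [measurable] = borel_measurable_antimono[OF anti]
  define II where "II = (\<lambda>(a :: real) b g. LINT v|lborel. indicator {a..b} v * (g v :: real))"
  have intL: "integrable lborel (\<lambda>v. indicator {a..b} v * L v)" if "0 \<le> a" for a b
    by (rule integrable_bounded_Icc[where C = M]) (use L0 LM that in \<open>auto simp: abs_of_nonneg\<close>)
  have intc: "integrable lborel (\<lambda>v. indicator {a..b} v * c)" for a b c :: real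
    by (rule integrable_bounded_Icc[where C = "\<bar>c\<bar>"]) auto
  have IIc: "II a b (\<lambda>_. c) = (b - a) * c" if "a \<le> b" for a b c
    using that by (simp add: II_def)
  have IIL0: "0 \<le> II z B L" for z
    unfolding II_def using L0 by (intro integral_nonneg_AE) auto
  have IILM: "II z B L \<le> II z z' (\<lambda>_. real M) + II z' B L" if "0 \<le> z" "z \<le> z'" "z' \<le> B" for z z'
  proof -
    have "II z B L \<le> (LINT v|lborel. indicator {z..z'} v * real M + indicator {z'..B} v * L v)"
      unfolding II_def
    proof (intro integral_mono Bochner_Integration.integrable_add intL intc)
      show "indicator {z..B} v * L v \<le> indicator {z..z'} v * real M + indicator {z'..B} v * L v" for v
        using that L0[of v] LM[of v] by (auto simp: indicator_def)
    qed (use that in auto)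
    also have "\<dots> = II z z' (\<lambda>_. real M) + II z' B L"
      unfolding II_def by (intro Bochner_Integration.integral_add intL intc) (use that in auto)
    finally show ?thesis .
  qed
  have IImin: "II 0 B (\<lambda>v. min (L v) l) \<le> l * z + II z B L" if "0 \<le> l" "0 \<le> z" "z \<le> B" for l z
  proof -
    have "II 0 B (\<lambda>v. min (L v) l) \<le> (LINT v|lborel. indicator {0..z} v * l + indicator {z..B} v * L v)"
      unfolding II_def
    proof (intro integral_mono Bochner_Integration.integrable_add intL intc
        integrable_bounded_Icc[where C = l])
      show "\<bar>min (L v) l\<bar> \<le> l" for v using that L0[of v] by auto
      show "indicator {0..B} v * min (L v) l \<le> indicator {0..z} v * l + indicator {z..B} v * L v" for v
        using that L0[of v] by (auto simp: indicator_def)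
    qed (use that in auto)
    also have "\<dots> = II 0 z (\<lambda>_. l) + II z B L"
      unfolding II_def by (intro Bochner_Integration.integral_add intL intc) (use that in auto)
    finally show ?thesis using that by (simp add: IIc mult.commute)
  qed
  \<comment> \<open>As \<open>L\<close> is at most \<open>M\<close>, one step adds at most the
    distance from \<open>Z (Suc k)\<close> to \<open>B\<close>.\<close>
  have Zb: "0 \<le> Z k \<and> Z k \<le> B" if "k \<le> M" for k
    using that
  proof (induction rule: inc_induct)
    case (step k)
    then have "II (Z (Suc k)) B L \<le> (B - Z (Suc k)) * M + II B B L"
      using IILM[of "Z (Suc k)" B] by (simp add: IIc)
    also have "II B B L = 0"
    proof -
      have "AE v in lborel. indicator {B..B} v * L v = 0"
      proof (rule AE_mp[OF AE_lborel_singleton[of B]])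
        show "AE v in lborel. v \<noteq> B \<longrightarrow> indicator {B..B} v * L v = 0"
          by (auto simp: indicator_def)
      qed
      from integral_cong_AE[OF _ _ this] show ?thesis by (simp add: II_def)
    qed
    finally have "II (Z (Suc k)) B L / M \<le> B - Z (Suc k)"
      using M by (simp add: field_simps)
    moreover have "Z k = Z (Suc k) + II (Z (Suc k)) B L / M"
      using Z[OF step.hyps(2)] by (simp add: II_def)
    ultimately show ?case using step IIL0[of "Z (Suc k)"] by simp
  qed (use Z_M B in auto)
  then show "0 \<le> Z k" "Z k \<le> B" if "k \<le> M" for k using that by auto
  obtain lam :: "nat \<Rightarrow> real" and P :: "nat \<Rightarrow> real \<Rightarrow> real" where
    P: "\<forall>k<M. 0 \<le> lam k"
    "\<forall>k<M. \<forall>l\<ge>0. P k l \<le> (1 - lam k / M) * P (Suc k) l + min l (lam k) / M"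
    "\<forall>l\<ge>0. P 0 l = kertz * (1 - exp (- l))" "\<forall>l\<ge>0. P M l = 0"
    "\<forall>k\<le>M. \<forall>l\<ge>0. 0 \<le> P k l \<and> P k l \<le> 1"
    "\<forall>k. P k \<in> borel_measurable borel"
    by (rule kertz_levels[OF M])
  have lam: "0 \<le> lam k" if "k < M" for k using P(1) that by blast
  have Pstep: "P k l \<le> (1 - lam k / M) * P (Suc k) l + min l (lam k) / M" if "k < M" "0 \<le> l" for k l
    using P(2) that by blast
  have P0: "P 0 l = kertz * (1 - exp (- l))" and PM: "P M l = 0" if "0 \<le> l" for l
    using P(3,4) that by blast+
  have P_nonneg: "0 \<le> P k l" and P_le: "P k l \<le> 1" if "k \<le> M" "0 \<le> l" for k l
    using P(5) that by blast+
  have [measurable]: "P k \<in> borel_measurable borel" for k using P(6) by blast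
  have intP: "integrable lborel (\<lambda>v. indicator {0..B} v * P k (L v))" if "k \<le> M" for k
    by (rule integrable_bounded_Icc[where C = 1])
       (use P_nonneg P_le L0 that in \<open>auto simp: abs_of_nonneg\<close>)
  have "II 0 B (\<lambda>v. P k (L v)) \<le> Z k" if "k \<le> M" for k
    using that
  proof (induction rule: inc_induct)
    case base
    then show ?case using Z_M by (simp add: II_def PM L0)
  next
    case (step k)
    define W where "W = II 0 B (\<lambda>v. P (Suc k) (L v))"
    have "0 \<le> indicator {0..B} v * P (Suc k) (L v)" for v
      using P_nonneg[of "Suc k" "L v"] L0[of v] step by (auto simp: indicator_def)
    then have W: "W \<le> Z (Suc k)" "0 \<le> W"
      using step unfolding W_def II_def by (auto intro!: Bochner_Integration.integral_nonneg)
    have Zk: "0 \<le> Z (Suc k)" "Z (Suc k) \<le> B" using Zb[of "Suc k"] step by auto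
    have "II 0 B (\<lambda>v. P k (L v)) \<le> (LINT v|lborel. (1 - lam k / M) * (indicator {0..B} v * P (Suc k) (L v))
        + (indicator {0..B} v * min (L v) (lam k)) / M)"
      unfolding II_def
    proof (intro integral_mono intP Bochner_Integration.integrable_add integrable_mult_right
        integrable_divide integrable_bounded_Icc[where C = "lam k"])
      fix v
      show "indicator {0..B} v * P k (L v) \<le> (1 - lam k / M) * (indicator {0..B} v * P (Suc k) (L v))
        + (indicator {0..B} v * min (L v) (lam k)) / M"
        using Pstep[OF step.hyps(2) L0[of v]]
        by (auto simp: indicator_def)
    qed (use step lam[of k] L0 in auto)
    also have "\<dots> = (1 - lam k / M) * W + II 0 B (\<lambda>v. min (L v) (lam k)) / M"
      unfolding II_def W_def using step lam[of k] L0
      by (subst Bochner_Integration.integral_add)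
         (auto intro!: intP integrable_bounded_Icc[where C = "lam k"])
    \<comment> \<open>Splitting the integral of the minimum at \<open>W\<close> itself makes the
      terms in \<open>lam k\<close> cancel.\<close>
    also have "\<dots> \<le> (1 - lam k / M) * W + (lam k * W + II W B L) / M"
      using IImin[of "lam k" W] W Zk lam[of k] step M by (intro add_left_mono divide_right_mono) auto
    also have "\<dots> = W + II W B L / M"
      using M by (simp add: field_simps)
    \<comment> \<open>The expression \<open>z + II z B L / M\<close> increases in \<open>z\<close>
      because \<open>L\<close> is at most \<open>M\<close>, so \<open>W\<close> may give way to the
      larger \<open>Z (Suc k)\<close>.\<close>
    also have "\<dots> \<le> W + ((Z (Suc k) - W) * M + II (Z (Suc k)) B L) / M"
      using IILM[of W "Z (Suc k)"] W Zk by (intro add_left_mono divide_right_mono) (auto simp: IIc)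
    also have "\<dots> = Z (Suc k) + II (Z (Suc k)) B L / M"
      using M by (simp add: field_simps)
    also have "\<dots> = Z k"
      using Z[OF step.hyps(2)] by (simp add: II_def)
    finally show ?case .
  qed
  from this[of 0] have "II 0 B (\<lambda>v. P 0 (L v)) \<le> Z 0" by simp
  also have "II 0 B (\<lambda>v. P 0 (L v)) = kertz * II 0 B (\<lambda>v. 1 - exp (- L v))"
    unfolding II_def P0[OF L0] by (simp add: mult.left_commute[of _ kertz])
  finally show "kertz * (LINT v|lborel. indicator {0..B} v * (1 - exp (- L v))) \<le> Z 0"
    by (simp add: II_def)
qed

section \<open>Averages over permutations\<close>

definition pavg :: "'i set \<Rightarrow> ('i list \<Rightarrow> real) \<Rightarrow> real" where
  "pavg I F = (\<Sum>\<pi>\<in>permutations_of_set I. F \<pi>) / fact (card I)"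

text \<open>Relabelling the variables permutes the orders, so every ordered pair of distinct
  variables occupies the positions \<open>p\<close> and \<open>q\<close> equally often.\<close>

lemma pavg_pair:
  fixes G :: "'i \<Rightarrow> 'i \<Rightarrow> real"
  assumes I: "finite I" and p: "p < card I" "q < card I" "p \<noteq> q"
  shows "pavg I (\<lambda>\<pi>. G (\<pi> ! p) (\<pi> ! q)) =
    (\<Sum>i\<in>I. \<Sum>j\<in>I - {i}. G i j) / (real (card I) * (real (card I) - 1))"
proof -
  define S where "S = permutations_of_set I"
  define P where "P = (SIGMA i:I. I - {i})"
  define c where "c = (\<lambda>(i, j). card {\<pi> \<in> S. (\<pi> ! p, \<pi> ! q) = (i, j)})"
  have S: "finite S" by (simp add: S_def)
  have P: "finite P" using I by (simp add: P_def)
  have len: "length \<pi> = card I" "set \<pi> = I" "distinct \<pi>" if "\<pi> \<in> S" for \<pi>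
    using that I by (auto simp: S_def permutations_of_set_def distinct_card)
  have key: "(\<lambda>\<pi>. (\<pi> ! p, \<pi> ! q)) ` S \<subseteq> P"
    using len p by (fastforce simp: P_def nth_eq_iff_index_eq)
  have sum: "(\<Sum>\<pi>\<in>S. F (\<pi> ! p) (\<pi> ! q)) = (\<Sum>(i, j)\<in>P. real (c (i, j)) * F i j)"
    for F :: "'i \<Rightarrow> 'i \<Rightarrow> real"
    by (subst sum.group[OF S P key, symmetric]) (auto simp: c_def intro!: sum.cong)
  have const: "c (i, j) \<le> c (i', j')" if ij: "(i, j) \<in> P" "(i', j') \<in> P" for i j i' j'
  proof -
    \<comment> \<open>The inner transposition takes \<open>i\<close> to \<open>i'\<close>; the outer
      one takes the image of \<open>j\<close> to \<open>j'\<close> and fixes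
      \<open>i'\<close>.\<close>
    define \<tau> where "\<tau> = Transposition.transpose (Transposition.transpose i i' j) j' \<circ> Transposition.transpose i i'"
    have bij: "bij \<tau>" by (auto simp: \<tau>_def intro: bij_comp)
    have "\<tau> i = i'" "\<tau> j = j'"
      using ij by (auto simp: \<tau>_def P_def Transposition.transpose_def)
    have im: "\<tau> ` I = I"
    proof -
      have "Transposition.transpose i i' ` I = I" "Transposition.transpose i i' j \<in> I" using ij by (auto simp: P_def Transposition.transpose_def)
      then show ?thesis using ij unfolding \<tau>_def image_comp[symmetric] by (simp add: P_def)
    qed
    have inj: "inj_on \<tau> A" for A using bij by (meson bij_is_inj inj_on_subset subset_UNIV)
    have mS: "map \<tau> \<pi> \<in> S" if "\<pi> \<in> S" for \<pi>
      using permutations_of_set_image_inj[OF inj, of I] that im by (auto simp: S_def)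
    show ?thesis
      unfolding c_def prod.case
    proof (rule card_inj_on_le[of "map \<tau>"])
      show "inj_on (map \<tau>) {\<pi> \<in> S. (\<pi> ! p, \<pi> ! q) = (i, j)}"
        by (rule inj_on_subset[OF inj_mapI[OF bij_is_inj[OF bij]]]) simp
    qed (use S mS len p \<open>\<tau> i = i'\<close> \<open>\<tau> j = j'\<close> in auto)
  qed
  have "P \<noteq> {}"
  proof -
    have "2 \<le> card I" using p by linarith
    then obtain i j where "i \<in> I" "j \<in> I" "i \<noteq> j"
      by (metis card_2_iff' card_le_Suc0_iff_eq[OF I] not_less_eq_eq numeral_2_eq_2)
    then show ?thesis by (auto simp: P_def)
  qed
  then obtain z where z: "z \<in> P" by blast
  have cz: "c x = c z" if "x \<in> P" for x
    using const[of "fst x" "snd x" "fst z" "snd z"] const[of "fst z" "snd z" "fst x" "snd x"] that z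
    by simp
  have sum': "(\<Sum>\<pi>\<in>S. F (\<pi> ! p) (\<pi> ! q)) = real (c z) * (\<Sum>(i, j)\<in>P. F i j)"
    for F :: "'i \<Rightarrow> 'i \<Rightarrow> real"
    unfolding sum sum_distrib_left by (rule sum.cong) (auto simp: cz)
  \<comment> \<open>The constant function \<open>1\<close> determines the common count.\<close>
  have "real (fact (card I)) = real (c z) * real (card P)"
    using sum'[of "\<lambda>_ _. 1"] I by (simp add: S_def)
  moreover have "card P = card I * (card I - 1)"
    using I by (simp add: P_def)
  ultimately have "fact (card I) = real (c z) * (real (card I) * (real (card I) - 1))"
    using p by (simp add: of_nat_diff)
  moreover from this have "real (c z) \<noteq> 0" by (metis fact_nonzero mult_zero_left)
  moreover have "(\<Sum>(i, j)\<in>P. G i j) = (\<Sum>i\<in>I. \<Sum>j\<in>I - {i}. G i j)"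
    unfolding P_def by (rule sum.Sigma[symmetric]) (use I in auto)
  ultimately show ?thesis
    using sum'[of G] by (simp add: pavg_def S_def)
qed

lemma pavg_single:
  assumes I: "finite I" and p: "p < card I" "2 \<le> card I"
  shows "pavg I (\<lambda>\<pi>. F (\<pi> ! p)) = (\<Sum>i\<in>I. F i) / card I"
proof -
  define q :: nat where "q = (if p = 0 then 1 else 0)"
  have q: "q < card I" "p \<noteq> q" using p by (auto simp: q_def)
  have "(\<Sum>i\<in>I. \<Sum>j\<in>I - {i}. F i) = (real (card I) - 1) * (\<Sum>i\<in>I. F i)"
    using I p by (simp add: sum_distrib_left of_nat_diff)
  with pavg_pair[OF I p(1) q, of "\<lambda>i j. F i"] p show ?thesis by simp
qed

lemma pavg_mono:
  assumes "finite I"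
    and "\<And>\<pi>. length \<pi> = card I \<Longrightarrow> set \<pi> = I \<Longrightarrow> distinct \<pi> \<Longrightarrow> F \<pi> \<le> G \<pi>"
  shows "pavg I F \<le> pavg I G"
  unfolding pavg_def using assms
  by (intro divide_right_mono sum_mono) (auto simp: permutations_of_set_def distinct_card)

lemma pavg_add: "pavg I (\<lambda>\<pi>. F \<pi> + G \<pi>) = pavg I F + pavg I G"
  by (simp add: pavg_def sum.distrib add_divide_distrib)

lemma pavg_diff: "pavg I (\<lambda>\<pi>. F \<pi> - G \<pi>) = pavg I F - pavg I G"
  by (simp add: pavg_def sum_subtractf diff_divide_distrib)

lemma pavg_cmult: "pavg I (\<lambda>\<pi>. c * F \<pi>) = c * pavg I F"
  by (simp add: pavg_def sum_distrib_left)

lemma pavg_sum: "pavg I (\<lambda>\<pi>. \<Sum>x\<in>A. F x \<pi>) = (\<Sum>x\<in>A. pavg I (F x))"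
  unfolding pavg_def by (subst sum.swap) (simp add: sum_divide_distrib)

lemma pavg_const: "finite I \<Longrightarrow> pavg I (\<lambda>_. c) = c"
  by (simp add: pavg_def)

text \<open>
  The expected reward when position \<open>k\<close> accepts variable \<open>i\<close> with probability \<open>a k i\<close> and \<open>g k i\<close> is
  the expected accepted value.
\<close>

fun order_reward :: "(nat \<Rightarrow> 'i \<Rightarrow> real) \<Rightarrow> (nat \<Rightarrow> 'i \<Rightarrow> real) \<Rightarrow> nat \<Rightarrow> 'i list \<Rightarrow> real" where
  "order_reward a g k [] = 0"
| "order_reward a g k (i # is) = g k i + (1 - a k i) * order_reward a g (Suc k) is"

text \<open>Every accepted value is split into the base \<open>T\<close> and a surplus. The base is
  then earned with the total probability of acceptance, whatever the position, and only the surplus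
  is weighted with survival probabilities.\<close>

lemma order_reward_eq:
  "order_reward a g k \<pi> = T * (1 - (\<Prod>p<length \<pi>. 1 - a (k + p) (\<pi> ! p))) +
    (\<Sum>m<length \<pi>. (\<Prod>p<m. 1 - a (k + p) (\<pi> ! p)) * (g (k + m) (\<pi> ! m) - T * a (k + m) (\<pi> ! m)))"
proof (induction \<pi> arbitrary: k)
  case (Cons i \<pi>)
  show ?case
    unfolding order_reward.simps Cons.IH[of "Suc k"] list.size add_Suc_right add_0_right
      prod.lessThan_Suc_shift sum.lessThan_Suc_shift
    by (simp add: algebra_simps sum_distrib_left)
qed simp

text \<open>Unrolls a linear recursion into the kind of survival-weighted sum that
  \<open>order_reward_eq\<close> produces, so that the two can be compared term by term.\<close>

lemma sum_survival_telescope: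
  fixes Z x y :: "nat \<Rightarrow> real"
  assumes "\<And>k. k < M \<Longrightarrow> Z k = (1 - y k) * Z (Suc k) + x k"
  shows "m \<le> M \<Longrightarrow> Z 0 = (\<Sum>k<m. (\<Prod>p<k. 1 - y p) * x k) + (\<Prod>p<m. 1 - y p) * Z m"
proof (induction m)
  case (Suc m)
  then show ?case using assms[of m] by (simp add: algebra_simps)
qed simp

text \<open>The converse of \<open>1 - x \<le> exp (- x)\<close> at the price of a stretched
  exponent; it comes from \<open>1 / (1 - x) = 1 + x / (1 - x)\<close>.\<close>

lemma one_minus_ge_exp:
  fixes x c :: real
  assumes "0 \<le> x" "x \<le> c" "c < 1"
  shows "exp (- (x / (1 - c))) \<le> 1 - x"
proof -
  have "1 / (1 - x) = 1 + x / (1 - x)" using assms by (simp add: field_simps)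
  also have "\<dots> \<le> exp (x / (1 - x))" by simp
  finally have "exp (- (x / (1 - x))) \<le> 1 - x"
    using assms by (simp add: exp_minus field_simps)
  moreover have "x / (1 - x) \<le> x / (1 - c)"
    using assms by (intro divide_left_mono) auto
  ultimately show ?thesis by (smt (verit) exp_le_cancel_iff)
qed

text \<open>If \<open>y < \<mu> / 2\<close>, the second summand alone is at least
  \<open>1\<close>.\<close>

lemma exp_neg_le_deviation:
  fixes y \<mu> :: real
  assumes "0 \<le> y" "0 < \<mu>"
  shows "exp (- y) \<le> exp (- (\<mu> / 2)) + 4 * (y - \<mu>)\<^sup>2 / \<mu>\<^sup>2"
proof (cases "\<mu> / 2 \<le> y")
  case True
  then have "exp (- y) \<le> exp (- (\<mu> / 2))" by simp
  moreover have "0 \<le> 4 * (y - \<mu>)\<^sup>2 / \<mu>\<^sup>2" by simp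
  ultimately show ?thesis by linarith
next
  case False
  then have "(\<mu> / 2)\<^sup>2 \<le> (\<mu> - y)\<^sup>2" using assms by (intro power_mono) auto
  then have "1 \<le> 4 * (y - \<mu>)\<^sup>2 / \<mu>\<^sup>2"
    using assms by (simp add: power_divide power2_commute)
  moreover have "exp (- y) \<le> 1" using assms by simp
  ultimately show ?thesis by (smt (verit) exp_gt_zero)
qed

text \<open>
  The product is bounded below by the exponential of a sum, and the exponential by its tangent at the
  mean, so that only the two-point marginals of a random permutation enter.
\<close>

lemma pavg_survival_early:
  fixes a :: "nat \<Rightarrow> 'i \<Rightarrow> real" and M :: nat
  assumes I: "finite I" "card I = n" "2 \<le> n" and k: "k < n" "k \<le> M" and M: "0 < M"
    and \<epsilon>: "\<epsilon> < 1" "real M \<le> (1 - \<epsilon>) * (real n - 1)"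
    and a: "\<And>p i. p < k \<Longrightarrow> i \<in> I \<Longrightarrow> 0 \<le> a p i \<and> a p i \<le> \<epsilon>"
    and y: "\<And>p. p < k \<Longrightarrow> (\<Sum>i\<in>I. a p i) \<le> M"
    and e: "\<And>i. i \<in> I \<Longrightarrow> 0 \<le> e i"
  shows "(\<Prod>p<k. 1 - (\<Sum>i\<in>I. a p i) / M) * ((\<Sum>i\<in>I. e i) / n)
    \<le> pavg I (\<lambda>\<pi>. (\<Prod>p<k. 1 - a p (\<pi> ! p)) * e (\<pi> ! k))"
proof -
  define g where "g = 1 / (1 - \<epsilon>)"
  have g: "0 < g" using \<epsilon> by (simp add: g_def)
  define A where "A = (\<lambda>p. \<Sum>i\<in>I. a p i)"
  define E where "E = (\<Sum>i\<in>I. e i)"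
  define W where "W = (\<lambda>\<pi>. - (\<Sum>p<k. g * a p (\<pi> ! p)))"
  \<comment> \<open>Given the variable at position \<open>k\<close>, the one at an earlier position
    is uniform among the other \<open>n - 1\<close>; accordingly \<open>w\<close> bounds the
    \<open>e\<close>-weighted mean of \<open>W\<close> from below.\<close>
  define w where "w = - (\<Sum>p<k. g * (A p / (real n - 1)))"
  have E: "0 \<le> E" using e by (auto simp: E_def intro: sum_nonneg)
  have n: "0 < real n - 1" "0 < real n" using I by auto
  have in_I: "\<pi> ! p \<in> I" if "length \<pi> = card I" "set \<pi> = I" "p < n" for \<pi> p
    using that I by (metis nth_mem)
  have surv: "exp w * (1 + W \<pi> - w) \<le> (\<Prod>p<k. 1 - a p (\<pi> ! p))"
    if \<pi>: "length \<pi> = card I" "set \<pi> = I" for \<pi>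
  proof -
    have "exp w * (1 + (W \<pi> - w)) \<le> exp w * exp (W \<pi> - w)"
      by (intro mult_left_mono exp_ge_add_one_self) auto
    also have "\<dots> = (\<Prod>p<k. exp (- (g * a p (\<pi> ! p))))"
      unfolding W_def by (simp add: exp_sum flip: exp_add sum_negf)
    also have "\<dots> \<le> (\<Prod>p<k. 1 - a p (\<pi> ! p))"
    proof (intro prod_mono conjI)
      fix p assume "p \<in> {..<k}"
      then have "0 \<le> a p (\<pi> ! p) \<and> a p (\<pi> ! p) \<le> \<epsilon>"
        using k a in_I[OF \<pi>] by simp
      with one_minus_ge_exp[of "a p (\<pi> ! p)" \<epsilon>] \<epsilon>
      show "exp (- (g * a p (\<pi> ! p))) \<le> 1 - a p (\<pi> ! p)" by (simp add: g_def)
    qed simp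
    finally show ?thesis by (simp add: algebra_simps)
  qed
  have single: "pavg I (\<lambda>\<pi>. e (\<pi> ! k)) = E / n"
    using pavg_single[of I k e] I k by (simp add: E_def)
  have pair: "pavg I (\<lambda>\<pi>. e (\<pi> ! k) * a p (\<pi> ! p)) \<le> (E / n) * (A p / (real n - 1))"
    if p: "p < k" for p
  proof -
    have "(\<Sum>i\<in>I. \<Sum>j\<in>I - {i}. e i * a p j) \<le> (\<Sum>i\<in>I. \<Sum>j\<in>I. e i * a p j)"
      using I a[OF p] e by (intro sum_mono sum_mono2) (auto intro: mult_nonneg_nonneg)
    also have "\<dots> = E * A p"
      by (simp add: E_def A_def sum_product)
    finally have "(\<Sum>i\<in>I. \<Sum>j\<in>I - {i}. e i * a p j) / (n * (real n - 1)) \<le> E * A p / (n * (real n - 1))"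
      using n by (intro divide_right_mono) auto
    then show ?thesis
      using pavg_pair[of I k p "\<lambda>i j. e i * a p j"] p k I by simp
  qed
  have split: "x = (1 - w) * x + w * x" for x
    by (simp add: left_diff_distrib)
  have "exp w * (E / n) = exp w * ((1 - w) * (E / n) + w * (E / n))"
    by (rule arg_cong[OF split])
  also have "w * (E / n) \<le> pavg I (\<lambda>\<pi>. e (\<pi> ! k) * W \<pi>)"
  proof -
    have "pavg I (\<lambda>\<pi>. e (\<pi> ! k) * W \<pi>)
        = pavg I (\<lambda>\<pi>. \<Sum>p<k. (- g) * (e (\<pi> ! k) * a p (\<pi> ! p)))"
      unfolding W_def by (simp add: sum_distrib_left sum_negf mult.left_commute)
    also have "\<dots> = (\<Sum>p<k. (- g) * pavg I (\<lambda>\<pi>. e (\<pi> ! k) * a p (\<pi> ! p)))"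
      by (simp only: pavg_sum pavg_cmult)
    also have "\<dots> \<ge> (\<Sum>p<k. (- g) * ((E / n) * (A p / (real n - 1))))"
      using g by (intro sum_mono mult_left_mono_neg pair) auto
    also have "(\<Sum>p<k. (- g) * ((E / n) * (A p / (real n - 1)))) = w * (E / n)"
      unfolding w_def by (simp add: sum_distrib_right sum_distrib_left sum_negf mult.commute mult.left_commute)
    finally show ?thesis .
  qed
  then have "exp w * ((1 - w) * (E / n) + w * (E / n))
      \<le> exp w * ((1 - w) * (E / n) + pavg I (\<lambda>\<pi>. e (\<pi> ! k) * W \<pi>))"
    by simp
  also have "\<dots> = pavg I (\<lambda>\<pi>. exp w * ((1 - w) * e (\<pi> ! k) + e (\<pi> ! k) * W \<pi>))"
    by (simp only: pavg_cmult pavg_add single)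
  also have "\<dots> = pavg I (\<lambda>\<pi>. (exp w * (1 + W \<pi> - w)) * e (\<pi> ! k))"
    by (simp add: algebra_simps)
  also have "\<dots> \<le> pavg I (\<lambda>\<pi>. (\<Prod>p<k. 1 - a p (\<pi> ! p)) * e (\<pi> ! k))"
    using surv e in_I k by (intro pavg_mono I mult_right_mono) auto
  finally have 1: "exp w * (E / n) \<le> \<dots>" .
  have "(\<Prod>p<k. 1 - A p / M) \<le> (\<Prod>p<k. exp (- (g * (A p / (real n - 1)))))"
  proof (intro prod_mono conjI)
    fix p assume p: "p \<in> {..<k}"
    then have A: "0 \<le> A p" "A p \<le> M" using a y by (auto simp: A_def intro: sum_nonneg)
    show "0 \<le> 1 - A p / M" using A M by simp
    \<comment> \<open>Here the bound on \<open>M\<close> pays both for the stretched exponent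
      \<open>g\<close> and for drawing without replacement.\<close>
    have "g * (A p / (real n - 1)) = A p / ((1 - \<epsilon>) * (real n - 1))" by (simp add: g_def)
    also have "\<dots> \<le> A p / M" using A M \<epsilon> by (intro divide_left_mono) auto
    finally show "1 - A p / M \<le> exp (- (g * (A p / (real n - 1))))"
      using exp_ge_add_one_self[of "- (g * (A p / (real n - 1)))"] by linarith
  qed
  also have "\<dots> = exp w" by (simp add: w_def exp_sum flip: sum_negf)
  finally have "(\<Prod>p<k. 1 - A p / M) * (E / n) \<le> exp w * (E / n)"
    using E by (intro mult_right_mono) auto
  with 1 show ?thesis by (simp add: A_def E_def)
qed

text \<open>
  Chebyshev's inequality in the form \<open>exp (- Y) \<le> exp (- \<mu> / 2) + 4 (Y - \<mu>)\<^sup>2 / \<mu>\<^sup>2\<close>.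
\<close>

lemma pavg_survival_late:
  fixes a :: "nat \<Rightarrow> 'i \<Rightarrow> real"
  assumes I: "finite I" "card I = n" "2 \<le> n" and M: "M \<le> n" and R: "R \<subseteq> I"
    and a: "\<And>p i. p < n \<Longrightarrow> i \<in> I \<Longrightarrow> 0 \<le> a p i \<and> a p i \<le> 1"
    and \<epsilon>: "0 \<le> \<epsilon>"
    and late: "\<And>p i. M \<le> p \<Longrightarrow> p < n \<Longrightarrow> i \<in> R \<Longrightarrow> \<epsilon> \<le> a p i"
    and \<mu>: "\<mu> = real (n - M) * real (card R) * \<epsilon> / n" "0 < \<mu>"
  shows "pavg I (\<lambda>\<pi>. \<Prod>p<n. 1 - a p (\<pi> ! p)) \<le> exp (- (\<mu> / 2)) + 4 * \<epsilon> / \<mu>"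
proof -
  \<comment> \<open>Only variables of \<open>R\<close> at late positions are counted, each with its
    guaranteed probability.\<close>
  define b where "b = (\<lambda>i. if i \<in> R then \<epsilon> else 0)"
  define Y where "Y = (\<lambda>\<pi>. \<Sum>p=M..<n. b (\<pi> ! p))"
  define m where "m = real (n - M)"
  define N where "N = real (card R)"
  have n: "0 < real n" "0 < real n - 1" using I by auto
  have finR: "finite R" using I R finite_subset by blast
  have b0: "0 \<le> b i" for i using \<epsilon> by (simp add: b_def)
  have N: "0 \<le> N" "N \<le> n" using card_mono[OF I(1) R] I by (auto simp: N_def)
  have m: "0 \<le> m" "m \<le> n" by (auto simp: m_def)
  have mu: "\<mu> = m * N * \<epsilon> / n" using \<mu> by (simp add: m_def N_def)
  have sb: "(\<Sum>i\<in>I. b i) = N * \<epsilon>" "(\<Sum>i\<in>I. b i * b i) = N * \<epsilon> * \<epsilon>"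
    using I R by (simp_all add: b_def N_def sum.If_cases if_distrib[of "\<lambda>x. x * x"] Int_absorb1 cong: if_cong)
  have cardp: "card {M..<n} = n - M" by simp
  have single: "pavg I (\<lambda>\<pi>. F (\<pi> ! p)) = (\<Sum>i\<in>I. F i) / n" if "p < n" for p and F :: "'i \<Rightarrow> real"
    using pavg_single[of I p F] that I by simp
  have EY: "pavg I Y = \<mu>"
    unfolding Y_def pavg_sum using M by (simp add: single sb mu m_def)
  have pair: "pavg I (\<lambda>\<pi>. b (\<pi> ! p) * b (\<pi> ! q)) \<le> (if p = q then N * \<epsilon> * \<epsilon> / n else 0)
      + (if p = q then 0 else N\<^sup>2 * \<epsilon>\<^sup>2 / n\<^sup>2)" if "p < n" "q < n" for p q
  proof (cases "p = q")
    case False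
    have "(\<Sum>i\<in>I. \<Sum>j\<in>I - {i}. b i * b j) = (\<Sum>i\<in>I. \<Sum>j\<in>I. b i * b j) - (\<Sum>i\<in>I. b i * b i)"
      using I by (simp add: sum_diff1 sum_subtractf)
    also have "(\<Sum>i\<in>I. \<Sum>j\<in>I. b i * b j) = (N * \<epsilon>) * (N * \<epsilon>)"
      by (simp add: sum_product[symmetric] sb)
    finally have "(\<Sum>i\<in>I. \<Sum>j\<in>I - {i}. b i * b j) = N * (N - 1) * \<epsilon>\<^sup>2"
      by (simp add: sb power2_eq_square algebra_simps)
    then have "pavg I (\<lambda>\<pi>. b (\<pi> ! p) * b (\<pi> ! q)) = N * (N - 1) * \<epsilon>\<^sup>2 / (n * (real n - 1))"
      using pavg_pair[of I p q "\<lambda>i j. b i * b j"] False that I by simp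
    \<comment> \<open>\<open>(N - 1) / (n - 1) \<le> N / n\<close>: drawing without replacement
      makes distinct positions negatively correlated, so only the diagonal terms enter the bound for
      the variance.\<close>
    also have "\<dots> \<le> N * (N * (real n - 1) / n) * \<epsilon>\<^sup>2 / (n * (real n - 1))"
      using N n by (intro divide_right_mono mult_right_mono mult_left_mono) (auto simp: field_simps)
    also have "\<dots> = N\<^sup>2 * \<epsilon>\<^sup>2 / n\<^sup>2"
      using n by (simp add: power2_eq_square)
    finally show ?thesis using False by simp
  qed (use that single[of _ "\<lambda>i. b i * b i"] in \<open>simp add: sb\<close>)
  have "pavg I (\<lambda>\<pi>. (Y \<pi>)\<^sup>2) = (\<Sum>p=M..<n. \<Sum>q=M..<n. pavg I (\<lambda>\<pi>. b (\<pi> ! p) * b (\<pi> ! q)))"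
    by (simp add: Y_def power2_eq_square sum_product pavg_sum)
  also have "\<dots> \<le> (\<Sum>p=M..<n. \<Sum>q=M..<n. (if p = q then N * \<epsilon> * \<epsilon> / n else 0) + N\<^sup>2 * \<epsilon>\<^sup>2 / n\<^sup>2)"
    by (intro sum_mono order_trans[OF pair]) auto
  also have "\<dots> = \<epsilon> * \<mu> + \<mu>\<^sup>2"
    by (simp add: sum.distrib mu m_def[symmetric] power2_eq_square distrib_left ac_simps)
  finally have "pavg I (\<lambda>\<pi>. (Y \<pi>)\<^sup>2) \<le> \<epsilon> * \<mu> + \<mu>\<^sup>2" .
  moreover have "pavg I (\<lambda>\<pi>. (Y \<pi> - \<mu>)\<^sup>2) = pavg I (\<lambda>\<pi>. ((Y \<pi>)\<^sup>2 + (- 2 * \<mu>) * Y \<pi>) + \<mu>\<^sup>2)"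
    by (intro arg_cong[of _ _ "pavg I"] ext) (simp add: power2_eq_square algebra_simps)
  then have "pavg I (\<lambda>\<pi>. (Y \<pi> - \<mu>)\<^sup>2) = pavg I (\<lambda>\<pi>. (Y \<pi>)\<^sup>2) - \<mu>\<^sup>2"
    by (simp only: pavg_add pavg_cmult EY pavg_const[OF I(1)]) (simp add: power2_eq_square)
  ultimately have var: "pavg I (\<lambda>\<pi>. (Y \<pi> - \<mu>)\<^sup>2) \<le> \<epsilon> * \<mu>" by simp
  have "pavg I (\<lambda>\<pi>. \<Prod>p<n. 1 - a p (\<pi> ! p)) \<le> pavg I (\<lambda>\<pi>. exp (- (\<mu> / 2)) + (4 / \<mu>\<^sup>2) * (Y \<pi> - \<mu>)\<^sup>2)"
  proof (rule pavg_mono[OF I(1)])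
    fix \<pi> assume \<pi>: "length \<pi> = card I" "set \<pi> = I"
    have in_I: "\<pi> ! p \<in> I" if "p < n" for p using that \<pi> I by (metis nth_mem)
    have ap: "0 \<le> a p (\<pi> ! p)" "a p (\<pi> ! p) \<le> 1" if "p < n" for p
      using a[OF that in_I[OF that]] by auto
    have "(\<Prod>p<n. 1 - a p (\<pi> ! p)) \<le> (\<Prod>p<n. if M \<le> p then exp (- b (\<pi> ! p)) else 1)"
    proof (intro prod_mono conjI)
      fix p assume p: "p \<in> {..<n}"
      show "0 \<le> 1 - a p (\<pi> ! p)" using ap p by simp
      have "b (\<pi> ! p) \<le> a p (\<pi> ! p)" if "M \<le> p"
        using late[OF that] ap p by (auto simp: b_def)
      then show "1 - a p (\<pi> ! p) \<le> (if M \<le> p then exp (- b (\<pi> ! p)) else 1)"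
        using exp_ge_add_one_self[of "- b (\<pi> ! p)"] ap[of p] p by auto
    qed
    also have "\<dots> = (\<Prod>p=M..<n. exp (- b (\<pi> ! p)))"
      by (intro prod.mono_neutral_cong_right) auto
    also have "\<dots> = exp (- Y \<pi>)" by (simp add: Y_def exp_sum flip: sum_negf)
    also have "\<dots> \<le> exp (- (\<mu> / 2)) + 4 * (Y \<pi> - \<mu>)\<^sup>2 / \<mu>\<^sup>2"
      using b0 \<mu>(2) by (intro exp_neg_le_deviation) (auto simp: Y_def intro: sum_nonneg)
    finally show "(\<Prod>p<n. 1 - a p (\<pi> ! p)) \<le> exp (- (\<mu> / 2)) + (4 / \<mu>\<^sup>2) * (Y \<pi> - \<mu>)\<^sup>2"
      by simp
  qed
  also have "\<dots> = exp (- (\<mu> / 2)) + (4 / \<mu>\<^sup>2) * pavg I (\<lambda>\<pi>. (Y \<pi> - \<mu>)\<^sup>2)"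
    by (simp only: pavg_add pavg_cmult pavg_const[OF I(1)])
  also have "\<dots> \<le> exp (- (\<mu> / 2)) + (4 / \<mu>\<^sup>2) * (\<epsilon> * \<mu>)"
    by (intro add_left_mono mult_left_mono var) auto
  also have "(4 / \<mu>\<^sup>2) * (\<epsilon> * \<mu>) = 4 * \<epsilon> / \<mu>"
    using \<mu>(2) by (simp add: power2_eq_square)
  finally show ?thesis .
qed

text \<open>The base \<open>T\<close> is secured by the late survival bound, the surplus of the
  first \<open>M\<close> positions by the early one; later surplus is nonnegative and dropped. The
  factor \<open>M / n\<close> appears because a position holds a given variable with probability
  \<open>1 / n\<close>, where the recursion for \<open>Z\<close> has \<open>1 / M\<close>.\<close>

lemma pavg_order_reward_ge:
  fixes a g :: "nat \<Rightarrow> 'i \<Rightarrow> real" and M n :: nat and Z :: "nat \<Rightarrow> real"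
  assumes I: "finite I" "card I = n" "2 \<le> n" and M: "0 < M" "M \<le> n" and R: "R \<subseteq> I" and T: "0 \<le> T"
    and \<epsilon>: "0 \<le> \<epsilon>" "\<epsilon> < 1" "real M \<le> (1 - \<epsilon>) * (real n - 1)"
    and a: "\<And>p i. p < n \<Longrightarrow> i \<in> I \<Longrightarrow> 0 \<le> a p i \<and> a p i \<le> 1"
    and a_small: "\<And>p i. p < M \<Longrightarrow> i \<in> I \<Longrightarrow> a p i \<le> \<epsilon>"
    and y: "\<And>p. p < M \<Longrightarrow> (\<Sum>i\<in>I. a p i) \<le> M"
    and g: "\<And>p i. p < n \<Longrightarrow> i \<in> I \<Longrightarrow> T * a p i \<le> g p i"
    and late: "\<And>p i. M \<le> p \<Longrightarrow> p < n \<Longrightarrow> i \<in> R \<Longrightarrow> \<epsilon> \<le> a p i"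
    and \<mu>: "\<mu> = real (n - M) * real (card R) * \<epsilon> / n" "0 < \<mu>"
    and Z_M: "Z M = 0"
    and Z: "\<And>k. k < M \<Longrightarrow>
      Z k = (1 - (\<Sum>i\<in>I. a k i) / M) * Z (Suc k) + (\<Sum>i\<in>I. g k i - T * a k i) / M"
  shows "T * (1 - (exp (- (\<mu> / 2)) + 4 * \<epsilon> / \<mu>)) + real M / n * Z 0 \<le> pavg I (order_reward a g 0)"
proof -
  define S where "S = (\<lambda>k (\<pi> :: 'i list). \<Prod>p<k. 1 - a p (\<pi> ! p))"
  define e where "e = (\<lambda>k i. g k i - T * a k i)"
  have early: "(\<Prod>p<k. 1 - (\<Sum>i\<in>I. a p i) / M) * ((\<Sum>i\<in>I. e k i) / n)
    \<le> pavg I (\<lambda>\<pi>. S k \<pi> * e k (\<pi> ! k))" if "k < M" for k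
    unfolding S_def
    by (rule pavg_survival_early[where \<epsilon> = \<epsilon>])
       (use that I M \<epsilon> a a_small y g in \<open>auto simp: e_def\<close>)
  define Es where "Es = (\<lambda>k. \<Sum>i\<in>I. e k i)"
  define Ps where "Ps = (\<lambda>k. \<Prod>p<k. 1 - (\<Sum>i\<in>I. a p i) / M)"
  have "Z 0 = (\<Sum>k<M. Ps k * (Es k / M))"
    using sum_survival_telescope[where Z = Z and M = M and m = M and
        y = "\<lambda>k. (\<Sum>i\<in>I. a k i) / M" and x = "\<lambda>k. Es k / M"] Z Z_M
    by (simp add: e_def Es_def Ps_def)
  then have "real M / n * Z 0 = (\<Sum>k<M. Ps k * (Es k / n))"
    using M by (simp add: sum_distrib_left)
  also have "\<dots> \<le> (\<Sum>k<M. pavg I (\<lambda>\<pi>. S k \<pi> * e k (\<pi> ! k)))"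
    unfolding Ps_def Es_def by (intro sum_mono early) auto
  finally have "real M / n * Z 0 \<le> pavg I (\<lambda>\<pi>. \<Sum>k<M. S k \<pi> * e k (\<pi> ! k))"
    by (simp only: pavg_sum)
  moreover have "pavg I (S n) \<le> exp (- (\<mu> / 2)) + 4 * \<epsilon> / \<mu>"
    unfolding S_def by (rule pavg_survival_late[OF I M(2) R a \<epsilon>(1) late \<mu>])
  then have "T * (1 - (exp (- (\<mu> / 2)) + 4 * \<epsilon> / \<mu>)) \<le> T * (1 - pavg I (S n))"
    using T by (intro mult_left_mono) auto
  moreover have "T * (1 - pavg I (S n)) + pavg I (\<lambda>\<pi>. \<Sum>k<M. S k \<pi> * e k (\<pi> ! k))
      = pavg I (\<lambda>\<pi>. T * (1 - S n \<pi>) + (\<Sum>k<M. S k \<pi> * e k (\<pi> ! k)))"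
    by (simp only: pavg_add pavg_cmult pavg_diff pavg_const[OF I(1)])
  moreover have "\<dots> \<le> pavg I (order_reward a g 0)"
  proof (rule pavg_mono[OF I(1)])
    fix \<pi> assume \<pi>: "length \<pi> = card I" "set \<pi> = I"
    have in_I: "\<pi> ! p \<in> I" if "p < n" for p using that \<pi> I by (metis nth_mem)
    have "(\<Sum>k<M. S k \<pi> * e k (\<pi> ! k)) \<le> (\<Sum>k<n. S k \<pi> * e k (\<pi> ! k))"
      using M a g in_I by (intro sum_mono2) (auto simp: S_def e_def intro!: mult_nonneg_nonneg prod_nonneg)
    then show "T * (1 - S n \<pi>) + (\<Sum>k<M. S k \<pi> * e k (\<pi> ! k)) \<le> order_reward a g 0 \<pi>"
      using \<pi> I by (subst order_reward_eq[where T = T]) (simp add: S_def e_def)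
  qed
  ultimately show ?thesis by linarith
qed

section \<open>Expected reward of a position-dependent threshold policy\<close>

definition pos_policy :: "(nat \<Rightarrow> nat \<Rightarrow> real \<Rightarrow> bool) \<Rightarrow> real history \<Rightarrow> bool" where
  "pos_policy acc h = (h \<noteq> [] \<and> acc (length h - 1) (fst (last h)) (snd (last h)))"

lemma policy_pos_policy:
  assumes [measurable]: "\<And>k i. Measurable.pred borel (acc k i)"
  shows "policy Q (\<lambda>_. pos_policy acc)"
  unfolding policy_def
proof
  fix "is" :: "nat list"
  show "(\<lambda>(s, v). pos_policy acc (map (\<lambda>k. (is ! k, v k)) [0..<length is]))
     \<in> Q \<Otimes>\<^sub>M (\<Pi>\<^sub>M k\<in>{..<length is}. borel) \<rightarrow>\<^sub>M count_space UNIV"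
  proof (cases "is = []")
    case True
    then show ?thesis by (simp add: pos_policy_def split_beta)
  next
    case False
    then have eq: "(\<lambda>(s, v). pos_policy acc (map (\<lambda>k. (is ! k, v k)) [0..<length is]))
      = (\<lambda>z. acc (length is - 1) (is ! (length is - 1)) (snd z (length is - 1)))"
      by (auto simp: pos_policy_def split_beta fun_eq_iff last_map)
    have "(\<lambda>z. snd z (length is - 1))
        \<in> borel_measurable (Q \<Otimes>\<^sub>M (\<Pi>\<^sub>M k\<in>{..<length is}. (borel :: real measure)))"
      using False
      by (intro measurable_compose[OF measurable_snd measurable_component_singleton]) auto
    from measurable_compose[OF this assms] show ?thesis by (simp only: eq)
  qed
qed

fun pos_reward :: "(nat \<Rightarrow> nat \<Rightarrow> real \<Rightarrow> bool) \<Rightarrow> nat \<Rightarrow> (nat \<Rightarrow> real) \<Rightarrow> nat list \<Rightarrow> real" where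
  "pos_reward acc k x [] = 0"
| "pos_reward acc k x (i # is) = (if acc k i (x i) then x i else pos_reward acc (Suc k) x is)"

lemma reward_pos_policy:
  "reward (pos_policy acc) h (map (\<lambda>i. (i, x i)) is) = pos_reward acc (length h) x is"
  by (induction "is" arbitrary: h) (simp_all add: pos_policy_def)

lemma borel_measurable_pos_reward:
  assumes [measurable]: "\<And>k i. Measurable.pred borel (acc k i)"
  shows "set is \<subseteq> S \<Longrightarrow> (\<lambda>x. pos_reward acc k x is) \<in> borel_measurable (\<Pi>\<^sub>M i\<in>S. borel)"
proof (induction "is" arbitrary: k)
  case (Cons i "is")
  have [measurable]: "(\<lambda>x. x i) \<in> borel_measurable (\<Pi>\<^sub>M i\<in>S. (borel :: real measure))"
    using Cons.prems by (intro measurable_component_singleton) auto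
  have [measurable]: "(\<lambda>x. pos_reward acc (Suc k) x is) \<in> borel_measurable (\<Pi>\<^sub>M i\<in>S. borel)"
    using Cons by auto
  show ?case unfolding pos_reward.simps by measurable
qed simp

lemma pos_reward_upd:
  "i \<notin> set is \<Longrightarrow> pos_reward acc k (x(i := y)) is = pos_reward acc k x is"
  by (induction "is" arbitrary: k) auto

text \<open>Fubini along the order, one variable at a time. An accepted value may have infinite
  mean, hence the finite lower bound \<open>g\<close> in place of its expectation.\<close>

lemma nn_integral_pos_reward_ge:
  fixes D :: "nat \<Rightarrow> real measure"
  assumes prob: "\<And>i. prob_space (D i)" and sets: "\<And>i. sets (D i) = sets borel"
    and acc: "\<And>k i. Measurable.pred borel (acc k i)"
    and a: "\<And>k i. a k i = measure (D i) {x. acc k i x}"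
    and g: "\<And>k i. 0 \<le> g k i"
      "\<And>k i. ennreal (g k i) \<le> (\<integral>\<^sup>+x. ennreal x * indicator {x. acc k i x} x \<partial>D i)"
  shows "distinct is \<Longrightarrow> ennreal (order_reward a g k is)
    \<le> (\<integral>\<^sup>+x. ennreal (pos_reward acc k x is) \<partial>(\<Pi>\<^sub>M i\<in>set is. D i))"
proof (induction "is" arbitrary: k)
  case (Cons i js)
  interpret D: prob_space "D j" for j by (rule prob)
  interpret product_sigma_finite D ..
  note [measurable] = acc
  note [measurable_cong] = sets
  have space: "space (D i) = UNIV" for i using sets_eq_imp_space_eq[OF sets] by simp
  define r where "r = order_reward a g (Suc k) js"
  define A where "A = {x. acc k i x}"
  have A [measurable]: "A \<in> sets (D i)" unfolding A_def by measurable
  have "0 \<le> order_reward a g m ls" for m ls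
    by (induction ls arbitrary: m) (use a g in \<open>auto intro!: add_nonneg_nonneg mult_nonneg_nonneg\<close>)
  then have r: "0 \<le> r" by (simp add: r_def)
  have mA: "(\<lambda>x. ennreal x * indicator A x) \<in> borel_measurable (D i)"
    by measurable
  have "ennreal (order_reward a g k (i # js)) = ennreal (g k i) + ennreal r * emeasure (D i) (- A)"
  proof -
    have "measure (D i) (- A) = 1 - measure (D i) A"
      using D.prob_compl[OF A] unfolding space Compl_eq_Diff_UNIV .
    then have "emeasure (D i) (- A) = ennreal (1 - a k i)"
      by (simp add: a A_def D.emeasure_eq_measure)
    then show ?thesis
      using g(1) r a[of k i] by (simp add: r_def mult.commute ennreal_mult' ennreal_plus)
  qed
  also have "\<dots> \<le> (\<integral>\<^sup>+y. ennreal y * indicator A y \<partial>D i) + (\<integral>\<^sup>+y. ennreal r * indicator (- A) y \<partial>D i)"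
    using g(2)[of k i] A by (intro add_mono) (auto simp: A_def nn_integral_cmult_indicator)
  also have "\<dots> = (\<integral>\<^sup>+y. ennreal y * indicator A y + ennreal r * indicator (- A) y \<partial>D i)"
    using A by (intro nn_integral_add[symmetric] mA) auto
  also have "\<dots> \<le> (\<integral>\<^sup>+y. (\<integral>\<^sup>+x. ennreal (pos_reward acc k (x(i := y)) (i # js)) \<partial>(\<Pi>\<^sub>M i\<in>set js. D i)) \<partial>D i)"
  proof (rule nn_integral_mono)
    fix y
    interpret P: prob_space "\<Pi>\<^sub>M i\<in>set js. D i" by (intro prob_space_PiM prob)
    have "ennreal r \<le> (\<integral>\<^sup>+x. ennreal (pos_reward acc (Suc k) x js) \<partial>(\<Pi>\<^sub>M i\<in>set js. D i))"
      using Cons unfolding r_def by simp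
    then show "ennreal y * indicator A y + ennreal r * indicator (- A) y
      \<le> (\<integral>\<^sup>+x. ennreal (pos_reward acc k (x(i := y)) (i # js)) \<partial>(\<Pi>\<^sub>M i\<in>set js. D i))"
      using Cons.prems P.emeasure_space_1
      by (auto simp: A_def pos_reward_upd indicator_def)
  qed
  also have "\<dots> = (\<integral>\<^sup>+x. ennreal (pos_reward acc k x (i # js)) \<partial>(\<Pi>\<^sub>M i\<in>set (i # js). D i))"
  proof -
    have "(\<lambda>x. pos_reward acc k x (i # js)) \<in> borel_measurable (\<Pi>\<^sub>M i\<in>insert i (set js). borel)"
      by (intro borel_measurable_pos_reward acc) auto
    also have "borel_measurable (\<Pi>\<^sub>M i\<in>insert i (set js). borel) = borel_measurable (\<Pi>\<^sub>M i\<in>insert i (set js). D i)"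
      by (intro measurable_cong_sets sets_PiM_cong refl) (simp add: sets)
    finally show ?thesis
      using Cons.prems by (simp only: list.set) (subst product_nn_integral_insert_rev, auto)
  qed
  finally show ?case .
qed simp

lemma expected_reward_pos_policy_ge:
  fixes D :: "nat \<Rightarrow> real measure"
  assumes prob: "\<And>i. prob_space (D i)" and sets: "\<And>i. sets (D i) = sets borel"
    and acc: "\<And>k i. Measurable.pred borel (acc k i)"
    and a: "\<And>k i. a k i = measure (D i) {x. acc k i x}"
    and g: "\<And>k i. 0 \<le> g k i"
      "\<And>k i. ennreal (g k i) \<le> (\<integral>\<^sup>+x. ennreal x * indicator {x. acc k i x} x \<partial>D i)"
    and I: "finite I" and Q: "prob_space Q"
  shows "ennreal (pavg I (order_reward a g 0)) \<le> expected_reward D I Q (\<lambda>_. pos_policy acc)"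
proof -
  interpret Q: prob_space Q by (rule Q)
  define S where "S = permutations_of_set I"
  have S: "finite S" "S \<noteq> {}" using I by (auto simp: S_def permutations_of_set_empty_iff)
  have rr0: "0 \<le> order_reward a g m ls" for m ls
  proof -
    have "a k i \<le> 1" for k i using prob_space.prob_le_1[OF prob] by (simp add: a)
    then show ?thesis
      by (induction ls arbitrary: m) (use g in \<open>auto intro!: add_nonneg_nonneg mult_nonneg_nonneg\<close>)
  qed
  have card: "real (card S) = fact (card I)" using I by (simp add: S_def)
  have "pavg I (order_reward a g 0) = (\<Sum>\<pi>\<in>S. order_reward a g 0 \<pi>) / real (card S)"
    by (simp add: pavg_def S_def[symmetric] card)
  also have "ennreal \<dots> = ennreal (\<Sum>\<pi>\<in>S. order_reward a g 0 \<pi>) / ennreal (real (card S))"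
    using rr0 card by (intro divide_ennreal[symmetric] sum_nonneg) auto
  finally have "ennreal (pavg I (order_reward a g 0)) = (\<Sum>\<pi>\<in>S. ennreal (order_reward a g 0 \<pi>)) / card S"
    using rr0 by (simp only: sum_ennreal ennreal_of_nat_eq_real_of_nat)
  also have "\<dots> = (\<integral>\<^sup>+\<pi>. ennreal (order_reward a g 0 \<pi>) \<partial>measure_pmf (pmf_of_set S))"
    by (rule nn_integral_pmf_of_set[OF S(2,1), symmetric])
  also have "\<dots> \<le> expected_reward D I Q (\<lambda>_. pos_policy acc)"
    unfolding expected_reward_def S_def[symmetric]
  proof (rule nn_integral_mono_AE, unfold AE_measure_pmf_iff, safe)
    fix \<pi> assume "\<pi> \<in> set_pmf (pmf_of_set S)"
    then have \<pi>: "set \<pi> = I" "distinct \<pi>"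
      using S by (auto simp: S_def dest: permutations_of_setD)
    have "ennreal (order_reward a g 0 \<pi>) \<le> (\<integral>\<^sup>+x. ennreal (pos_reward acc 0 x \<pi>) \<partial>(\<Pi>\<^sub>M i\<in>set \<pi>. D i))"
      by (rule nn_integral_pos_reward_ge) (use assms \<pi> in auto)
    then show "ennreal (order_reward a g 0 \<pi>) \<le> (\<integral>\<^sup>+s. (\<integral>\<^sup>+x. ennreal (reward (pos_policy acc) []
        (map (\<lambda>i. (i, x i)) \<pi>)) \<partial>(\<Pi>\<^sub>M i\<in>I. D i)) \<partial>Q)"
      using \<pi> by (simp add: reward_pos_policy Q.emeasure_space_1)
  qed
  finally show ?thesis .
qed

section \<open>Truncated maxima\<close>

text \<open>The layer-cake formula: the positive part of \<open>min (f x) b - a\<close> is the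
  length of \<open>{a..b} \<inter> {..<f x}\<close>. The positive part is implicit, as
  \<open>ennreal\<close> sends negative numbers to \<open>0\<close>.\<close>

lemma nn_integral_truncated:
  fixes f :: "'a \<Rightarrow> real"
  assumes N: "prob_space N" and [measurable]: "f \<in> borel_measurable N" and ab: "a \<le> b"
  shows "(\<integral>\<^sup>+x. ennreal (min (f x) b - a) \<partial>N)
    = ennreal (LINT v|lborel. indicator {a..b} v * measure N {x\<in>space N. v < f x})"
proof -
  interpret N: prob_space N by (rule N)
  interpret pair_sigma_finite lborel N ..
  define q where "q = (\<lambda>v. measure N {x\<in>space N. v < f x})"
  have "antimono q" unfolding q_def by (auto intro!: antimonoI N.finite_measure_mono)
  note [measurable] = borel_measurable_antimono[OF this]
  have "ennreal (min (f x) b - a) = (\<integral>\<^sup>+v. indicator {a..b} v * indicator {..<f x} v \<partial>lborel)" for x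
  proof -
    have "(\<integral>\<^sup>+v. indicator {a..b} v * indicator {..<f x} v \<partial>lborel)
        = (\<integral>\<^sup>+v. indicator ({a..b} \<inter> {..<f x}) v \<partial>lborel)"
      by (intro nn_integral_cong) (simp add: indicator_inter_arith)
    also have "\<dots> = emeasure lborel ({a..b} \<inter> {..<f x})"
      by (rule nn_integral_indicator) simp
    finally have "(\<integral>\<^sup>+v. indicator {a..b} v * indicator {..<f x} v \<partial>lborel) = emeasure lborel ({a..b} \<inter> {..<f x})" .
    moreover have "{a..b} \<inter> {..<f x} = (if b < f x then {a..b} else {a..<f x})" by auto
    moreover have "f x < a \<Longrightarrow> emeasure lborel {a..<f x} = 0" by simp
    ultimately show ?thesis using ab
      by (cases "a \<le> f x") (auto simp: ennreal_neg)
  qed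
  then have "(\<integral>\<^sup>+x. ennreal (min (f x) b - a) \<partial>N)
      = (\<integral>\<^sup>+x. (\<integral>\<^sup>+v. indicator {a..b} v * indicator {..<f x} v \<partial>lborel) \<partial>N)" by simp
  also have "\<dots> = (\<integral>\<^sup>+v. (\<integral>\<^sup>+x. indicator {a..b} v * indicator {..<f x} v \<partial>N) \<partial>lborel)"
    by (rule Fubini') (simp add: indicator_def[of "{..<f _}"] lessThan_def split_beta)
  also have "\<dots> = (\<integral>\<^sup>+v. ennreal (indicator {a..b} v * q v) \<partial>lborel)"
  proof (rule nn_integral_cong)
    fix v :: real
    have "(\<integral>\<^sup>+x. indicator {a..b} v * indicator {..<f x} v \<partial>N)
        = indicator {a..b} v * (\<integral>\<^sup>+x. indicator {x\<in>space N. v < f x} x \<partial>N)"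
      by (subst nn_integral_cmult[symmetric]) (auto intro!: nn_integral_cong simp: indicator_def)
    also have "(\<integral>\<^sup>+x. indicator {x\<in>space N. v < f x} x \<partial>N) = ennreal (q v)"
      by (subst nn_integral_indicator) (auto simp: q_def N.emeasure_eq_measure)
    also have "indicator {a..b} v * ennreal (q v) = ennreal (indicator {a..b} v * q v)"
      by (simp add: indicator_def)
    finally show "(\<integral>\<^sup>+x. indicator {a..b} v * indicator {..<f x} v \<partial>N) = ennreal (indicator {a..b} v * q v)" .
  qed
  also have "\<dots> = ennreal (LINT v|lborel. indicator {a..b} v * q v)"
    by (intro nn_integral_eq_integral integrable_bounded_Icc[where C = 1])
       (auto simp: q_def)
  finally show ?thesis by (simp add: q_def)
qed

text \<open>
  The laws may have infinite mean, so the dynamic program is run for values truncated at \<open>b\<close>, and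
  \<open>b\<close> tends to infinity only at the end.
\<close>

definition EMAXB :: "real \<Rightarrow> (nat \<Rightarrow> real measure) \<Rightarrow> nat set \<Rightarrow> ennreal" where
  "EMAXB b D J = (\<integral>\<^sup>+x. (SUP i\<in>J. ennreal (min (x i) b)) \<partial>(\<Pi>\<^sub>M i\<in>J. D i))"

text \<open>The maximum is at most \<open>T\<close> plus the positive part of its excess, whose tail
  is one minus a product by independence; the layer-cake formula then gives its truncated
  mean.\<close>

lemma EMAXB_le:
  fixes D :: "nat \<Rightarrow> real measure"
  assumes prob: "\<And>i. prob_space (D i)" and sets: "\<And>i. sets (D i) = sets borel"
    and J: "finite J" and T: "0 \<le> T" and B: "0 \<le> B"
  shows "EMAXB (T + B) D J \<le> ennreal (T + (LINT v|lborel. indicator {0..B} v *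
    (1 - (\<Prod>i\<in>J. 1 - measure (D i) {x. T + v < x}))))"
proof (cases "J = {}")
  case True
  then show ?thesis using T B by (simp add: EMAXB_def bot_ennreal)
next
  case False
  interpret D: prob_space "D j" for j by (rule prob)
  interpret product_sigma_finite D ..
  interpret P: prob_space "\<Pi>\<^sub>M i\<in>J. D i" by (intro prob_space_PiM prob)
  note [measurable_cong] = sets
  have space: "space (D i) = UNIV" for i using sets_eq_imp_space_eq[OF sets] by simp
  define f where "f = (\<lambda>x. Max ((\<lambda>i. x i) ` J) - T)"
  have [measurable]: "f \<in> borel_measurable (\<Pi>\<^sub>M i\<in>J. D i)"
    unfolding f_def using J False by measurable
  have meas: "measure (\<Pi>\<^sub>M i\<in>J. D i) {x \<in> space (\<Pi>\<^sub>M i\<in>J. D i). v < f x}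
      = 1 - (\<Prod>i\<in>J. 1 - measure (D i) {x. T + v < x})" for v
  proof -
    have eq: "{x \<in> space (\<Pi>\<^sub>M i\<in>J. D i). \<not> v < f x} = (\<Pi>\<^sub>E i\<in>J. {..T + v})"
      using J False by (auto simp: f_def space_PiM space PiE_iff extensional_def not_less algebra_simps)
    have "emeasure (\<Pi>\<^sub>M i\<in>J. D i) (\<Pi>\<^sub>E i\<in>J. {..T + v}) = (\<Prod>i\<in>J. emeasure (D i) {..T + v})"
      using J by (intro emeasure_PiM) (auto simp: sets)
    then have 1: "measure (\<Pi>\<^sub>M i\<in>J. D i) (\<Pi>\<^sub>E i\<in>J. {..T + v}) = (\<Prod>i\<in>J. measure (D i) {..T + v})"
      by (simp add: P.emeasure_eq_measure D.emeasure_eq_measure prod_ennreal prod_nonneg)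
    have 2: "measure (D i) {..T + v} = 1 - measure (D i) {x. T + v < x}" for i
    proof -
      have "{..T + v} = space (D i) - {x. T + v < x}" by (auto simp: space)
      moreover have "{x. T + v < x} \<in> sets (D i)" by (simp add: sets)
      ultimately show ?thesis using D.prob_compl by simp
    qed
    have "{x \<in> space (\<Pi>\<^sub>M i\<in>J. D i). v < f x} \<in> sets (\<Pi>\<^sub>M i\<in>J. D i)" by measurable
    from P.prob_neg[OF this] show ?thesis by (simp add: eq 1 2)
  qed
  have plus: "ennreal (t + max 0 y) = ennreal t + ennreal y" if "0 \<le> t" for t y
    using that by (cases "0 \<le> y") (auto simp: max_def ennreal_neg)
  have "EMAXB (T + B) D J \<le> (\<integral>\<^sup>+x. ennreal T + ennreal (min (f x) B - 0) \<partial>(\<Pi>\<^sub>M i\<in>J. D i))"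
    unfolding EMAXB_def
  proof (intro nn_integral_mono SUP_least)
    fix x :: "nat \<Rightarrow> real" and i assume i: "i \<in> J"
    have "x i \<le> Max ((\<lambda>i. x i) ` J)" using J i by (intro Max_ge) auto
    then have "min (x i) (T + B) \<le> T + max 0 (min (f x) B - 0)"
      by (auto simp: f_def)
    then have "ennreal (min (x i) (T + B)) \<le> ennreal (T + max 0 (min (f x) B - 0))"
      by (rule ennreal_leI)
    also have "\<dots> = ennreal T + ennreal (min (f x) B - 0)"
      using T by (rule plus)
    finally show "ennreal (min (x i) (T + B)) \<le> ennreal T + ennreal (min (f x) B - 0)" .
  qed
  also have "\<dots> = ennreal T + (\<integral>\<^sup>+x. ennreal (min (f x) B - 0) \<partial>(\<Pi>\<^sub>M i\<in>J. D i))"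
    by (subst nn_integral_add) (auto simp: P.emeasure_space_1)
  also have "(\<integral>\<^sup>+x. ennreal (min (f x) B - 0) \<partial>(\<Pi>\<^sub>M i\<in>J. D i)) = ennreal (LINT v|lborel. indicator {0..B} v *
    (1 - (\<Prod>i\<in>J. 1 - measure (D i) {x. T + v < x})))"
    using B by (subst nn_integral_truncated) (auto simp: meas P.prob_space_axioms)
  also have "ennreal T + \<dots> = ennreal (T + (LINT v|lborel. indicator {0..B} v *
    (1 - (\<Prod>i\<in>J. 1 - measure (D i) {x. T + v < x}))))"
    using T by (intro ennreal_plus[symmetric] Bochner_Integration.integral_nonneg)
      (auto intro!: mult_nonneg_nonneg prod_le_1)
  finally show ?thesis .
qed

lemma EMAX_le_if_EMAXB_le:
  fixes D :: "nat \<Rightarrow> real measure"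
  assumes sets: "\<And>i. sets (D i) = sets borel" and J: "finite J"
    and le: "\<And>b. b0 \<le> b \<Longrightarrow> c * EMAXB b D J \<le> R"
  shows "c * EMAX D J \<le> R"
proof -
  note [measurable_cong] = sets
  define F where "F = (\<lambda>m x. SUP i\<in>J. ennreal (min (x i) (b0 + real m)))"
  have [measurable]: "F m \<in> borel_measurable (\<Pi>\<^sub>M i\<in>J. D i)" for m
    unfolding F_def using J by (intro borel_measurable_SUP countable_finite) auto
  have "(SUP m. F m x) = (SUP i\<in>J. ennreal (x i))" for x
  proof -
    have "(SUP m. ennreal (min (x i) (b0 + real m))) = ennreal (x i)" for i
    proof (rule antisym)
      obtain m :: nat where "x i - b0 \<le> real m" using real_arch_simple by blast
      then have "ennreal (x i) = ennreal (min (x i) (b0 + real m))" by (simp add: min_def)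
      also have "\<dots> \<le> (SUP m. ennreal (min (x i) (b0 + real m)))" by (rule SUP_upper) simp
      finally show "ennreal (x i) \<le> (SUP m. ennreal (min (x i) (b0 + real m)))" .
    qed (auto intro!: SUP_least ennreal_leI)
    then show ?thesis unfolding F_def by (subst SUP_commute) simp
  qed
  then have "EMAX D J = (\<integral>\<^sup>+x. (SUP m. F m x) \<partial>(\<Pi>\<^sub>M i\<in>J. D i))"
    by (simp add: EMAX_def)
  also have "\<dots> = (SUP m. \<integral>\<^sup>+x. F m x \<partial>(\<Pi>\<^sub>M i\<in>J. D i))"
    by (intro nn_integral_monotone_convergence_SUP incseq_SucI le_funI)
       (auto simp: F_def intro!: SUP_mono' ennreal_leI)
  also have "\<dots> = (SUP m. EMAXB (b0 + real m) D J)"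
    by (simp add: F_def EMAXB_def)
  finally have "c * EMAX D J = (SUP m. c * EMAXB (b0 + real m) D J)"
    by (simp add: SUP_mult_left_ennreal)
  also have "\<dots> \<le> R" by (intro SUP_least le) simp
  finally show ?thesis .
qed

section \<open>The guarantee of the dynamic-programming thresholds\<close>

definition tail_ge :: "real measure \<Rightarrow> real \<Rightarrow> real" where
  "tail_ge N t = measure N {t..}"

definition tail_gt :: "real measure \<Rightarrow> real \<Rightarrow> real" where
  "tail_gt N t = measure N {t<..}"

text \<open>The truncation at \<open>c\<close> keeps the integral finite for laws with infinite
  mean.\<close>

definition excess :: "real measure \<Rightarrow> real \<Rightarrow> real \<Rightarrow> real" where
  "excess N c u = (\<integral>x. max 0 (min x c - u) \<partial>N)"

text \<open>The strict and the weak inequality are chosen with atoms at \<open>T\<close> in mind: a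
  kept variable exceeds \<open>T\<close> strictly with small probability, while the variables of the
  safety net reach \<open>T\<close> weakly with large probability. The late phase accepts removed
  variables too, since they may be among the \<open>N\<close> that reach \<open>T\<close>.\<close>

definition dp_acc :: "nat \<Rightarrow> nat set \<Rightarrow> real \<Rightarrow> (nat \<Rightarrow> real) \<Rightarrow> nat \<Rightarrow> nat \<Rightarrow> real \<Rightarrow> bool" where
  "dp_acc M J T U k i x = (if k < M then i \<in> J \<and> U k < x else T \<le> x)"

lemma measurable_dp_acc [measurable]: "Measurable.pred borel (dp_acc M J T U k i)"
proof -
  have "dp_acc M J T U k i = (\<lambda>x. if k < M then i \<in> J \<and> U k < x else T \<le> x)"
    by (simp add: dp_acc_def fun_eq_iff)
  then show ?thesis by simp
qed

text \<open>The product is at least the exponential of a stretched sum, and the concavity of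
  \<open>1 - exp (- x)\<close> undoes the stretching at the price of the factor
  \<open>1 - \<epsilon>\<close>.\<close>

lemma one_minus_prod_le:
  fixes q :: "'i \<Rightarrow> real"
  assumes "finite J" "\<And>i. i \<in> J \<Longrightarrow> 0 \<le> q i \<and> q i \<le> \<epsilon>" "\<epsilon> < 1" "0 \<le> \<epsilon>"
  shows "(1 - \<epsilon>) * (1 - (\<Prod>i\<in>J. 1 - q i)) \<le> 1 - exp (- (\<Sum>i\<in>J. q i))"
proof -
  define s where "s = (\<Sum>i\<in>J. q i)"
  have s: "0 \<le> s" using assms by (auto simp: s_def intro: sum_nonneg)
  have "exp (- (s / (1 - \<epsilon>))) = (\<Prod>i\<in>J. exp (- (q i / (1 - \<epsilon>))))"
    using assms by (simp add: s_def sum_divide_distrib exp_sum flip: sum_negf)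
  also have "\<dots> \<le> (\<Prod>i\<in>J. 1 - q i)"
    using assms by (intro prod_mono conjI one_minus_ge_exp) auto
  finally have 1: "1 - (\<Prod>i\<in>J. 1 - q i) \<le> 1 - exp (- (s / (1 - \<epsilon>)))" by simp
  have "exp ((1 - \<epsilon>) * - (s / (1 - \<epsilon>)) + \<epsilon> * 0) \<le> (1 - \<epsilon>) * exp (- (s / (1 - \<epsilon>))) + \<epsilon> * exp 0"
    using convex_onD[OF exp_convex, of "1 - \<epsilon>" 0 "- (s / (1 - \<epsilon>))"] assms by simp
  moreover have "(1 - \<epsilon>) * - (s / (1 - \<epsilon>)) = - s" using assms by simp
  ultimately have "exp (- s) \<le> (1 - \<epsilon>) * exp (- (s / (1 - \<epsilon>))) + \<epsilon>" by simp
  then have "(1 - \<epsilon>) * (1 - exp (- (s / (1 - \<epsilon>)))) \<le> 1 - exp (- s)"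
    by (simp add: algebra_simps)
  moreover have "(1 - \<epsilon>) * (1 - (\<Prod>i\<in>J. 1 - q i)) \<le> (1 - \<epsilon>) * (1 - exp (- (s / (1 - \<epsilon>))))"
    using 1 assms by (intro mult_left_mono) auto
  ultimately show ?thesis by (simp add: s_def)
qed

text \<open>\<open>EMAXB\<close> is at most \<open>T + W\<close>, where \<open>W\<close> bounds the
  mean truncated excess. The policy earns \<open>(1 - 5 / K) * T\<close> from the base and
  \<open>(1 - 2 / K) * kertz * (1 - 1 / K) * W\<close> from the surplus: the first factor is the
  share of the first phase, the last the passage from the product to the exponential.\<close>

lemma dp_policy_guarantee:
  fixes D :: "nat \<Rightarrow> real measure" and n k K N M :: nat and T B :: real and Z :: "nat \<Rightarrow> real"
  assumes prob: "\<And>i. prob_space (D i)" and sets: "\<And>i. sets (D i) = sets borel"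
    and K: "K = 2 ^ k" "2 \<le> k" and N: "N = 2 * k * K\<^sup>2" "N \<le> n"
    and T: "0 \<le> T" and B: "0 \<le> B"
    and R: "N \<le> card {i. i < n \<and> 1 / K \<le> tail_ge (D i) T}"
    and J: "J = {i. i < n \<and> tail_gt (D i) T \<le> 1 / K}"
    and M: "M = (n - 1) * (K - 1) div K"
    and Z_M: "Z M = 0"
    and Z: "\<And>m. m < M \<Longrightarrow> Z m = Z (Suc m) + (\<Sum>i\<in>J. excess (D i) (T + B) (T + Z (Suc m))) / M"
    and Q: "prob_space Q"
  shows "ennreal (kertz - 5 / K) * EMAXB (T + B) D J \<le>
    expected_reward D {..<n} Q (\<lambda>_. pos_policy (dp_acc M J T (\<lambda>m. T + Z (Suc m))))"
proof -
  interpret D: prob_space "D j" for j by (rule prob)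
  note [measurable_cong] = sets
  have space: "space (D i) = UNIV" for i using sets_eq_imp_space_eq[OF sets] by simp
  have K4: "4 \<le> K" using power_increasing[of 2 k "2 :: nat"] K by simp
  have kK: "k \<le> K" "0 < k" using K less_exp[of k] by auto
  have n32: "2 * K * K \<le> n"
  proof -
    have "2 * K * K \<le> 2 * k * K\<^sup>2" using kK by (simp add: power2_eq_square)
    with N show ?thesis by simp
  qed
  have nK: "2 * K \<le> n" "32 \<le> n"
  proof -
    have "2 * K * 1 \<le> 2 * K * K" using K4 by (intro mult_le_mono2) simp
    with n32 show "2 * K \<le> n" by linarith
    have "32 \<le> 2 * K * K" using mult_mono[of 4 K 4 K] K4 by simp
    with n32 show "32 \<le> n" by linarith
  qed
  define \<epsilon> where "\<epsilon> = 1 / real K"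
  have \<epsilon>: "0 < \<epsilon>" "\<epsilon> \<le> 1 / 4" using K4 by (auto simp: \<epsilon>_def field_simps)
  have M_le: "real M \<le> (1 - \<epsilon>) * (real n - 1)"
  proof -
    have "real M \<le> real ((n - 1) * (K - 1)) / real K" unfolding M by (rule of_nat_div_le_of_nat)
    also have "\<dots> = (1 - \<epsilon>) * (real n - 1)" using nK K4 by (simp add: \<epsilon>_def of_nat_diff field_simps)
    finally show ?thesis .
  qed
  have M_ge: "(1 - \<epsilon>) * (real n - 1) - 1 \<le> real M"
  proof -
    have "(n - 1) * (K - 1) \<le> M * K + K"
      unfolding M using K4 by (metis add_le_cancel_left div_mult_mod_eq less_imp_le mod_less_divisor not_numeral_le_zero zero_less_iff_neq_zero)
    then have "real ((n - 1) * (K - 1)) \<le> real (M * K + K)" by (rule of_nat_mono)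
    then show ?thesis using nK K4 by (simp add: \<epsilon>_def of_nat_diff field_simps)
  qed
  have M0: "0 < M" "M \<le> n"
  proof -
    have "(3 / 4) * 31 \<le> (1 - \<epsilon>) * (real n - 1)" using \<epsilon> nK by (intro mult_mono) auto
    with M_ge show "0 < M" by (cases M) auto
    have "(1 - \<epsilon>) * (real n - 1) \<le> 1 * (real n - 1)" using \<epsilon> nK by (intro mult_right_mono) auto
    with M_le show "M \<le> n" by simp
  qed
  \<comment> \<open>One \<open>\<epsilon>\<close> is the share of the safety net; the other covers
    the rounding in \<open>M\<close> and \<open>n - 1\<close> in place of \<open>n\<close>.\<close>
  have Mn: "1 - 2 * \<epsilon> \<le> real M / n"
  proof -
    have "2 \<le> \<epsilon> * n" using nK K4 by (simp add: \<epsilon>_def field_simps)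
    have "(1 - 2 * \<epsilon>) * n = (1 - \<epsilon>) * n - \<epsilon> * n" by (simp add: algebra_simps)
    also have "\<dots> \<le> (1 - \<epsilon>) * n - 2" using \<open>2 \<le> \<epsilon> * n\<close> by simp
    also have "\<dots> \<le> (1 - \<epsilon>) * (real n - 1) - 1" using \<epsilon> by (simp add: algebra_simps)
    finally have "(1 - 2 * \<epsilon>) * n \<le> M" using M_ge by simp
    then show ?thesis using nK by (simp add: pos_le_divide_eq)
  qed
  have finJ: "finite J" and JI: "J \<subseteq> {..<n}" by (auto simp: J)
  define q where "q = (\<lambda>i v. measure (D i) {x. T + v < x})"
  define L where "L = (\<lambda>v. \<Sum>i\<in>J. q i v)"
  have q0: "0 \<le> q i v" "q i v \<le> 1" for i v by (auto simp: q_def)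
  have q_anti: "q i w \<le> q i v" if "v \<le> w" for i v w
    unfolding q_def using that by (intro D.finite_measure_mono) (auto simp: sets)
  have q_small: "q i v \<le> \<epsilon>" if "i \<in> J" "0 \<le> v" for i v
  proof -
    have "q i v \<le> q i 0" by (rule q_anti) (use that in simp)
    also have "q i 0 = tail_gt (D i) T" by (simp add: q_def tail_gt_def greaterThan_def)
    finally show ?thesis using that by (simp add: J \<epsilon>_def)
  qed
  have antiL: "antimono L" unfolding L_def by (intro antimonoI sum_mono q_anti)
  have L0: "0 \<le> L v" for v unfolding L_def by (intro sum_nonneg q0)
  \<comment> \<open>\<open>kertz_dp\<close> demands this bound; it holds because
    \<open>\<epsilon> \<le> 1 / 4\<close> gives
    \<open>\<epsilon> \<le> 1 - 2 * \<epsilon>\<close>.\<close>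
  have LM: "L v \<le> M" if "0 \<le> v" for v
  proof -
    have "L v \<le> real (card J) * \<epsilon>"
      unfolding L_def using q_small that by (intro sum_bounded_above) auto
    also have "\<dots> \<le> real n * \<epsilon>"
      using card_mono[OF _ JI] \<epsilon> by (intro mult_right_mono) auto
    also have "\<dots> = \<epsilon> * n" by simp
    also have "\<dots> \<le> (1 - 2 * \<epsilon>) * n" using \<epsilon> by (intro mult_right_mono) auto
    also have "\<dots> \<le> M" using Mn nK by (simp add: pos_le_divide_eq)
    finally show ?thesis .
  qed
  have eqT: "{x \<in> space (D i). v < x - T} = {x. T + v < x}" for i v by (auto simp: space)
  have excn: "(\<integral>\<^sup>+x. ennreal (min (x - T) B - z) \<partial>D i) = ennreal (LINT v|lborel. indicator {z..B} v * q i v)"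
    for z i
  proof (cases "z \<le> B")
    case True
    have m: "(\<lambda>x. x - T) \<in> borel_measurable (D i)" by measurable
    show ?thesis
      using nn_integral_truncated[OF prob m True] by (simp add: eqT q_def)
  next
    case False
    then have "ennreal (min (x - T) B - z) = 0" for x by (intro ennreal_neg) auto
    with False show ?thesis by simp
  qed
  have exc0: "0 \<le> (LINT v|lborel. indicator {z..B} v * q i v)" for z i
    by (intro Bochner_Integration.integral_nonneg) (auto simp: q0)
  have ennreal_max0: "ennreal (max 0 y) = ennreal y" for y
    by (cases "0 \<le> y") (auto simp: max_def ennreal_neg)
  have exc: "excess (D i) (T + B) (T + z) = (LINT v|lborel. indicator {z..B} v * q i v)" for z i
  proof -
    have "(\<integral>\<^sup>+x. ennreal (max 0 (min x (T + B) - (T + z))) \<partial>D i)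
        = (\<integral>\<^sup>+x. ennreal (min (x - T) B - z) \<partial>D i)"
    proof (rule nn_integral_cong)
      fix x
      have "min x (T + B) - (T + z) = min (x - T) B - z" by (auto simp: min_def)
      then show "ennreal (max 0 (min x (T + B) - (T + z))) = ennreal (min (x - T) B - z)"
        by (simp only: ennreal_max0)
    qed
    then have "excess (D i) (T + B) (T + z) = enn2real (\<integral>\<^sup>+x. ennreal (min (x - T) B - z) \<partial>D i)"
      unfolding excess_def by (subst integral_eq_nn_integral) (auto)
    also have "\<dots> = (LINT v|lborel. indicator {z..B} v * q i v)"
      unfolding excn by (intro enn2real_ennreal exc0)
    finally show ?thesis .
  qed
  have intq: "integrable lborel (\<lambda>v. indicator {a..b} v * q i v)" for a b i
  proof -
    have "antimono (q i)" by (intro antimonoI q_anti)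
    from borel_measurable_antimono[OF this] show ?thesis
      by (rule integrable_bounded_Icc[where C = 1]) (use q0 in auto)
  qed
  have sum_exc: "(\<Sum>i\<in>J. excess (D i) (T + B) (T + z)) = (LINT v|lborel. indicator {z..B} v * L v)" for z
  proof -
    have "(LINT v|lborel. indicator {z..B} v * L v) = (LINT v|lborel. (\<Sum>i\<in>J. indicator {z..B} v * q i v))"
      by (simp only: L_def sum_distrib_left)
    also have "\<dots> = (\<Sum>i\<in>J. LINT v|lborel. indicator {z..B} v * q i v)"
      by (rule Bochner_Integration.integral_sum) (rule intq)
    finally show ?thesis by (simp only: exc)
  qed
  have Z': "Z m = Z (Suc m) + (LINT v|lborel. indicator {Z (Suc m)..B} v * L v) / M" if "m < M" for m
    using Z[OF that] sum_exc[of "Z (Suc m)"] by simp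
  note dp = kertz_dp[OF M0(1) B antiL L0 LM Z_M Z']
  define acc where "acc = dp_acc M J T (\<lambda>m. T + Z (Suc m))"
  have acc [measurable]: "Measurable.pred borel (acc m i)" for m i
    unfolding acc_def by measurable
  define a where "a = (\<lambda>m i. measure (D i) {x. acc m i x})"
  \<comment> \<open>Beyond \<open>T\<close>, an accepted early value is worth
    \<open>Z (Suc m)\<close> for certain, plus its excess over that, cut off at
    \<open>B\<close>.\<close>
  define g where "g = (\<lambda>m i. T * a m i + (if m < M \<and> i \<in> J then
      Z (Suc m) * q i (Z (Suc m)) + (LINT v|lborel. indicator {Z (Suc m)..B} v * q i v) else 0))"
  have a01: "0 \<le> a m i" "a m i \<le> 1" for m i by (auto simp: a_def)
  have a_early: "a m i = (if i \<in> J then q i (Z (Suc m)) else 0)" if "m < M" for m i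
    using that by (simp add: a_def acc_def dp_acc_def q_def)
  have a_late: "a m i = tail_ge (D i) T" if "M \<le> m" for m i
    using that by (simp add: a_def acc_def dp_acc_def tail_ge_def atLeast_def)
  have ZB: "0 \<le> Z (Suc m)" "Z (Suc m) \<le> B" if "m < M" for m
    using dp(2,3)[of "Suc m"] that by auto
  have g0: "T * a m i \<le> g m i" for m i
    unfolding g_def using ZB[of m] q0 exc0 by auto
  have g_le: "ennreal (g m i) \<le> (\<integral>\<^sup>+x. ennreal x * indicator {x. acc m i x} x \<partial>D i)" for m i
  proof (cases "m < M \<and> i \<in> J")
    case True
    let ?z = "Z (Suc m)"
    have z: "0 \<le> ?z" using ZB True by auto
    have aq: "a m i = q i ?z" using a_early True by simp
    have A: "{x. acc m i x} = {x. T + ?z < x}" using True by (simp add: acc_def dp_acc_def)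
    have g_eq: "g m i = (T + ?z) * q i ?z + (LINT v|lborel. indicator {?z..B} v * q i v)"
      using True by (simp add: g_def aq algebra_simps)
    have "ennreal (g m i) = ennreal (T + ?z) * emeasure (D i) {x. T + ?z < x}
        + (\<integral>\<^sup>+x. ennreal (min (x - T) B - ?z) \<partial>D i)"
      unfolding g_eq excn using T z exc0[of ?z i] q0
      by (simp add: ennreal_plus ennreal_mult D.emeasure_eq_measure flip: q_def[THEN fun_cong, THEN fun_cong])
    also have "\<dots> = (\<integral>\<^sup>+x. ennreal (T + ?z) * indicator {x. T + ?z < x} x + ennreal (min (x - T) B - ?z) \<partial>D i)"
      by (subst nn_integral_add) (auto simp: nn_integral_cmult_indicator sets)
    also have "\<dots> \<le> (\<integral>\<^sup>+x. ennreal x * indicator {x. acc m i x} x \<partial>D i)"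
      unfolding A
    proof (rule nn_integral_mono)
      fix x
      show "ennreal (T + ?z) * indicator {x. T + ?z < x} x + ennreal (min (x - T) B - ?z)
        \<le> ennreal x * indicator {x. T + ?z < x} x"
      proof (cases "T + ?z < x")
        case True
        have "ennreal (T + ?z) + ennreal (min (x - T) B - ?z) \<le> ennreal (T + ?z) + ennreal (x - T - ?z)"
          by (intro add_left_mono ennreal_leI) auto
        also have "\<dots> = ennreal x" using T z True by (subst ennreal_plus[symmetric]) auto
        finally show ?thesis using True by simp
      next
        case False
        then have "ennreal (min (x - T) B - ?z) = 0" by (intro ennreal_neg) auto
        then show ?thesis using False by simp
      qed
    qed
    finally show ?thesis .
  next
    case False
    then have "g m i = T * a m i" unfolding g_def by auto
    then have "ennreal (g m i) = (\<integral>\<^sup>+x. ennreal T * indicator {x. acc m i x} x \<partial>D i)"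
      using T by (simp add: a_def ennreal_mult D.emeasure_eq_measure nn_integral_cmult_indicator sets)
    also have "\<dots> \<le> (\<integral>\<^sup>+x. ennreal x * indicator {x. acc m i x} x \<partial>D i)"
      using False by (intro nn_integral_mono) (auto simp: indicator_def acc_def dp_acc_def intro!: ennreal_leI split: if_splits)
    finally show ?thesis .
  qed
  define R where "R = {i. i < n \<and> 1 / K \<le> tail_ge (D i) T}"
  define \<mu> where "\<mu> = real (n - M) * real (card R) * \<epsilon> / n"
  \<comment> \<open>The net has at least \<open>\<epsilon> * n\<close> positions, and
    \<open>R\<close> has at least \<open>2 * k * K\<^sup>2\<close> variables, each accepted there
    with probability at least \<open>1 / K\<close>.\<close>
  have \<mu>: "2 * real k \<le> \<mu>"
  proof -
    have nM: "\<epsilon> * n \<le> real (n - M)"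
    proof -
      have "real M \<le> (1 - \<epsilon>) * n" using M_le \<epsilon> by (simp add: algebra_simps)
      then show ?thesis using M0 by (simp add: of_nat_diff algebra_simps)
    qed
    have "2 * real k = (\<epsilon> * n) * N * \<epsilon> / n"
      using nK K4 by (simp add: N \<epsilon>_def power2_eq_square)
    also have "\<dots> \<le> real (n - M) * real (card R) * \<epsilon> / n"
      using nM \<epsilon> R by (intro divide_right_mono mult_right_mono mult_mono) (auto simp: R_def)
    finally show ?thesis by (simp add: \<mu>_def)
  qed
  moreover have "1 \<le> real k" using kK by simp
  ultimately have \<mu>1: "1 \<le> \<mu>" by linarith
  \<comment> \<open>Here \<open>N\<close> needs its factor \<open>k\<close>: \<open>exp k\<close> is
    at least \<open>2 ^ k = K\<close>.\<close>
  have exp_mu: "exp (- (\<mu> / 2)) \<le> \<epsilon>"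
  proof -
    have "real K \<le> exp 1 ^ k"
      unfolding K(1) of_nat_power using exp_ge_add_one_self[of 1] by (intro power_mono) auto
    also have "\<dots> = exp (real k)" by (simp flip: exp_of_nat_mult)
    also have "\<dots> \<le> exp (\<mu> / 2)" using \<mu> by simp
    finally show ?thesis using K4 by (simp add: \<epsilon>_def exp_minus field_simps)
  qed
  have late_small: "exp (- (\<mu> / 2)) + 4 * \<epsilon> / \<mu> \<le> 5 * \<epsilon>"
  proof -
    have "4 * \<epsilon> / \<mu> \<le> 4 * \<epsilon> / 1" using \<mu>1 \<epsilon> by (intro divide_left_mono) auto
    with exp_mu show ?thesis by simp
  qed
  have sumJ: "(\<Sum>i<n. if i \<in> J then f i else 0) = (\<Sum>i\<in>J. f i)" for f :: "nat \<Rightarrow> real"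
    using JI by (simp add: sum.If_cases Int_absorb1)
  \<comment> \<open>\<open>Z'\<close> regrouped: \<open>Z (Suc m) * L (Z (Suc m)) / M\<close> is
    subtracted in the survival factor and added to the surplus.\<close>
  have Zrec: "Z m = (1 - (\<Sum>i<n. a m i) / M) * Z (Suc m) + (\<Sum>i<n. g m i - T * a m i) / M"
    if "m < M" for m
  proof -
    have "(\<Sum>i<n. a m i) = L (Z (Suc m))"
      using that by (simp add: a_early sumJ L_def)
    moreover have "(\<Sum>i<n. g m i - T * a m i)
        = Z (Suc m) * L (Z (Suc m)) + (LINT v|lborel. indicator {Z (Suc m)..B} v * L v)"
      using that sum_exc[of "Z (Suc m)"] by (simp add: g_def sumJ L_def sum.distrib sum_distrib_left exc)
    ultimately show ?thesis
      using Z'[OF that] by (simp add: algebra_simps add_divide_distrib)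
  qed
  have main: "T * (1 - (exp (- (\<mu> / 2)) + 4 * \<epsilon> / \<mu>)) + real M / n * Z 0 \<le> pavg {..<n} (order_reward a g 0)"
  proof (rule pavg_order_reward_ge[where R = R and M = M])
    show "(\<Sum>i<n. a p i) \<le> M" if "p < M" for p
      using that LM ZB by (simp add: a_early sumJ flip: L_def[THEN fun_cong])
    show "a p i \<le> \<epsilon>" if "p < M" for p i
      using that q_small ZB \<epsilon> by (simp add: a_early)
    show "\<epsilon> \<le> a p i" if "M \<le> p" "i \<in> R" for p i
      using that by (simp add: a_late R_def \<epsilon>_def)
  qed (use nK M0 T \<epsilon> M_le a01 g0 \<mu>1 Z_M Zrec in \<open>auto simp: R_def \<mu>_def\<close>)
  define W where "W = (LINT v|lborel. indicator {0..B} v * (1 - (\<Prod>i\<in>J. 1 - q i v)))"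
  have W0: "0 \<le> W"
    unfolding W_def by (intro Bochner_Integration.integral_nonneg)
      (auto intro!: mult_nonneg_nonneg prod_le_1 simp: q0)
  have mq: "q i \<in> borel_measurable borel" for i
    by (intro borel_measurable_antimono antimonoI q_anti)
  have intW: "integrable lborel (\<lambda>v. indicator {0..B} v * (1 - (\<Prod>i\<in>J. 1 - q i v)))"
  proof (rule integrable_bounded_Icc[where C = 1])
    show "(\<lambda>v. 1 - (\<Prod>i\<in>J. 1 - q i v)) \<in> borel_measurable borel" using mq by measurable
    have "0 \<le> (\<Prod>i\<in>J. 1 - q i v) \<and> (\<Prod>i\<in>J. 1 - q i v) \<le> 1" for v
      by (auto intro!: prod_nonneg prod_le_1 simp: q0)
    then show "\<bar>1 - (\<Prod>i\<in>J. 1 - q i v)\<bar> \<le> 1" for v by (simp add: abs_le_iff)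
  qed
  have "(1 - \<epsilon>) * W = (LINT v|lborel. (1 - \<epsilon>) * (indicator {0..B} v * (1 - (\<Prod>i\<in>J. 1 - q i v))))"
    by (simp add: W_def)
  also have "\<dots> \<le> (LINT v|lborel. indicator {0..B} v * (1 - exp (- L v)))"
  proof (intro integral_mono integrable_mult_right intW)
    show "integrable lborel (\<lambda>v. indicator {0..B} v * (1 - exp (- L v)))"
      using borel_measurable_antimono[OF antiL] L0
      by (intro integrable_bounded_Icc[where C = 1]) auto
    show "(1 - \<epsilon>) * (indicator {0..B} v * (1 - (\<Prod>i\<in>J. 1 - q i v))) \<le> indicator {0..B} v * (1 - exp (- L v))" for v
      using one_minus_prod_le[OF finJ, of "\<lambda>i. q i v" \<epsilon>] q0 q_small[of _ v] \<epsilon>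
      by (auto simp: indicator_def L_def)
  qed
  finally have WL: "(1 - \<epsilon>) * W \<le> (LINT v|lborel. indicator {0..B} v * (1 - exp (- L v)))" .
  have "(kertz - 5 * \<epsilon>) * (T + W) \<le> pavg {..<n} (order_reward a g 0)"
  proof -
    have "(kertz - 5 * \<epsilon>) * T \<le> (1 - 5 * \<epsilon>) * T"
      using kertz_works T by (intro mult_right_mono) auto
    also have "\<dots> \<le> T * (1 - (exp (- (\<mu> / 2)) + 4 * \<epsilon> / \<mu>))"
      using late_small T by (simp add: mult.commute mult_left_mono)
    finally have 1: "(kertz - 5 * \<epsilon>) * T \<le> T * (1 - (exp (- (\<mu> / 2)) + 4 * \<epsilon> / \<mu>))" .
    have "kertz * \<epsilon> \<le> 1 * \<epsilon>" using kertz_works \<epsilon> by (intro mult_right_mono) auto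
    moreover have "(1 - 2 * \<epsilon>) * kertz * (1 - \<epsilon>) = kertz - 3 * (kertz * \<epsilon>) + 2 * (\<epsilon> * \<epsilon> * kertz)"
      by (simp add: algebra_simps)
    moreover have "0 \<le> \<epsilon> * \<epsilon> * kertz" using kertz_works(1) by simp
    ultimately have "kertz - 5 * \<epsilon> \<le> (1 - 2 * \<epsilon>) * kertz * (1 - \<epsilon>)"
      using \<epsilon>(1) by linarith
    then have "(kertz - 5 * \<epsilon>) * W \<le> (1 - 2 * \<epsilon>) * kertz * (1 - \<epsilon>) * W"
      using W0 by (intro mult_right_mono)
    also have "\<dots> = (1 - 2 * \<epsilon>) * (kertz * ((1 - \<epsilon>) * W))" by simp
    also have "\<dots> \<le> real M / n * (kertz * ((1 - \<epsilon>) * W))"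
      using Mn kertz_works \<epsilon> W0 by (intro mult_right_mono) auto
    also have "\<dots> \<le> real M / n * Z 0"
      using dp(1) WL kertz_works by (intro mult_left_mono) (auto intro: order_trans[OF mult_left_mono])
    finally have "(kertz - 5 * \<epsilon>) * W \<le> real M / n * Z 0" .
    with 1 main show ?thesis by (simp add: distrib_left)
  qed
  then have "ennreal (kertz - 5 * \<epsilon>) * ennreal (T + W) \<le> ennreal (pavg {..<n} (order_reward a g 0))"
    using T W0 by (subst ennreal_mult''[symmetric]) (auto intro: ennreal_leI)
  moreover have gnn: "0 \<le> g m i" for m i
    using g0[of m i] a01[of m i] T by (meson mult_nonneg_nonneg order_trans)
  moreover have "EMAXB (T + B) D J \<le> ennreal (T + W)"
    using EMAXB_le[OF prob sets finJ T B] by (simp add: W_def q_def)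
  moreover have "ennreal (pavg {..<n} (order_reward a g 0)) \<le> expected_reward D {..<n} Q (\<lambda>_. pos_policy acc)"
    by (rule expected_reward_pos_policy_ge[OF prob sets acc _ gnn g_le _ Q]) (auto simp: a_def)
  ultimately show ?thesis
    unfolding acc_def by (simp add: \<epsilon>_def) (meson mult_left_mono order_trans zero_le)
qed

section \<open>Arbitrary distributions\<close>

text \<open>\<open>u\<close> is the infimum of the nonnegative points with strict upper tail at most
  \<open>p\<close>. Approaching \<open>u\<close> from the right gives the bound on
  \<open>tail_gt\<close>, from the left the one on \<open>tail_ge\<close>; if \<open>u = 0\<close>,
  nonnegativity replaces the left limit.\<close>

lemma quantile_exists:
  assumes N: "prob_space N" and sets: "sets N = sets borel" and nonneg: "AE x in N. 0 \<le> (x :: real)"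
    and p: "0 < p" "p \<le> 1"
  obtains u where "0 \<le> u" "p \<le> tail_ge N u" "tail_gt N u \<le> p"
proof -
  interpret N: prob_space N by (rule N)
  have space: "space N = UNIV" using sets_eq_imp_space_eq[OF sets] by simp
  have meas: "{t<..} \<in> sets N" "{t..} \<in> sets N" for t by (simp_all add: sets)
  have mono: "tail_gt N t \<le> tail_gt N s" if "s \<le> t" for s t
    unfolding tail_gt_def using that by (intro N.finite_measure_mono meas) auto
  define A where "A = {t. 0 \<le> t \<and> tail_gt N t \<le> p}"
  have lim0: "(\<lambda>m. tail_gt N (real m)) \<longlonglongrightarrow> 0"
  proof -
    have "(\<lambda>m. measure N {real m<..}) \<longlonglongrightarrow> measure N (\<Inter>m. {real m<..})"
      by (rule N.finite_Lim_measure_decseq) (auto simp: sets decseq_def)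
    moreover have "(\<Inter>m. {real m<..}) = {}"
      by (auto simp: set_eq_iff not_less real_arch_simple)
    ultimately show ?thesis by (simp add: tail_gt_def)
  qed
  have "A \<noteq> {}"
  proof -
    from order_tendstoD(2)[OF lim0 p(1)] obtain m where "tail_gt N (real m) < p"
      by (auto simp: eventually_sequentially)
    then have "real m \<in> A" by (simp add: A_def)
    then show ?thesis by blast
  qed
  have bdd: "bdd_below A" by (auto simp: A_def bdd_below_def)
  define u where "u = Inf A"
  have u0: "0 \<le> u" unfolding u_def using \<open>A \<noteq> {}\<close> by (intro cInf_greatest) (auto simp: A_def)
  have above: "tail_gt N t \<le> p" if ut: "u < t" for t
  proof -
    obtain a where "a \<in> A" "a < t"
      using ut cInf_less_iff[OF \<open>A \<noteq> {}\<close> bdd, of t] unfolding u_def by blast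
    with mono[of a t] show ?thesis by (simp add: A_def)
  qed
  have below: "p < tail_gt N t" if "0 \<le> t" "t < u" for t
  proof (rule ccontr)
    assume "\<not> ?thesis"
    then have "t \<in> A" using that by (simp add: A_def)
    from cInf_lower[OF this bdd] that show False by (simp add: u_def)
  qed
  have "tail_gt N u \<le> p"
  proof -
    have "(\<lambda>m. measure N {u + 1 / real (Suc m)<..}) \<longlonglongrightarrow> measure N (\<Union>m. {u + 1 / real (Suc m)<..})"
    proof (rule N.finite_Lim_measure_incseq)
      show "incseq (\<lambda>m. {u + 1 / real (Suc m)<..})"
        by (intro incseq_SucI) (auto intro!: frac_le elim!: order.strict_trans1[rotated])
    qed (auto simp: sets)
    moreover have "(\<Union>m. {u + 1 / real (Suc m)<..}) = {u<..}"
    proof (intro equalityI subsetI)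
      fix x assume "x \<in> {u<..}"
      then have "0 < x - u" by simp
      then obtain m where "1 / real (Suc m) < x - u" by (rule nat_approx_posE)
      then show "x \<in> (\<Union>m. {u + 1 / real (Suc m)<..})" by (auto intro!: exI[of _ m])
    qed (auto intro: order.strict_trans[rotated] simp: add_strict_increasing)
    ultimately have "(\<lambda>m. tail_gt N (u + 1 / real (Suc m))) \<longlonglongrightarrow> tail_gt N u"
      by (simp add: tail_gt_def)
    then show ?thesis by (rule LIMSEQ_le_const2) (auto intro!: above)
  qed
  moreover have "p \<le> tail_ge N u"
  proof (cases "u = 0")
    case True
    have "measure N {0..} = 1"
      using nonneg N.prob_eq_1[of "{0..}"] by (simp add: sets)
    then show ?thesis using True p by (simp add: tail_ge_def)
  next
    case False
    with u0 have "0 < u" by simp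
    have "(\<lambda>m. measure N {u - u / real (Suc m)<..}) \<longlonglongrightarrow> measure N (\<Inter>m. {u - u / real (Suc m)<..})"
    proof (rule N.finite_Lim_measure_decseq)
      show "decseq (\<lambda>m. {u - u / real (Suc m)<..})"
        using \<open>0 < u\<close> by (intro decseq_SucI) (auto intro!: frac_le elim!: order.strict_trans1[rotated])
    qed (auto simp: sets)
    moreover have "(\<Inter>m. {u - u / real (Suc m)<..}) = {u..}"
    proof (intro equalityI subsetI)
      fix x assume x: "x \<in> (\<Inter>m. {u - u / real (Suc m)<..})"
      show "x \<in> {u..}"
      proof (rule ccontr)
        assume "x \<notin> {u..}"
        then have "0 < (u - x) / u" using \<open>0 < u\<close> by simp
        then obtain m where "1 / real (Suc m) < (u - x) / u" by (rule nat_approx_posE)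
        then have "u / real (Suc m) < u - x" using \<open>0 < u\<close> by (simp add: field_simps)
        moreover have "u - u / real (Suc m) < x" using x by blast
        ultimately show False by simp
      qed
    next
      fix x assume x: "x \<in> {u..}"
      show "x \<in> (\<Inter>m. {u - u / real (Suc m)<..})"
      proof (rule INT_I)
        fix m
        have "0 < u / real (Suc m)" using \<open>0 < u\<close> by simp
        with x show "x \<in> {u - u / real (Suc m)<..}" by (simp del: of_nat_Suc)
      qed
    qed
    ultimately have "(\<lambda>m. tail_gt N (u - u / real (Suc m))) \<longlonglongrightarrow> tail_ge N u"
      by (simp add: tail_gt_def tail_ge_def)
    moreover have "p \<le> tail_gt N (u - u / real (Suc m))" for m
    proof (rule less_imp_le[OF below])
      have "u / real (Suc m) \<le> u / 1" using \<open>0 < u\<close> by (intro divide_left_mono) auto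
      then show "0 \<le> u - u / real (Suc m)" by simp
    qed (use \<open>0 < u\<close> in simp)
    ultimately show ?thesis using LIMSEQ_le_const by blast
  qed
  ultimately show ?thesis using that u0 by blast
qed

text \<open>\<open>T\<close> is the \<open>N\<close>-th largest of the \<open>u i\<close>: were
  \<open>N\<close> indices strictly above it, the least of their values would be a larger
  candidate.\<close>

lemma exists_top_threshold:
  fixes u :: "nat \<Rightarrow> real"
  assumes "0 < N" "N \<le> n" and u: "\<And>i. i < n \<Longrightarrow> 0 \<le> u i"
  obtains T where "0 \<le> T" "N \<le> card {i. i < n \<and> T \<le> u i}" "card {i. i < n \<and> T < u i} < N"
proof -
  define C where "C = {t \<in> u ` {..<n}. N \<le> card {i. i < n \<and> t \<le> u i}}"
  have "finite C" by (simp add: C_def)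
  have "u 0 \<in> u ` {..<n}" using assms by simp
  then have n: "u ` {..<n} \<noteq> {}" by blast
  have "{i. i < n \<and> Min (u ` {..<n}) \<le> u i} = {..<n}" by auto
  then have "Min (u ` {..<n}) \<in> C"
    using assms(2) Min_in[OF _ n] by (simp add: C_def)
  then have C: "C \<noteq> {}" by blast
  define T where "T = Max C"
  have T: "T \<in> C" unfolding T_def using \<open>finite C\<close> C by (rule Max_in)
  have "card {i. i < n \<and> T < u i} < N"
  proof (rule ccontr)
    define X where "X = {i. i < n \<and> T < u i}"
    assume "\<not> ?thesis"
    then have X: "N \<le> card X" by (simp add: X_def)
    have "X \<noteq> {}"
    proof
      assume "X = {}"
      with X assms(1) show False by simp
    qed
    have "finite X" by (simp add: X_def)
    then have min: "Min (u ` X) \<in> u ` X" using \<open>X \<noteq> {}\<close> by (intro Min_in) auto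
    have "X \<subseteq> {i. i < n \<and> Min (u ` X) \<le> u i}" using \<open>finite X\<close> by (auto simp: X_def)
    then have "card X \<le> card {i. i < n \<and> Min (u ` X) \<le> u i}" by (intro card_mono) auto
    then have "Min (u ` X) \<in> C" using X min by (auto simp: C_def X_def)
    then have "Min (u ` X) \<le> T" unfolding T_def using \<open>finite C\<close> by simp
    moreover have "T < Min (u ` X)" using min by (auto simp: X_def)
    ultimately show False by simp
  qed
  moreover have "0 \<le> T" "N \<le> card {i. i < n \<and> T \<le> u i}" using T u by (auto simp: C_def)
  ultimately show ?thesis using that by blast
qed

text \<open>The origin of the constants. \<open>K = 2 ^ k\<close> lies above
  \<open>1 / (4 * \<epsilon>)\<close> and, for positive \<open>k\<close>, not above
  \<open>1 / (2 * \<epsilon>)\<close>. So \<open>5 / K\<close> becomes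
  \<open>20 * \<epsilon>\<close>, and with \<open>k \<le> 2 * ln (1 / \<epsilon>)\<close>, from
  \<open>1 / 2 \<le> ln 2\<close>, the count \<open>2 * k * K\<^sup>2\<close> is at most
  \<open>ln (1 / \<epsilon>) / \<epsilon>\<^sup>2\<close>. For \<open>k = 0\<close> the count is
  \<open>0\<close>, which the truncated bound always allows.\<close>

lemma removal_params:
  fixes \<epsilon> :: real
  assumes \<epsilon>: "0 < \<epsilon>" and k: "1 < 2 ^ k * (4 * \<epsilon>)" "k = 0 \<or> 2 ^ (k - 1) * (4 * \<epsilon>) \<le> 1"
  shows "real (2 * k * (2 ^ k)\<^sup>2) \<le> removal_bound 1 \<epsilon>" "5 / 2 ^ k \<le> 20 * \<epsilon>"
proof -
  show "5 / 2 ^ k \<le> 20 * \<epsilon>" using k(1) by (simp add: field_simps)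
  show "real (2 * k * (2 ^ k)\<^sup>2) \<le> removal_bound 1 \<epsilon>"
  proof (cases k)
    case 0
    then show ?thesis using \<epsilon> by (simp add: removal_bound_def)
  next
    case (Suc j)
    with k(2) have K: "2 ^ k \<le> 1 / (2 * \<epsilon>)" using \<epsilon> by (simp add: field_simps)
    have ln2: "1 / 2 \<le> ln (2 :: real)"
      using ln_one_minus_pos_upper_bound[of "1 / 2 :: real"] by (simp add: ln_div)
    have "real k * (1 / 2) \<le> real k * ln 2" using ln2 by (intro mult_left_mono) auto
    also have "\<dots> = ln (2 ^ k)" by (simp add: ln_realpow)
    also have "\<dots> \<le> ln (1 / (2 * \<epsilon>))" using K \<epsilon> by (subst ln_le_cancel_iff) auto
    also have "\<dots> \<le> ln (1 / \<epsilon>)" using \<epsilon> by (subst ln_le_cancel_iff) (auto simp: field_simps)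
    finally have l: "real k \<le> 2 * ln (1 / \<epsilon>)" by simp
    have "1 \<le> 1 / (2 * \<epsilon>)" using K one_le_power[of "2 :: real" k] by linarith
    then have "\<epsilon> \<le> 1" using \<epsilon> by (simp add: field_simps)
    have "real (2 * k * (2 ^ k)\<^sup>2) = 2 * (real k * (2 ^ k)\<^sup>2)" by simp
    also have "\<dots> \<le> 2 * (2 * ln (1 / \<epsilon>) * (1 / (2 * \<epsilon>))\<^sup>2)"
      using l K \<epsilon> \<open>\<epsilon> \<le> 1\<close> by (intro mult_left_mono mult_mono power_mono) auto
    also have "\<dots> = 1 * (1 / \<epsilon>\<^sup>2) * ln (1 / \<epsilon>)" using \<epsilon> by (simp add: power2_eq_square)
    also have "\<dots> \<le> removal_bound 1 \<epsilon>"
      unfolding removal_bound_def by (intro mult_left_mono) auto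
    finally show ?thesis .
  qed
qed

lemma removal_params_exist:
  fixes \<epsilon> :: real
  assumes \<epsilon>: "0 < \<epsilon>"
  obtains k where "1 < 2 ^ k * (4 * \<epsilon>)" "k = 0 \<or> 2 ^ (k - 1) * (4 * \<epsilon>) \<le> 1"
proof -
  define P where "P = (\<lambda>k::nat. 1 < 2 ^ k * (4 * \<epsilon>))"
  have "\<exists>k. P k"
  proof -
    obtain k where "1 / (4 * \<epsilon>) < 2 ^ k" using real_arch_pow[of 2 "1 / (4 * \<epsilon>)"] by auto
    then show ?thesis using \<epsilon> by (auto simp: P_def field_simps)
  qed
  then have "P (LEAST k. P k)" by (rule LeastI_ex)
  moreover have "\<not> P ((LEAST k. P k) - 1)" if "(LEAST k. P k) \<noteq> 0"
    using that by (intro not_less_Least) simp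
  ultimately show ?thesis using that unfolding P_def by (metis not_less)
qed

lemma EMAX_empty [simp]: "EMAX D {} = 0"
  by (simp add: EMAX_def bot_ennreal)

lemma prob_space_uniform_seed: "prob_space uniform_seed"
  unfolding uniform_seed_def by (intro prob_space_uniform_measure) auto

text \<open>Indexed by the number of steps that remain: \<open>Z m\<close> is the value at
  \<open>M - m\<close>.\<close>

primrec dp_values :: "(real \<Rightarrow> real) \<Rightarrow> nat \<Rightarrow> real" where
  "dp_values f 0 = 0"
| "dp_values f (Suc r) = dp_values f r + f (dp_values f r)"

text \<open>If \<open>k < 2\<close>, the factor \<open>kertz - 20 * \<epsilon>\<close> is negative
  and the bound trivial; if there are fewer than \<open>N\<close> variables, all may be removed.
  Otherwise \<open>T\<close> is the \<open>N\<close>-th largest of the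
  \<open>1 / K\<close>-quantiles, and a removed variable has its quantile above
  \<open>T\<close>.\<close>

lemma OPT_ge_after_removal:
  fixes D :: "nat \<Rightarrow> real measure"
  assumes \<epsilon>: "0 < \<epsilon>"
    and D: "\<And>i. i < n \<Longrightarrow> real_distribution (D i)" "\<And>i. i < n \<Longrightarrow> AE x in D i. 0 \<le> x"
  shows "\<exists>J \<subseteq> {..<n}. real (card ({..<n} - J)) \<le> removal_bound 1 \<epsilon> \<and>
    ennreal (kertz - 20 * \<epsilon>) * EMAX D J \<le> OPT D {..<n}"
proof -
  obtain k where k: "1 < 2 ^ k * (4 * \<epsilon>)" "k = 0 \<or> 2 ^ (k - 1) * (4 * \<epsilon>) \<le> 1"
    using removal_params_exist[OF \<epsilon>] by blast
  note params = removal_params[OF \<epsilon> k]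
  define K :: nat where "K = 2 ^ k"
  define N where "N = 2 * k * K\<^sup>2"
  have N_le: "real N \<le> removal_bound 1 \<epsilon>" using params(1) by (simp add: N_def K_def)
  consider "k < 2" | "2 \<le> k" "n < N" | "2 \<le> k" "N \<le> n" by linarith
  then show ?thesis
  proof cases
    case 1
    then have "(2 :: real) ^ k \<le> 2 ^ 1" by (intro power_increasing) auto
    then have "5 / 2 \<le> 5 / (2 :: real) ^ k" by (intro divide_left_mono) auto
    then have "kertz - 20 * \<epsilon> < 0" using kertz_works params(2) by linarith
    then have "ennreal (kertz - 20 * \<epsilon>) = 0" by (intro ennreal_neg) simp
    moreover have "0 \<le> removal_bound 1 \<epsilon>" by (simp add: removal_bound_def)
    ultimately show ?thesis by (intro exI[of _ "{..<n}"]) auto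
  next
    case 2
    with N_le show ?thesis by (intro exI[of _ "{}"]) auto
  next
    case 3
    \<comment> \<open>Indices outside the range get the point mass at \<open>0\<close>, because the
      preceding results ask for probability laws at all indices.\<close>
    define D' where "D' = (\<lambda>i. if i < n then D i else return borel 0)"
    have prob: "prob_space (D' i)" for i
      using D(1)[of i] by (auto simp: D'_def real_distribution_def intro: prob_space_return)
    have sets: "sets (D' i) = sets borel" for i
      using D(1)[of i] by (auto simp: D'_def real_distribution_def real_distribution_axioms_def)
    have nonneg: "AE x in D' i. 0 \<le> x" for i
    proof (cases "i < n")
      case False
      have "AE x in return borel 0. 0 \<le> (x :: real)" by (subst AE_return) auto
      moreover have "D' i = return borel 0" using False unfolding D'_def by simp
      ultimately show ?thesis by (simp only:)
    next
      case True
      then have "D' i = D i" unfolding D'_def by simp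
      with True D(2)[of i] show ?thesis by (simp only:)
    qed
    have K0: "0 < K" by (simp add: K_def)
    have "\<exists>u\<ge>0. 1 / K \<le> tail_ge (D' i) u \<and> tail_gt (D' i) u \<le> 1 / K" for i
      using quantile_exists[OF prob sets nonneg, of "1 / K"] K0 by (metis One_nat_def Suc_leI divide_le_eq_1 less_divide_eq_1_pos of_nat_0_less_iff of_nat_1 of_nat_le_iff zero_less_divide_1_iff)
    then obtain u where u: "\<And>i. 0 \<le> u i" "\<And>i. 1 / K \<le> tail_ge (D' i) (u i)"
        "\<And>i. tail_gt (D' i) (u i) \<le> 1 / K" by metis
    have "0 < N" using 3 K0 by (simp add: N_def)
    then obtain T where T: "0 \<le> T" "N \<le> card {i. i < n \<and> T \<le> u i}" "card {i. i < n \<and> T < u i} < N"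
      using exists_top_threshold[of N n u] 3 u(1) by blast
    define J where "J = {i. i < n \<and> tail_gt (D' i) T \<le> 1 / K}"
    have mono: "tail_ge (D' i) t \<le> tail_ge (D' i) s" "tail_gt (D' i) t \<le> tail_gt (D' i) s"
      if "s \<le> t" for s t i
      unfolding tail_ge_def tail_gt_def using that prob[of i]
      by (auto intro!: finite_measure.finite_measure_mono prob_space.finite_measure simp: sets)
    have R: "N \<le> card {i. i < n \<and> 1 / K \<le> tail_ge (D' i) T}"
    proof (rule order_trans[OF T(2) card_mono])
      show "{i. i < n \<and> T \<le> u i} \<subseteq> {i. i < n \<and> 1 / K \<le> tail_ge (D' i) T}"
        using order_trans[OF u(2) mono(1)] by blast
    qed simp
    have "{..<n} - J \<subseteq> {i. i < n \<and> T < u i}"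
    proof
      fix i assume i: "i \<in> {..<n} - J"
      then have "\<not> tail_gt (D' i) T \<le> 1 / K" by (simp add: J_def)
      then have "T < u i" using mono(2)[of "u i" T i] u(3)[of i] by linarith
      with i show "i \<in> {i. i < n \<and> T < u i}" by simp
    qed
    then have "card ({..<n} - J) \<le> card {i. i < n \<and> T < u i}" by (intro card_mono) auto
    then have card: "real (card ({..<n} - J)) \<le> removal_bound 1 \<epsilon>" using T(3) N_le by linarith
    define M where "M = (n - 1) * (K - 1) div K"
    have "(\<Pi>\<^sub>M i\<in>J. D i) = (\<Pi>\<^sub>M i\<in>J. D' i)"
      by (intro PiM_cong refl) (auto simp: D'_def J_def)
    then have EMAX_eq: "EMAX D J = EMAX D' J" by (simp only: EMAX_def)
    have er_eq: "expected_reward D {..<n} Q d = expected_reward D' {..<n} Q d" for Q :: "real measure" and d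
    proof -
      have "(\<Pi>\<^sub>M i\<in>{..<n}. D i) = (\<Pi>\<^sub>M i\<in>{..<n}. D' i)" by (intro PiM_cong refl) (auto simp: D'_def)
      then show ?thesis by (simp add: expected_reward_def)
    qed
    \<comment> \<open>The thresholds depend on the truncation \<open>b\<close>, so the bound that is
      uniform in \<open>b\<close> is one for the supremum and not for a single policy.\<close>
    have le: "ennreal (kertz - 5 / K) * EMAXB b D' J \<le> OPT D {..<n}" if b: "T \<le> b" for b
    proof -
      define Z where "Z = (\<lambda>m. dp_values (\<lambda>z. (\<Sum>i\<in>J. excess (D' i) (T + (b - T)) (T + z)) / M) (M - m))"
      have "ennreal (kertz - 5 / K) * EMAXB (T + (b - T)) D' J \<le>
        expected_reward D' {..<n} uniform_seed (\<lambda>_. pos_policy (dp_acc M J T (\<lambda>m. T + Z (Suc m))))"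
      proof (rule dp_policy_guarantee[OF prob sets K_def _ N_def _ T(1) _ R J_def M_def])
        show "Z m = Z (Suc m) + (\<Sum>i\<in>J. excess (D' i) (T + (b - T)) (T + Z (Suc m))) / M" if "m < M" for m
        proof -
          have "M - m = Suc (M - Suc m)" using that by simp
          then show ?thesis by (simp only: Z_def dp_values.simps)
        qed
      qed (use 3 b prob_space_uniform_seed in \<open>auto simp: Z_def\<close>)
      also have "\<dots> \<le> OPT D {..<n}"
        unfolding OPT_def er_eq
        by (intro SUP_upper) (auto intro!: policy_pos_policy measurable_dp_acc)
      finally show ?thesis by simp
    qed
    have "ennreal (kertz - 5 / K) * EMAX D' J \<le> OPT D {..<n}"
      by (rule EMAX_le_if_EMAXB_le[OF sets _ le]) (simp_all add: J_def)
    moreover have "ennreal (kertz - 20 * \<epsilon>) \<le> ennreal (kertz - 5 / K)"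
      using params(2) by (intro ennreal_leI) (simp add: K_def)
    ultimately have "ennreal (kertz - 20 * \<epsilon>) * EMAX D J \<le> OPT D {..<n}"
      unfolding EMAX_eq by (meson mult_right_mono order_trans zero_le)
    with card show ?thesis by (intro exI[of _ J]) (auto simp: J_def)
  qed
qed

section \<open>Verifying programs of the random access machine\<close>

definition mem_bits :: "nat \<Rightarrow> mem \<Rightarrow> bool" where
  "mem_bits \<beta> m \<longleftrightarrow> (\<forall>a. m a < 2 ^ \<beta>)"

text \<open>A bound on the length of a value in units of \<open>\<beta> + 1\<close> bits, read off
  the syntax. The unit is positive even for \<open>\<beta> = 0\<close>, so it also covers constants
  and carries.\<close>

fun wexp :: "rexp \<Rightarrow> nat" where
  "wexp (Cn k) = bits k"
| "wexp (Ld e) = 1"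
| "wexp (Plus a b) = wexp a + wexp b + 1"
| "wexp (Minus a b) = wexp a"
| "wexp (Times a b) = wexp a + wexp b"
| "wexp (Quot a b) = wexp a"

fun cexp :: "rexp \<Rightarrow> nat" where
  "cexp (Cn k) = 1 + wexp (Cn k)"
| "cexp (Ld e) = 1 + wexp (Ld e) + cexp e"
| "cexp (Plus a b) = 1 + wexp (Plus a b) + cexp a + cexp b"
| "cexp (Minus a b) = 1 + wexp (Minus a b) + cexp a + cexp b"
| "cexp (Times a b) = 1 + wexp (Times a b) + cexp a + cexp b"
| "cexp (Quot a b) = 1 + wexp (Quot a b) + cexp a + cexp b"

section \<open>Length and cost of expressions\<close>

lemma bits_le_iff: "bits x \<le> n \<longleftrightarrow> x < 2 ^ n"
  using floorlog_leD[of 2 x n] floorlog_leI[of x 2 n] by auto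

lemma less_power_bits: "x < 2 ^ bits x"
  using bits_le_iff by blast

lemma bits_mono: "x \<le> y \<Longrightarrow> bits x \<le> bits y"
  by (rule floorlog_mono)

lemma bits_rval_le:
  assumes "mem_bits \<beta> m"
  shows "bits (rval e m) \<le> wexp e * (\<beta> + 1)"
proof (induction e)
  case (Ld e)
  have "bits (m (rval e m)) \<le> \<beta>" using assms by (simp add: bits_le_iff mem_bits_def)
  then show ?case by simp
next
  case (Plus a b)
  have "rval a m + rval b m < 2 ^ (wexp a * (\<beta> + 1) + wexp b * (\<beta> + 1) + 1)"
  proof -
    have "rval a m < 2 ^ (wexp a * (\<beta> + 1))" "rval b m < 2 ^ (wexp b * (\<beta> + 1))"
      using Plus by (simp_all add: bits_le_iff)
    moreover have "(2 :: nat) ^ x \<le> 2 ^ (x + y)" "(2 :: nat) ^ y \<le> 2 ^ (x + y)" for x y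
      by (intro power_increasing; simp)+
    ultimately show ?thesis by (simp add: add_strict_mono less_le_trans mult_2)
  qed
  also have "(2 :: nat) ^ (wexp a * (\<beta> + 1) + wexp b * (\<beta> + 1) + 1) \<le> 2 ^ (wexp (Plus a b) * (\<beta> + 1))"
    by (intro power_increasing) (simp_all add: add_mult_distrib)
  finally show ?case by (simp only: bits_le_iff rval.simps)
next
  case (Times a b)
  have "rval a m * rval b m < 2 ^ (wexp a * (\<beta> + 1)) * 2 ^ (wexp b * (\<beta> + 1))"
    using Times by (intro mult_strict_mono) (auto simp: bits_le_iff)
  also have "\<dots> = 2 ^ (wexp (Times a b) * (\<beta> + 1))"
    by (simp only: wexp.simps add_mult_distrib power_add)
  finally show ?case by (simp only: bits_le_iff rval.simps)
next
  case (Minus a b)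
  have "bits (rval a m - rval b m) \<le> bits (rval a m)" by (intro bits_mono) simp
  with Minus show ?case by simp
next
  case (Quot a b)
  have "bits (rval a m div rval b m) \<le> bits (rval a m)" by (intro bits_mono div_le_dividend)
  with Quot show ?case by simp
qed simp

lemma budget2:
  fixes w :: nat
  assumes "x \<le> p * w" "y \<le> q * w" "1 \<le> w"
  shows "1 + x + y \<le> (1 + p + q) * w"
  using assms by (simp add: add_mult_distrib)

lemma budget3:
  fixes w :: nat
  assumes "x \<le> p * w" "y \<le> q * w" "z \<le> r * w" "1 \<le> w"
  shows "1 + x + y + z \<le> (1 + p + q + r) * w"
  using assms by (simp add: add_mult_distrib)

lemma rcost_le:
  assumes "mem_bits \<beta> m"
  shows "rcost e m \<le> cexp e * (\<beta> + 1)"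
proof (induction e)
  case (Cn k)
  show ?case by simp
next
  case (Ld e)
  then show ?case unfolding rcost.simps cexp.simps
    by (intro budget2 bits_rval_le assms) simp_all
qed (unfold rcost.simps cexp.simps, (intro budget3 bits_rval_le assms; simp)+)

text \<open>The cost, in units of the word length, when no loop is entered more than \<open>X\<close> times in a row.\<close>

fun ccom :: "nat \<Rightarrow> rcom \<Rightarrow> nat" where
  "ccom X Nop = 1"
| "ccom X (St a e) = 1 + cexp a + cexp e"
| "ccom X (Then c c') = ccom X c + ccom X c'"
| "ccom X (Cond e c c') = 1 + cexp e + ccom X c + ccom X c'"
| "ccom X (Loop e c) = X * (1 + cexp e + ccom X c) + 1 + cexp e"

text \<open>For a fixed program the cost bound is a polynomial in the loop bound; nesting of loops
  only raises its degree.\<close>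

lemma ccom_poly: "\<exists>p :: nat poly. \<forall>X. ccom X c = poly p X"
proof (induction c)
  case Nop
  show ?case by (intro exI[of _ 1]) simp
next
  case (St a e)
  show ?case by (intro exI[of _ "[:1 + cexp a + cexp e:]"]) simp
next
  case (Then c c')
  then obtain p p' where "\<forall>X. ccom X c = poly p X" "\<forall>X. ccom X c' = poly p' X" by blast
  then show ?case by (intro exI[of _ "p + p'"]) simp
next
  case (Cond e c c')
  then obtain p p' where "\<forall>X. ccom X c = poly p X" "\<forall>X. ccom X c' = poly p' X" by blast
  then show ?case by (intro exI[of _ "[:1 + cexp e:] + p + p'"]) simp
next
  case (Loop e c)
  then obtain p where "\<forall>X. ccom X c = poly p X" by blast
  then show ?case by (intro exI[of _ "[:0, 1:] * ([:1 + cexp e:] + p) + [:1 + cexp e:]"]) simp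
qed

text \<open>Total correctness with a cost that is read off the syntax. The word bound is assumed
  inside the definition and returned for the final memory, so a verification has three tasks left:
  written values fit into words, loops stay within \<open>X\<close> rounds, and the contents are
  right.\<close>

definition runs :: "nat \<Rightarrow> nat \<Rightarrow> rcom \<Rightarrow> mem \<Rightarrow> (mem \<Rightarrow> bool) \<Rightarrow> bool" where
  "runs \<beta> X c m Q \<longleftrightarrow> (mem_bits \<beta> m \<longrightarrow>
     (\<exists>m' t. exec c m t m' \<and> t \<le> ccom X c * (\<beta> + 1) \<and> mem_bits \<beta> m' \<and> Q m'))"

section \<open>Proof rules for programs with cost\<close>

lemma runs_Nop: "Q m \<Longrightarrow> runs \<beta> X Nop m Q"
  unfolding runs_def by (auto intro!: exI exec.Nop)

lemma runs_St:
  assumes "mem_bits \<beta> m \<Longrightarrow> rval e m < 2 ^ \<beta>"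
    and "mem_bits \<beta> m \<Longrightarrow> Q (m(rval a m := rval e m))"
  shows "runs \<beta> X (St a e) m Q"
  unfolding runs_def
proof
  assume b: "mem_bits \<beta> m"
  have "1 + rcost a m + rcost e m \<le> ccom X (St a e) * (\<beta> + 1)"
    unfolding ccom.simps by (intro budget2 rcost_le b) simp
  moreover have "mem_bits \<beta> (m(rval a m := rval e m))" using assms(1)[OF b] b by (simp add: mem_bits_def)
  ultimately show "\<exists>m' t. exec (St a e) m t m' \<and> t \<le> ccom X (St a e) * (\<beta> + 1) \<and> mem_bits \<beta> m' \<and> Q m'"
    using exec.St assms(2)[OF b] by blast
qed

lemma runs_Then:
  assumes "runs \<beta> X c m (\<lambda>m'. runs \<beta> X c' m' Q)"
  shows "runs \<beta> X (Then c c') m Q"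
  unfolding runs_def
proof
  assume "mem_bits \<beta> m"
  then obtain m' t where 1: "exec c m t m'" "t \<le> ccom X c * (\<beta> + 1)" "mem_bits \<beta> m'" "runs \<beta> X c' m' Q"
    using assms unfolding runs_def by blast
  then obtain m'' t' where 2: "exec c' m' t' m''" "t' \<le> ccom X c' * (\<beta> + 1)" "mem_bits \<beta> m''" "Q m''"
    unfolding runs_def by blast
  have "t + t' \<le> ccom X (Then c c') * (\<beta> + 1)" using 1(2) 2(2) by (simp add: add_mult_distrib)
  with exec.Then[OF 1(1) 2(1)] 2
  show "\<exists>m' t. exec (Then c c') m t m' \<and> t \<le> ccom X (Then c c') * (\<beta> + 1) \<and> mem_bits \<beta> m' \<and> Q m'"
    by blast
qed

lemma runs_Cond:
  assumes "rval e m \<noteq> 0 \<Longrightarrow> runs \<beta> X c m Q" "rval e m = 0 \<Longrightarrow> runs \<beta> X c' m Q"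
  shows "runs \<beta> X (Cond e c c') m Q"
  unfolding runs_def
proof
  assume b: "mem_bits \<beta> m"
  show "\<exists>m' t. exec (Cond e c c') m t m' \<and> t \<le> ccom X (Cond e c c') * (\<beta> + 1) \<and> mem_bits \<beta> m' \<and> Q m'"
  proof (cases "rval e m = 0")
    case True
    then obtain m' t where 1: "exec c' m t m'" "t \<le> ccom X c' * (\<beta> + 1)" "mem_bits \<beta> m'" "Q m'"
      using assms(2) b unfolding runs_def by blast
    have "1 + rcost e m + t \<le> ccom X (Cond e c c') * (\<beta> + 1)"
      using budget2[OF rcost_le[OF b, of e] 1(2)] by (simp add: add_mult_distrib)
    with exec.Cond_False[OF True 1(1)] 1 show ?thesis by blast
  next
    case False
    then obtain m' t where 1: "exec c m t m'" "t \<le> ccom X c * (\<beta> + 1)" "mem_bits \<beta> m'" "Q m'"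
      using assms(1) b unfolding runs_def by blast
    have "1 + rcost e m + t \<le> ccom X (Cond e c c') * (\<beta> + 1)"
      using budget2[OF rcost_le[OF b, of e] 1(2)] by (simp add: add_mult_distrib)
    with exec.Cond_True[OF False 1(1)] 1 show ?thesis by blast
  qed
qed

text \<open>The invariant is indexed by the round and \<open>N\<close> is the exact number of
  rounds, which settles termination along with the cost.\<close>

lemma runs_Loop:
  assumes init: "Inv 0 m" and N: "N \<le> X"
    and step: "\<And>j m. j < N \<Longrightarrow> Inv j m \<Longrightarrow> rval e m \<noteq> 0 \<and> runs \<beta> X c m (Inv (Suc j))"
    and fin: "\<And>m. Inv N m \<Longrightarrow> rval e m = 0 \<and> Q m"
  shows "runs \<beta> X (Loop e c) m Q"
  unfolding runs_def
proof
  assume b: "mem_bits \<beta> m"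
  have "\<exists>m' t. exec (Loop e c) m t m' \<and> t \<le> ((N - j) * (1 + cexp e + ccom X c) + 1 + cexp e) * (\<beta> + 1)
      \<and> mem_bits \<beta> m' \<and> Q m'" if "Inv j m" "j \<le> N" "mem_bits \<beta> m" for j m
    using that(2,1,3)
  proof (induction arbitrary: m rule: inc_induct)
    case base
    then have "rval e m = 0" "Q m" using fin by auto
    moreover have "1 + rcost e m \<le> ((N - N) * (1 + cexp e + ccom X c) + 1 + cexp e) * (\<beta> + 1)"
      using budget2[OF rcost_le[OF base(2), of e] le0, of 0] by simp
    ultimately show ?case using exec.Loop_False base by blast
  next
    case (step j)
    then obtain m' t where 1: "rval e m \<noteq> 0" "exec c m t m'" "t \<le> ccom X c * (\<beta> + 1)"
        "mem_bits \<beta> m'" "Inv (Suc j) m'"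
      using assms(3) unfolding runs_def by blast
    then obtain m'' t' where 2: "exec (Loop e c) m' t' m''"
        "t' \<le> ((N - Suc j) * (1 + cexp e + ccom X c) + 1 + cexp e) * (\<beta> + 1)" "mem_bits \<beta> m''" "Q m''"
      using step.IH by blast
    define d where "d = N - Suc j"
    have d: "N - j = Suc d" using step by (simp add: d_def)
    have "1 + rcost e m + t \<le> (1 + cexp e + ccom X c) * (\<beta> + 1)"
      by (rule budget2[OF rcost_le[OF step.prems(2)] 1(3)]) simp
    from add_mono[OF this 2(2)]
    have "1 + rcost e m + t + t' \<le> ((N - j) * (1 + cexp e + ccom X c) + 1 + cexp e) * (\<beta> + 1)"
      unfolding d d_def[symmetric] by (simp add: algebra_simps)
    with exec.Loop_True[OF 1(1,2) 2(1)] 2 show ?case by blast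
  qed
  from this[OF init _ b] obtain m' t where r: "exec (Loop e c) m t m'"
      "t \<le> (N * (1 + cexp e + ccom X c) + 1 + cexp e) * (\<beta> + 1)" "mem_bits \<beta> m'" "Q m'" by auto
  have "(N * (1 + cexp e + ccom X c) + 1 + cexp e) * (\<beta> + 1) \<le> ccom X (Loop e c) * (\<beta> + 1)"
    using N by (simp only: ccom.simps) (intro mult_le_mono1 add_le_mono order_refl)
  with r show "\<exists>m' t. exec (Loop e c) m t m' \<and> t \<le> ccom X (Loop e c) * (\<beta> + 1) \<and> mem_bits \<beta> m' \<and> Q m'"
    by (meson order_trans)
qed

lemma runs_mono:
  assumes "runs \<beta> X c m Q" "\<And>m'. mem_bits \<beta> m' \<Longrightarrow> Q m' \<Longrightarrow> Q' m'"
  shows "runs \<beta> X c m Q'"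
  using assms unfolding runs_def by blast

text \<open>
  Cell \<open>0\<close> holds the length \<open>L\<close> of the input, which occupies the cells \<open>1, \<dots>, L\<close>. The program
  variable number \<open>j\<close> is stored in cell \<open>L + j\<close>, where \<open>0 < j < 40\<close>, and component \<open>j\<close> of entry \<open>e\<close> of
  the table of atoms in cell \<open>L + 40 + 3 e + j\<close>.
\<close>

abbreviation bs :: rexp where "bs \<equiv> Ld (Cn 0)"
abbreviation vl :: "nat \<Rightarrow> rexp" where "vl j \<equiv> Plus bs (Cn j)"
abbreviation vr :: "nat \<Rightarrow> rexp" where "vr j \<equiv> Ld (vl j)"
abbreviation al :: "nat \<Rightarrow> rexp \<Rightarrow> rexp" where "al j e \<equiv> Plus bs (Plus (Cn (40 + j)) (Times (Cn 3) e))"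
abbreviation ar :: "nat \<Rightarrow> rexp \<Rightarrow> rexp" where "ar j e \<equiv> Ld (al j e)"
text \<open>Truncated subtraction turns comparisons into \<open>0\<close> or \<open>1\<close>, so
  conditional sums are evaluated without branching.\<close>

abbreviation le :: "rexp \<Rightarrow> rexp \<Rightarrow> rexp" where "le a b \<equiv> Minus (Cn 1) (Minus a b)"
abbreviation eq :: "rexp \<Rightarrow> rexp \<Rightarrow> rexp" where "eq a b \<equiv> Minus (Cn 1) (Plus (Minus a b) (Minus b a))"

abbreviation For :: "nat \<Rightarrow> rexp \<Rightarrow> rcom \<Rightarrow> rcom" where
  "For v n c \<equiv> Then (St (vl v) (Cn 0)) (Loop (Minus n (vr v)) (Then c (St (vl v) (Plus (vr v) (Cn 1)))))"

lemma runs_For: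
  assumes L: "m 0 = L" "0 < v" and X: "N \<le> X" "N < 2 ^ \<beta>"
    and init: "I 0 (m(L + v := 0))"
    and I: "\<And>j m. I j m \<Longrightarrow> m 0 = L \<and> rval n m = N"
    and body: "\<And>j m. j < N \<Longrightarrow> I j m \<Longrightarrow> m (L + v) = j \<Longrightarrow>
      runs \<beta> X c m (\<lambda>m'. m' 0 = L \<and> m' (L + v) = j \<and> I (Suc j) (m'(L + v := Suc j)))"
    and fin: "\<And>m. I N m \<Longrightarrow> Q m"
  shows "runs \<beta> X (For v n c) m Q"
proof (rule runs_Then, rule runs_St)
  show "runs \<beta> X (Loop (Minus n (vr v)) (Then c (St (vl v) (Plus (vr v) (Cn 1)))))
      (m(rval (vl v) m := rval (Cn 0) m)) Q"
  proof (rule runs_Loop[where Inv = "\<lambda>j m. I j m \<and> m (L + v) = j" and N = N])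
    fix j m assume j: "j < N" and Ij: "I j m \<and> m (L + v) = j"
    have "runs \<beta> X (Then c (St (vl v) (Plus (vr v) (Cn 1)))) m (\<lambda>m. I (Suc j) m \<and> m (L + v) = Suc j)"
      by (rule runs_Then, rule runs_mono[OF body[OF j]], use Ij in simp, use Ij in simp, rule runs_St)
         (use j X in auto)
    then show "rval (Minus n (vr v)) m \<noteq> 0 \<and>
        runs \<beta> X (Then c (St (vl v) (Plus (vr v) (Cn 1)))) m (\<lambda>m. I (Suc j) m \<and> m (L + v) = Suc j)"
      using I[of j m] Ij j by simp
  next
    fix m assume "I N m \<and> m (L + v) = N"
    then show "rval (Minus n (vr v)) m = 0 \<and> Q m" using I[of N m] fin by simp
  qed (use init L X in auto)
qed simp

section \<open>Integer data of an instance\<close>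

text \<open>
  A flat table lists for every atom the index of its variable, its value and its probability,
  the latter two multiplied by the common denominator \<open>W\<close>.
\<close>

type_synonym table = "(nat \<times> nat \<times> nat) list"

abbreviation own :: "table \<Rightarrow> nat \<Rightarrow> nat" where "own G e \<equiv> fst (G ! e)"
abbreviation val :: "table \<Rightarrow> nat \<Rightarrow> nat" where "val G e \<equiv> fst (snd (G ! e))"
abbreviation wgt :: "table \<Rightarrow> nat \<Rightarrow> nat" where "wgt G e \<equiv> snd (snd (G ! e))"

definition tailN :: "table \<Rightarrow> nat \<Rightarrow> nat \<Rightarrow> nat" where
  "tailN G i t = (\<Sum>e<length G. of_bool (own G e = i) * of_bool (t \<le> val G e) * wgt G e)"

definition cntN :: "table \<Rightarrow> nat \<Rightarrow> nat \<Rightarrow> nat \<Rightarrow> nat \<Rightarrow> nat" where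
  "cntN G W K n t = (\<Sum>i<n. of_bool (W \<le> K * tailN G i t))"

text \<open>
  The truncated subtraction computes positive parts, which makes \<open>topN\<close> a maximum and \<open>dpN\<close> a dynamic
  program: \<open>dpN \<dots> r\<close> is the threshold \<open>T + Z\<^bsub>M-r\<^esub>\<close> multiplied by \<open>W (M W)\<^sup>r\<close>.
\<close>

primrec topN :: "table \<Rightarrow> nat \<Rightarrow> nat \<Rightarrow> nat \<Rightarrow> nat \<Rightarrow> nat \<Rightarrow> nat" where
  "topN G W K n N 0 = 0"
| "topN G W K n N (Suc e) = topN G W K n N e +
     of_bool (N \<le> cntN G W K n (val G e)) * (val G e - topN G W K n N e)"

definition keepN :: "table \<Rightarrow> nat \<Rightarrow> nat \<Rightarrow> nat \<Rightarrow> nat \<Rightarrow> bool" where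
  "keepN G W K T i \<longleftrightarrow> K * tailN G i (T + 1) \<le> W"

primrec dpN :: "table \<Rightarrow> nat \<Rightarrow> nat \<Rightarrow> nat \<Rightarrow> nat \<Rightarrow> nat \<Rightarrow> nat" where
  "dpN G W K T M 0 = T"
| "dpN G W K T M (Suc r) = M * W * dpN G W K T M r +
     (\<Sum>e<length G. of_bool (keepN G W K T (own G e)) * wgt G e * (val G e * (M * W) ^ r - dpN G W K T M r))"

section \<open>The programs\<close>

text \<open>
  Program variables: 2 index of a variable, 3 entry of a list, 4 number of atoms, 5 \<open>W\<close>, 6 \<open>K\<close>, 7 \<open>k\<close>,
  8 \<open>n\<close>, 9 length of a list, 10 input cell, 11 \<open>T\<close>, 12 and 14 atoms, 13 index in \<open>CNT\<close>, 15 value of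
  \<open>tailN\<close>, 16 value of \<open>cntN\<close>, 17 \<open>N\<close>, 18 \<open>M\<close>, 19 value of \<open>dpN\<close>, 20 power of \<open>M W\<close>, 21 step of the
  dynamic program, 22 its sum, 23 length of the output, 24 length of the history, 25 candidate for
  \<open>T\<close>, 26 number of steps, 27 current value, 28 identity of the current arrival.
\<close>

definition TAIL :: "rexp \<Rightarrow> rexp \<Rightarrow> rcom" where
  "TAIL ie te = Then (St (vl 15) (Cn 0)) (For 14 (vr 4) (St (vl 15) (Plus (vr 15)
     (Times (Times (eq (ar 0 (vr 14)) ie) (le te (ar 1 (vr 14)))) (ar 2 (vr 14))))))"

definition CNT :: rcom where
  "CNT = Then (St (vl 16) (Cn 0)) (For 13 (vr 8) (Then (TAIL (vr 13) (vr 25))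
     (St (vl 16) (Plus (vr 16) (le (vr 5) (Times (vr 6) (vr 15)))))))"

definition TOP :: rcom where
  "TOP = Then (St (vl 11) (Cn 0)) (For 12 (vr 4) (Then (St (vl 25) (ar 1 (vr 12))) (Then CNT
     (St (vl 11) (Plus (vr 11) (Times (le (vr 17) (vr 16)) (Minus (vr 25) (vr 11))))))))"

definition DPSTEP :: rcom where
  "DPSTEP = Then (St (vl 22) (Cn 0)) (For 12 (vr 4) (Then (TAIL (ar 0 (vr 12)) (Plus (vr 11) (Cn 1)))
     (St (vl 22) (Plus (vr 22) (Times (Times (le (Times (vr 6) (vr 15)) (vr 5)) (ar 2 (vr 12)))
        (Minus (Times (ar 1 (vr 12)) (vr 20)) (vr 19)))))))"

definition DP :: rcom where
  "DP = Then (St (vl 19) (vr 11)) (Then (St (vl 20) (Cn 1)) (For 21 (vr 26) (Then DPSTEP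
     (Then (St (vl 19) (Plus (Times (Times (vr 18) (vr 5)) (vr 19)) (vr 22)))
        (St (vl 20) (Times (Times (vr 18) (vr 5)) (vr 20)))))))"

definition env :: "nat \<Rightarrow> table \<Rightarrow> mem \<Rightarrow> bool" where
  "env L G m \<longleftrightarrow> m 0 = L \<and> m (L + 4) = length G \<and>
     (\<forall>e<length G. m (L + (40 + 3 * e)) = own G e \<and> m (L + (41 + 3 * e)) = val G e \<and>
        m (L + (42 + 3 * e)) = wgt G e)"

lemma envD:
  assumes "env L G m"
  shows "m 0 = L" "m (L + 4) = length G"
    "e < length G \<Longrightarrow> m (L + (40 + 3 * e)) = own G e"
    "e < length G \<Longrightarrow> m (L + (41 + 3 * e)) = val G e"
    "e < length G \<Longrightarrow> m (L + (42 + 3 * e)) = wgt G e"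
  using assms by (auto simp: env_def)

lemma env_frame:
  assumes "env L G m" "\<And>a. a \<notin> V \<Longrightarrow> m' a = m a" "\<forall>a\<in>V. a \<noteq> 0 \<and> a \<noteq> L + 4 \<and> a < L + 40"
  shows "env L G m'"
proof -
  have "m' 0 = m 0" "m' (L + 4) = m (L + 4)" "\<And>e. m' (L + (40 + e)) = m (L + (40 + e))"
    using assms(3) by (auto intro!: assms(2))
  moreover from this(3)[of "1 + e" for e] this(3)[of "2 + e" for e]
  have "\<And>e. m' (L + (41 + e)) = m (L + (41 + e))" "\<And>e. m' (L + (42 + e)) = m (L + (42 + e))"
    by simp_all
  ultimately show ?thesis using assms(1) by (simp add: env_def)
qed

lemma le_of_bool: "1 - (a - b) = (of_bool (a \<le> b) :: nat)" for a b :: nat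
  by auto

lemma eq_of_bool: "1 - ((a - b) + (b - a)) = (of_bool (a = b) :: nat)" for a b :: nat
  by auto

lemma sum_lessThan_le:
  fixes f :: "nat \<Rightarrow> nat"
  shows "j \<le> n \<Longrightarrow> (\<Sum>e<j. f e) \<le> (\<Sum>e<n. f e)"
  by (intro sum_mono2) auto

text \<open>The arguments are expressions that are evaluated anew in every round; hence the
  assumption that their values do not depend on the two cells that the loop changes.\<close>

lemma runs_TAIL:
  assumes env: "env L G m" and L: "0 < L" and F: "length G \<le> X" "length G < 2 ^ \<beta>"
    and tot: "(\<Sum>e<length G. wgt G e) < 2 ^ \<beta>"
    and ie: "\<And>m'. (\<And>a. a \<notin> {L + 14, L + 15} \<Longrightarrow> m' a = m a) \<Longrightarrow> rval ie m' = i"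
    and te: "\<And>m'. (\<And>a. a \<notin> {L + 14, L + 15} \<Longrightarrow> m' a = m a) \<Longrightarrow> rval te m' = t"
  shows "runs \<beta> X (TAIL ie te) m (\<lambda>m'. m' (L + 15) = tailN G i t \<and>
    (\<forall>a. a \<notin> {L + 14, L + 15} \<longrightarrow> m' a = m a))"
proof -
  note e = envD[OF env]
  define f where "f = (\<lambda>e. of_bool (own G e = i) * of_bool (t \<le> val G e) * wgt G e)"
  define S where "S = (\<lambda>j. \<Sum>e<j. f e)"
  define fr where "fr = (\<lambda>m'. \<forall>a. a \<notin> {L + 14, L + 15} \<longrightarrow> m' a = m a)"
  have Sb: "S j < 2 ^ \<beta>" if "j \<le> length G" for j
  proof -
    have "S j \<le> (\<Sum>e<length G. f e)" unfolding S_def by (rule sum_lessThan_le[OF that])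
    also have "\<dots> \<le> (\<Sum>e<length G. wgt G e)" by (intro sum_mono) (auto simp: f_def)
    finally show ?thesis using tot by simp
  qed
  show ?thesis
    unfolding TAIL_def
  proof (rule runs_Then, rule runs_St, simp, rule runs_For[where L = L and N = "length G" and
        I = "\<lambda>j m'. fr m' \<and> m' (L + 15) = S j"])
    fix j m' assume j: "j < length G" and I: "fr m' \<and> m' (L + 15) = S j" and v: "m' (L + 14) = j"
    have m': "m' a = m a" if "a \<notin> {L + 14, L + 15}" for a using I that by (auto simp: fr_def)
    have em': "env L G m'"
      by (rule env_frame[where V = "{L + 14, L + 15}", OF env]) (use m' L in auto)
    note e' = envD[OF em']
    have r: "rval (Plus (vr 15) (Times (Times (eq (ar 0 (vr 14)) ie) (le te (ar 1 (vr 14)))) (ar 2 (vr 14)))) m'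
      = S (Suc j)"
      using ie[OF m'] te[OF m'] I v j e' by (simp add: S_def f_def le_of_bool[simplified] eq_of_bool[simplified])
    show "runs \<beta> X (St (vl 15) (Plus (vr 15) (Times (Times (eq (ar 0 (vr 14)) ie) (le te (ar 1 (vr 14)))) (ar 2 (vr 14))))) m'
      (\<lambda>m''. m'' 0 = L \<and> m'' (L + 14) = j \<and> (fr (m''(L + 14 := Suc j)) \<and> (m''(L + 14 := Suc j)) (L + 15) = S (Suc j)))"
    proof (rule runs_St)
      show "rval (Plus (vr 15) (Times (Times (eq (ar 0 (vr 14)) ie) (le te (ar 1 (vr 14)))) (ar 2 (vr 14)))) m' < 2 ^ \<beta>"
        unfolding r using Sb[of "Suc j"] j by simp
    qed (unfold r, use v e' L m' in \<open>auto simp: fr_def\<close>)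
  qed (use F e L in \<open>auto simp: fr_def S_def f_def tailN_def\<close>)
qed

definition scal :: "nat \<Rightarrow> table \<Rightarrow> nat \<Rightarrow> nat \<Rightarrow> nat \<Rightarrow> nat \<Rightarrow> nat \<Rightarrow> mem \<Rightarrow> bool" where
  "scal L G n W K N M m \<longleftrightarrow> env L G m \<and> m (L + 8) = n \<and> m (L + 5) = W \<and> m (L + 6) = K \<and>
     m (L + 17) = N \<and> m (L + 18) = M"

lemma scalD:
  assumes "scal L G n W K N M m"
  shows "env L G m" "m (L + 8) = n" "m (L + 5) = W" "m (L + 6) = K" "m (L + 17) = N" "m (L + 18) = M"
  using assms by (auto simp: scal_def)

lemma scal_frame:
  assumes "scal L G n W K N M m" "\<And>a. a \<notin> V \<Longrightarrow> m' a = m a"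
    and V: "\<forall>a\<in>V. a \<noteq> 0 \<and> a < L + 40 \<and> a \<notin> {L + 4, L + 5, L + 6, L + 8, L + 17, L + 18}"
  shows "scal L G n W K N M m'"
proof -
  have "env L G m'"
    by (rule env_frame[OF scalD(1)[OF assms(1)] assms(2)]) (use V in auto)
  moreover have "m' (L + 8) = m (L + 8)" "m' (L + 5) = m (L + 5)" "m' (L + 6) = m (L + 6)"
      "m' (L + 17) = m (L + 17)" "m' (L + 18) = m (L + 18)"
    using V by (auto intro!: assms(2))
  ultimately show ?thesis using assms(1) by (simp add: scal_def)
qed

section \<open>Threshold and dynamic program computed from the table\<close>

locale table_bounds =
  fixes \<beta> X L :: nat and G :: table and n W K N M :: nat
  assumes L: "0 < L" and F: "length G \<le> X" "length G < 2 ^ \<beta>" and n: "n \<le> X" "n < 2 ^ \<beta>"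
    and tot: "(\<Sum>e<length G. wgt G e) < 2 ^ \<beta>"
begin

abbreviation "T \<equiv> topN G W K n N (length G)"

lemma runs_CNT:
  assumes m: "scal L G n W K N M m" "m (L + 25) = t"
  shows "runs \<beta> X CNT m (\<lambda>m'. m' (L + 16) = cntN G W K n t \<and>
    (\<forall>a. a \<notin> {L + 13, L + 14, L + 15, L + 16} \<longrightarrow> m' a = m a))"
proof -
  define S where "S = (\<lambda>j. \<Sum>i<j. of_bool (W \<le> K * tailN G i t) :: nat)"
  define fr where "fr = (\<lambda>m'. \<forall>a. a \<notin> {L + 13, L + 14, L + 15, L + 16} \<longrightarrow> m' a = m a)"
  have S_Suc: "S (Suc j) = S j + of_bool (W \<le> K * tailN G j t)" for j
    unfolding S_def by (rule sum.lessThan_Suc)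
  have Sb: "S j < 2 ^ \<beta>" if "j \<le> n" for j
  proof -
    have "S j \<le> (\<Sum>i<j. 1)" unfolding S_def by (intro sum_mono) auto
    then show ?thesis using that n by simp
  qed
  have scal: "scal L G n W K N M m' \<and> m' (L + 25) = t" if "fr m'" for m'
  proof
    show "scal L G n W K N M m'"
      by (rule scal_frame[where V = "{L + 13, L + 14, L + 15, L + 16}", OF m(1)])
         (use that L in \<open>auto simp: fr_def\<close>)
    show "m' (L + 25) = t" using that m(2) by (auto simp: fr_def)
  qed
  show ?thesis
    unfolding CNT_def
  proof (rule runs_Then, rule runs_St, simp, rule runs_For[where L = L and N = n and
        I = "\<lambda>j m'. fr m' \<and> m' (L + 16) = S j"])
    fix j m' assume j: "j < n" and I: "fr m' \<and> m' (L + 16) = S j" and v: "m' (L + 13) = j"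
    note sm' = scal[THEN conjunct1, OF conjunct1[OF I]]
    note em' = scalD(1)[OF sm']
    have t: "m' (L + 25) = t" "m' 0 = L" using scal I envD(1)[OF em'] by auto
    show "runs \<beta> X (Then (TAIL (vr 13) (vr 25)) (St (vl 16) (Plus (vr 16) (le (vr 5) (Times (vr 6) (vr 15)))))) m'
      (\<lambda>m''. m'' 0 = L \<and> m'' (L + 13) = j \<and> (fr (m''(L + 13 := Suc j)) \<and> (m''(L + 13 := Suc j)) (L + 16) = S (Suc j)))"
    proof (rule runs_Then, rule runs_mono[OF runs_TAIL[OF em' L F tot, where i = j and t = t]])
      fix m'' assume "mem_bits \<beta> m''"
        and q: "m'' (L + 15) = tailN G j t \<and> (\<forall>a. a \<notin> {L + 14, L + 15} \<longrightarrow> m'' a = m' a)"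
      then have fr: "m'' a = m' a" if "a \<notin> {L + 14, L + 15}" for a using that by blast
      have "scal L G n W K N M m''"
        by (rule scal_frame[where V = "{L + 14, L + 15}", OF sm']) (use fr L in auto)
      note s = scalD[OF this] envD(1)[OF scalD(1)[OF this]]
      have r: "rval (Plus (vr 16) (le (vr 5) (Times (vr 6) (vr 15)))) m'' = S (Suc j)"
        using s q I fr[of "L + 16"] by (simp add: S_Suc le_of_bool[simplified])
      show "runs \<beta> X (St (vl 16) (Plus (vr 16) (le (vr 5) (Times (vr 6) (vr 15))))) m''
        (\<lambda>m''. m'' 0 = L \<and> m'' (L + 13) = j \<and> (fr (m''(L + 13 := Suc j)) \<and> (m''(L + 13 := Suc j)) (L + 16) = S (Suc j)))"
      proof (rule runs_St)
        show "rval (Plus (vr 16) (le (vr 5) (Times (vr 6) (vr 15)))) m'' < 2 ^ \<beta>"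
          unfolding r using Sb[of "Suc j"] j by simp
      qed (unfold r, use v s fr I L in \<open>auto simp: fr_def\<close>)
    qed (use t v in auto)
  next
    fix j m' assume "fr m' \<and> m' (L + 16) = S j"
    then have sm: "scal L G n W K N M m'" using scal by blast
    show "m' 0 = L \<and> rval (vr 8) m' = n"
      using envD(1)[OF scalD(1)[OF sm]] scalD(2)[OF sm] by simp
  next
    fix m' assume "fr m' \<and> m' (L + 16) = S n"
    then show "m' (L + 16) = cntN G W K n t \<and> (\<forall>a. a \<notin> {L + 13, L + 14, L + 15, L + 16} \<longrightarrow> m' a = m a)"
      unfolding fr_def S_def cntN_def by blast
  qed (use n envD(1)[OF scalD(1)[OF m(1)]] L in \<open>simp_all add: fr_def S_def\<close>)
qed

lemma topN_le:
  assumes "\<And>e. e < length G \<Longrightarrow> val G e < b" "0 < b"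
  shows "j \<le> length G \<Longrightarrow> topN G W K n N j < b"
proof (induction j)
  case (Suc j)
  then show ?case using assms(1)[of j] by (cases "N \<le> cntN G W K n (val G j)") auto
qed (use assms in simp)

lemma runs_TOP:
  assumes m: "scal L G n W K N M m" and val: "\<And>e. e < length G \<Longrightarrow> val G e < 2 ^ \<beta>"
  shows "runs \<beta> X TOP m (\<lambda>m'. m' (L + 11) = T \<and>
    (\<forall>a. a \<notin> {L + 11, L + 12, L + 13, L + 14, L + 15, L + 16, L + 25} \<longrightarrow> m' a = m a))"
proof -
  define V where "V = {L + 11, L + 12, L + 13, L + 14, L + 15, L + 16, L + 25}"
  define fr where "fr = (\<lambda>m'. \<forall>a. a \<notin> V \<longrightarrow> m' a = m a)"
  have scal: "scal L G n W K N M m'" if "fr m'" for m'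
    by (rule scal_frame[where V = V, OF m]) (use that L in \<open>auto simp: fr_def V_def\<close>)
  have top_b: "topN G W K n N j < 2 ^ \<beta>" if "j \<le> length G" for j
    by (rule topN_le[OF val _ that]) auto
  show ?thesis
    unfolding TOP_def
  proof (rule runs_Then, rule runs_St, simp, rule runs_For[where L = L and N = "length G" and
        I = "\<lambda>j m'. fr m' \<and> m' (L + 11) = topN G W K n N j"])
    fix j m' assume j: "j < length G" and I: "fr m' \<and> m' (L + 11) = topN G W K n N j" and v: "m' (L + 12) = j"
    note sm' = scal[OF conjunct1[OF I]]
    note em' = envD[OF scalD(1)[OF sm']]
    let ?Q = "\<lambda>m''. m'' 0 = L \<and> m'' (L + 12) = j \<and> (fr (m''(L + 12 := Suc j)) \<and> (m''(L + 12 := Suc j)) (L + 11) = topN G W K n N (Suc j))"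
    let ?e = "Plus (vr 11) (Times (le (vr 17) (vr 16)) (Minus (vr 25) (vr 11)))"
    have r1: "rval (ar 1 (vr 12)) m' = val G j" using em' v j by simp
    define m1 where "m1 = m'(L + 25 := val G j)"
    have sm1: "scal L G n W K N M m1"
      by (rule scal_frame[where V = "{L + 25}", OF sm']) (use L in \<open>auto simp: m1_def\<close>)
    have "runs \<beta> X (Then CNT (St (vl 11) ?e)) m1 ?Q"
    proof (rule runs_Then, rule runs_mono[OF runs_CNT[OF sm1, of "val G j"]])
      fix m'' assume "mem_bits \<beta> m''"
        and q: "m'' (L + 16) = cntN G W K n (val G j) \<and> (\<forall>a. a \<notin> {L + 13, L + 14, L + 15, L + 16} \<longrightarrow> m'' a = m1 a)"
      then have f1: "m'' a = m1 a" if "a \<notin> {L + 13, L + 14, L + 15, L + 16}" for a using that by blast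
      have "scal L G n W K N M m''"
        by (rule scal_frame[where V = "{L + 13, L + 14, L + 15, L + 16}", OF sm1]) (use f1 L in auto)
      note s = scalD[OF this] envD(1)[OF scalD(1)[OF this]]
      have r: "rval ?e m'' = topN G W K n N (Suc j)"
        using s q I f1[of "L + 11"] f1[of "L + 25"] by (simp add: m1_def le_of_bool[simplified])
      show "runs \<beta> X (St (vl 11) ?e) m'' ?Q"
      proof (rule runs_St)
        show "rval ?e m'' < 2 ^ \<beta>"
          unfolding r using top_b[of "Suc j"] j by simp
        have "fr m''" using f1 I by (auto simp: fr_def V_def m1_def)
        then show "?Q (m''(rval (vl 11) m'' := rval ?e m''))"
          unfolding r using v s f1[of "L + 12"] L by (auto simp: fr_def V_def m1_def)
      qed
    qed (simp add: m1_def)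
    moreover have "m'(rval (vl 25) m' := rval (ar 1 (vr 12)) m') = m1"
      unfolding r1 m1_def using em' by simp
    ultimately show "runs \<beta> X (Then (St (vl 25) (ar 1 (vr 12))) (Then CNT (St (vl 11) ?e))) m' ?Q"
      using val[OF j] by (intro runs_Then[of _ _ "St (vl 25) (ar 1 (vr 12))"] runs_St[of _ _ "ar 1 (vr 12)"])
        (simp_all only: r1)
  next
    fix j m' assume "fr m' \<and> m' (L + 11) = topN G W K n N j"
    then have sm: "scal L G n W K N M m'" using scal by blast
    show "m' 0 = L \<and> rval (vr 4) m' = length G"
      using envD(1,2)[OF scalD(1)[OF sm]] by simp
  next
    fix m' assume "fr m' \<and> m' (L + 11) = T"
    then show "m' (L + 11) = T \<and> (\<forall>a. a \<notin> {L + 11, L + 12, L + 13, L + 14, L + 15, L + 16, L + 25} \<longrightarrow> m' a = m a)"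
      unfolding fr_def V_def by blast
  qed (use F envD(1)[OF scalD(1)[OF m]] L in \<open>simp_all add: fr_def V_def\<close>)
qed

lemma runs_DPSTEP:
  assumes m: "scal L G n W K N M m" "m (L + 11) = t" "m (L + 20) = P" "m (L + 19) = U"
    and b: "(\<Sum>e<length G. of_bool (keepN G W K t (own G e)) * wgt G e * (val G e * P - U)) < 2 ^ \<beta>"
  shows "runs \<beta> X DPSTEP m (\<lambda>m'. m' (L + 22) =
      (\<Sum>e<length G. of_bool (keepN G W K t (own G e)) * wgt G e * (val G e * P - U)) \<and>
    (\<forall>a. a \<notin> {L + 12, L + 14, L + 15, L + 22} \<longrightarrow> m' a = m a))"
proof -
  define V where "V = {L + 12, L + 14, L + 15, L + 22}"
  define fr where "fr = (\<lambda>m'. \<forall>a. a \<notin> V \<longrightarrow> m' a = m a)"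
  define f where "f = (\<lambda>e. of_bool (keepN G W K t (own G e)) * wgt G e * (val G e * P - U))"
  define S where "S = (\<lambda>j. \<Sum>e<j. f e)"
  have Sb: "S j < 2 ^ \<beta>" if "j \<le> length G" for j
    using sum_lessThan_le[OF that, of f] b by (simp add: S_def f_def)
  have scal: "scal L G n W K N M m'" if "fr m'" for m'
    by (rule scal_frame[where V = V, OF m(1)]) (use that L in \<open>auto simp: fr_def V_def\<close>)
  show ?thesis
    unfolding DPSTEP_def
  proof (rule runs_Then, rule runs_St, simp, rule runs_For[where L = L and N = "length G" and
        I = "\<lambda>j m'. fr m' \<and> m' (L + 22) = S j"])
    fix j m' assume j: "j < length G" and I: "fr m' \<and> m' (L + 22) = S j" and v: "m' (L + 12) = j"
    note sm' = scal[OF conjunct1[OF I]]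
    note em' = envD[OF scalD(1)[OF sm']]
    have k: "m' (L + 11) = t" "m' (L + 20) = P" "m' (L + 19) = U"
      using I m by (auto simp: fr_def V_def)
    let ?Q = "\<lambda>m''. m'' 0 = L \<and> m'' (L + 12) = j \<and> (fr (m''(L + 12 := Suc j)) \<and> (m''(L + 12 := Suc j)) (L + 22) = S (Suc j))"
    let ?e = "Plus (vr 22) (Times (Times (le (Times (vr 6) (vr 15)) (vr 5)) (ar 2 (vr 12)))
        (Minus (Times (ar 1 (vr 12)) (vr 20)) (vr 19)))"
    show "runs \<beta> X (Then (TAIL (ar 0 (vr 12)) (Plus (vr 11) (Cn 1))) (St (vl 22) ?e)) m' ?Q"
    proof (rule runs_Then, rule runs_mono[OF runs_TAIL[OF scalD(1)[OF sm'] L F tot,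
            where i = "own G j" and t = "t + 1"]])
      fix m'' assume "mem_bits \<beta> m''"
        and q: "m'' (L + 15) = tailN G (own G j) (t + 1) \<and> (\<forall>a. a \<notin> {L + 14, L + 15} \<longrightarrow> m'' a = m' a)"
      then have f1: "m'' a = m' a" if "a \<notin> {L + 14, L + 15}" for a using that by blast
      have sm'': "scal L G n W K N M m''"
        by (rule scal_frame[where V = "{L + 14, L + 15}", OF sm']) (use f1 L in auto)
      note s = scalD[OF sm''] envD[OF scalD(1)[OF sm'']]
      have k'': "m'' (L + 22) = S j" "m'' (L + 20) = P" "m'' (L + 19) = U" "m'' (L + 12) = j"
        using f1 k I v by auto
      have r: "rval ?e m'' = S (Suc j)"
        using s q k'' j by (simp add: le_of_bool[simplified] S_def f_def keepN_def)
      show "runs \<beta> X (St (vl 22) ?e) m'' ?Q"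
      proof (rule runs_St)
        show "rval ?e m'' < 2 ^ \<beta>"
          unfolding r using Sb[of "Suc j"] j by simp
        have "fr m''" using f1 I by (auto simp: fr_def V_def)
        then show "?Q (m''(rval (vl 22) m'' := rval ?e m''))"
          unfolding r using v s f1[of "L + 12"] L by (auto simp: fr_def V_def)
      qed
    next
      fix m'' :: mem assume f1: "\<And>a. a \<notin> {L + 14, L + 15} \<Longrightarrow> m'' a = m' a"
      have "scal L G n W K N M m''"
        by (rule scal_frame[where V = "{L + 14, L + 15}", OF sm']) (use f1 L in auto)
      note s = envD[OF scalD(1)[OF this]]
      show "rval (ar 0 (vr 12)) m'' = own G j" using s f1[of "L + 12"] v j by simp
      show "rval (Plus (vr 11) (Cn 1)) m'' = t + 1" using s f1[of "L + 11"] k by simp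
    qed
  next
    fix j m' assume "fr m' \<and> m' (L + 22) = S j"
    then have sm: "scal L G n W K N M m'" using scal by blast
    show "m' 0 = L \<and> rval (vr 4) m' = length G"
      using envD(1,2)[OF scalD(1)[OF sm]] by simp
  next
    fix m' assume "fr m' \<and> m' (L + 22) = S (length G)"
    then show "m' (L + 22) = (\<Sum>e<length G. of_bool (keepN G W K t (own G e)) * wgt G e * (val G e * P - U)) \<and>
        (\<forall>a. a \<notin> {L + 12, L + 14, L + 15, L + 22} \<longrightarrow> m' a = m a)"
      unfolding fr_def V_def S_def f_def by blast
  qed (use F envD(1)[OF scalD(1)[OF m(1)]] L in \<open>simp_all add: fr_def V_def S_def\<close>)
qed

lemma runs_DP:
  assumes m: "scal L G n W K N M m" "m (L + 11) = t" "m (L + 26) = R"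
    and R: "R \<le> X" "R < 2 ^ \<beta>"
    and b: "\<And>r. r \<le> R \<Longrightarrow> dpN G W K t M r < 2 ^ \<beta>" "\<And>r. r \<le> R \<Longrightarrow> (M * W) ^ r < 2 ^ \<beta>"
  shows "runs \<beta> X DP m (\<lambda>m'. m' (L + 19) = dpN G W K t M R \<and> m' (L + 20) = (M * W) ^ R \<and>
    (\<forall>a. a \<notin> {L + 12, L + 14, L + 15, L + 19, L + 20, L + 21, L + 22} \<longrightarrow> m' a = m a))"
proof -
  define V where "V = {L + 12, L + 14, L + 15, L + 19, L + 20, L + 21, L + 22}"
  define fr where "fr = (\<lambda>m'. \<forall>a. a \<notin> V \<longrightarrow> m' a = m a)"
  have scal: "scal L G n W K N M m'" if "fr m'" for m'
    by (rule scal_frame[where V = V, OF m(1)]) (use that L in \<open>auto simp: fr_def V_def\<close>)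
  have m0: "m 0 = L" using envD(1)[OF scalD(1)[OF m(1)]] .
  define I where "I = (\<lambda>r m'. fr m' \<and> m' (L + 19) = dpN G W K t M r \<and> m' (L + 20) = (M * W) ^ r)"
  have loop: "runs \<beta> X (For 21 (vr 26) (Then DPSTEP
     (Then (St (vl 19) (Plus (Times (Times (vr 18) (vr 5)) (vr 19)) (vr 22)))
        (St (vl 20) (Times (Times (vr 18) (vr 5)) (vr 20)))))) (m(L + 19 := t, L + 20 := 1)) (I R)"
  proof (rule runs_For[where L = L and N = R and I = I])
    fix r m' assume r: "r < R" and I: "I r m'" and v: "m' (L + 21) = r"
    have k: "fr m'" "m' (L + 19) = dpN G W K t M r" "m' (L + 20) = (M * W) ^ r" "m' (L + 11) = t"
      using I m by (auto simp: I_def fr_def V_def)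
    note sm' = scal[OF k(1)]
    let ?acc = "\<Sum>e<length G. of_bool (keepN G W K t (own G e)) * wgt G e * (val G e * (M * W) ^ r - dpN G W K t M r)"
    let ?e1 = "Plus (Times (Times (vr 18) (vr 5)) (vr 19)) (vr 22)"
    let ?e2 = "Times (Times (vr 18) (vr 5)) (vr 20)"
    let ?Q = "\<lambda>m''. m'' 0 = L \<and> m'' (L + 21) = r \<and> I (Suc r) (m''(L + 21 := Suc r))"
    have acc: "?acc < 2 ^ \<beta>" using b(1)[of "Suc r"] r by simp
    show "runs \<beta> X (Then DPSTEP (Then (St (vl 19) ?e1) (St (vl 20) ?e2))) m' ?Q"
    proof (rule runs_Then, rule runs_mono[OF runs_DPSTEP[OF sm' k(4,3,2) acc]])
      fix m'' assume "mem_bits \<beta> m''"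
        and q: "m'' (L + 22) = ?acc \<and> (\<forall>a. a \<notin> {L + 12, L + 14, L + 15, L + 22} \<longrightarrow> m'' a = m' a)"
      then have f1: "m'' a = m' a" if "a \<notin> {L + 12, L + 14, L + 15, L + 22}" for a using that by blast
      have sm'': "scal L G n W K N M m''"
        by (rule scal_frame[where V = "{L + 12, L + 14, L + 15, L + 22}", OF sm']) (use f1 L in auto)
      note s = scalD[OF sm''] envD[OF scalD(1)[OF sm'']]
      have k'': "m'' (L + 19) = dpN G W K t M r" "m'' (L + 20) = (M * W) ^ r" "m'' (L + 21) = r"
        using f1 k v by auto
      have fr'': "fr m''" using f1 k(1) by (auto simp: fr_def V_def)
      have r1: "rval ?e1 m'' = dpN G W K t M (Suc r)" using s k'' q by simp
      define m3 where "m3 = m''(L + 19 := dpN G W K t M (Suc r))"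
      have r2: "rval ?e2 m3 = (M * W) ^ Suc r" using s k'' L by (simp add: m3_def)
      have "runs \<beta> X (St (vl 20) ?e2) m3 ?Q"
      proof (rule runs_St)
        show "rval ?e2 m3 < 2 ^ \<beta>" unfolding r2 using b(2)[of "Suc r"] r by simp
        show "?Q (m3(rval (vl 20) m3 := rval ?e2 m3))"
          unfolding r2 using fr'' s k'' L by (auto simp: I_def m3_def fr_def V_def simp del: dpN.simps)
      qed
      moreover have "m''(rval (vl 19) m'' := rval ?e1 m'') = m3"
        unfolding r1 m3_def using s by simp
      ultimately show "runs \<beta> X (Then (St (vl 19) ?e1) (St (vl 20) ?e2)) m'' ?Q"
        using b(1)[of "Suc r"] r by (intro runs_Then[of _ _ "St (vl 19) ?e1"] runs_St[of _ _ ?e1])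
          (simp_all only: r1 Suc_le_eq)
    qed
  next
    fix r m' assume "I r m'"
    then show "m' 0 = L \<and> rval (vr 26) m' = R"
      using L m0 m(3) by (auto simp: I_def fr_def V_def)
  qed (use R L m(3) m0 in \<open>simp_all add: I_def fr_def V_def\<close>)
  have "runs \<beta> X DP m (I R)"
    unfolding DP_def
  proof (rule runs_Then, rule runs_St)
    have e: "(m(rval (vl 19) m := rval (vr 11) m)) = m(L + 19 := t)" using m m0 by simp
    show "rval (vr 11) m < 2 ^ \<beta>" using b(1)[of 0] m m0 by simp
    have e': "(m(L + 19 := t))(rval (vl 20) (m(L + 19 := t)) := rval (Cn 1) (m(L + 19 := t))) = m(L + 19 := t, L + 20 := 1)"
      using L m0 by simp
    show "runs \<beta> X (Then (St (vl 20) (Cn 1)) (For 21 (vr 26) (Then DPSTEP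
     (Then (St (vl 19) (Plus (Times (Times (vr 18) (vr 5)) (vr 19)) (vr 22)))
        (St (vl 20) (Times (Times (vr 18) (vr 5)) (vr 20)))))))
      (m(rval (vl 19) m := rval (vr 11) m)) (I R)"
      unfolding e
    proof (rule runs_Then, rule runs_St)
      show "rval (Cn 1) (m(L + 19 := t)) < 2 ^ \<beta>" using b(2)[of 0] by simp
    qed (unfold e', rule loop)
  qed
  then show ?thesis by (rule runs_mono) (auto simp: I_def fr_def V_def)
qed

end

section \<open>Reading the input\<close>

text \<open>
  List \<open>i\<close> is preceded by its length; if the lists before it have \<open>F\<close> atoms in total, this length is in
  cell \<open>4 + i + 4 F\<close>.
\<close>

definition HEADER :: rexp where
  "HEADER = Ld (Plus (Plus (Cn 4) (vr 2)) (Times (Cn 4) (vr 4)))"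

text \<open>An atom takes four cells: numerator and denominator of the value
  (\<open>c = 0, 1\<close>) and of the probability (\<open>c = 2, 3\<close>). During the copy,
  \<open>vr 4\<close> counts the atoms already transferred.\<close>

definition ENTRY :: "nat \<Rightarrow> rexp" where
  "ENTRY c = Ld (Plus (Plus (Cn (5 + c)) (vr 2)) (Times (Cn 4) (vr 4)))"

definition COUNT :: rcom where
  "COUNT = Then (St (vl 4) (Cn 0)) (For 2 (vr 8) (St (vl 4) (Plus (vr 4) HEADER)))"

text \<open>In truncated arithmetic \<open>x + (1 - x)\<close> is \<open>max 1 x\<close>. The loop
  covers the cells of \<open>enc_input\<close> only, so that \<open>W\<close> is the same with and
  without a query behind them.\<close>

definition DENOM :: rcom where
  "DENOM = Then (St (vl 5) (Cn 1)) (For 10 (Plus (Plus (Cn 3) (vr 8)) (Times (Cn 4) (vr 4)))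
     (St (vl 5) (Times (vr 5) (Plus (Ld (Plus (vr 10) (Cn 1))) (Minus (Cn 1) (Ld (Plus (vr 10) (Cn 1))))))))"

definition COPY :: rcom where
  "COPY = Then (St (al 0 (vr 4)) (vr 2))
     (Then (St (al 1 (vr 4)) (Times (ENTRY 0) (Quot (vr 5) (ENTRY 1))))
     (Then (St (al 2 (vr 4)) (Times (ENTRY 2) (Quot (vr 5) (ENTRY 3))))
        (St (vl 4) (Plus (vr 4) (Cn 1)))))"

definition FLAT :: rcom where
  "FLAT = Then (St (vl 4) (Cn 0)) (For 2 (vr 8) (Then (St (vl 9) HEADER) (For 3 (vr 9) COPY)))"

text \<open>The power of two is doubled as long as it is at most
  \<open>1 / (4 * \<epsilon>)\<close>. Cells \<open>1\<close> and \<open>2\<close> hold the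
  numerator and the denominator of \<open>\<epsilon>\<close>; the added \<open>1\<close> keeps the
  truncated difference nonzero in the case of equality.\<close>

definition SCALE :: rcom where
  "SCALE = Then (St (vl 6) (Cn 1)) (Then (St (vl 7) (Cn 0))
     (Then (Loop (Minus (Plus (Ld (Cn 2)) (Cn 1)) (Times (Times (Cn 4) (vr 6)) (Ld (Cn 1))))
        (Then (St (vl 6) (Times (Cn 2) (vr 6))) (St (vl 7) (Plus (vr 7) (Cn 1)))))
     (Then (St (vl 17) (Times (Times (Times (Cn 2) (vr 7)) (vr 6)) (vr 6)))
        (St (vl 18) (Quot (Times (Minus (vr 8) (Cn 1)) (Minus (vr 6) (Cn 1))) (vr 6))))))"

definition PRE :: rcom where
  "PRE = Then (St (vl 8) (Ld (Cn 3))) (Then COUNT (Then DENOM (Then FLAT SCALE)))"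

text \<open>What the programs need to know about the input memory, detached from the encoding. Cells
  behind the instance are left open, so one verification of the preprocessing serves both
  programs.\<close>

locale parsed = table_bounds \<beta> X L G n W K N M
  for \<beta> X L G n W K N M +
  fixes m :: mem and len :: "nat \<Rightarrow> nat" and k :: nat
  assumes m0: "m 0 = L" and m3: "m 3 = n"
    and header: "\<And>i. i < n \<Longrightarrow> m (4 + i + 4 * sum len {..<i}) = len i"
    and size: "3 + n + 4 * sum len {..<n} \<le> L" "3 + n + 4 * sum len {..<n} \<le> X" "L < 2 ^ \<beta>"
    and lenG: "length G = sum len {..<n}"
    and entry: "\<And>i j e. i < n \<Longrightarrow> j < len i \<Longrightarrow> e = sum len {..<i} + j \<Longrightarrow>
      G ! e = (i, m (5 + i + 4 * e) * (W div m (6 + i + 4 * e)), m (7 + i + 4 * e) * (W div m (8 + i + 4 * e)))"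
    and W: "W = (\<Prod>a<3 + n + 4 * sum len {..<n}. max 1 (m (a + 1)))" "W < 2 ^ \<beta>"
    and val: "\<And>e. e < length G \<Longrightarrow> val G e < 2 ^ \<beta>"
    and k: "\<And>j. j < k \<Longrightarrow> 4 * 2 ^ j * m 1 \<le> m 2" "m 2 < 4 * 2 ^ k * m 1" "k \<le> X"
    and K: "K = 2 ^ k" "K < 2 ^ \<beta>" "k < 2 ^ \<beta>"
    and N: "N = 2 * k * K * K" "N < 2 ^ \<beta>"
    and M: "M = (n - 1) * (K - 1) div K"
begin

lemma fl_mono: "i \<le> j \<Longrightarrow> sum len {..<i} \<le> sum len {..<j}"
  by (rule sum_lessThan_le)

lemma fl_less: "i < n \<Longrightarrow> sum len {..<i} + len i \<le> sum len {..<n}"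
  using fl_mono[of "Suc i" n] by simp

lemma one_less: "1 < (2 :: nat) ^ \<beta>"
  using size(3) L by linarith

lemma runs_COUNT:
  assumes fr: "\<And>a. a \<le> L \<Longrightarrow> m1 a = m a" and n8: "m1 (L + 8) = n"
  shows "runs \<beta> X COUNT m1 (\<lambda>m'. m' (L + 4) = length G \<and> (\<forall>a. a \<notin> {L + 2, L + 4} \<longrightarrow> m' a = m1 a))"
proof -
  define fr where "fr = (\<lambda>m'. \<forall>a. a \<notin> {L + 2, L + 4} \<longrightarrow> m' a = m1 a)"
  have low: "m' a = m a" if "fr m'" "a \<le> L" for m' a
    using that assms(1)[of a] by (auto simp: fr_def)
  have c: "m1 0 = L" using fr m0 by simp
  show ?thesis
    unfolding COUNT_def
  proof (rule runs_Then, rule runs_St, simp, rule runs_For[where L = L and N = n and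
        I = "\<lambda>j m'. fr m' \<and> m' (L + 4) = sum len {..<j}"])
    fix j m' assume j: "j < n" and I: "fr m' \<and> m' (L + 4) = sum len {..<j}" and v: "m' (L + 2) = j"
    have a: "4 + j + 4 * sum len {..<j} \<le> L" using fl_less[OF j] size(1) j by simp
    have l0: "m' 0 = L" using low[of m' 0] I m0 by simp
    have r: "rval (Plus (vr 4) HEADER) m' = sum len {..<Suc j}"
      using I v l0 low[of m' "4 + j + 4 * sum len {..<j}"] a header[OF j] by (simp add: HEADER_def)
    have "sum len {..<Suc j} \<le> length G" using fl_less[OF j] lenG by simp
    then have b: "sum len {..<Suc j} < 2 ^ \<beta>" using F by linarith
    show "runs \<beta> X (St (vl 4) (Plus (vr 4) HEADER)) m' (\<lambda>m''. m'' 0 = L \<and> m'' (L + 2) = j \<and>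
        (fr (m''(L + 2 := Suc j)) \<and> (m''(L + 2 := Suc j)) (L + 4) = sum len {..<Suc j}))"
      by (rule runs_St; unfold r; use b I v l0 L in \<open>simp add: fr_def\<close>)
  next
    fix j m' assume I: "fr m' \<and> m' (L + 4) = sum len {..<j}"
    then show "m' 0 = L \<and> rval (vr 8) m' = n" using low[of m' 0] m0 n8 by (simp add: fr_def)
  next
    fix m' assume "fr m' \<and> m' (L + 4) = sum len {..<n}"
    then show "m' (L + 4) = length G \<and> (\<forall>a. a \<notin> {L + 2, L + 4} \<longrightarrow> m' a = m1 a)"
      unfolding fr_def lenG by blast
  qed (use n c L in \<open>simp_all add: fr_def\<close>)
qed

lemma runs_DENOM:
  assumes fr: "\<And>a. a \<le> L \<Longrightarrow> m1 a = m a" and s: "m1 (L + 8) = n" "m1 (L + 4) = length G"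
  shows "runs \<beta> X DENOM m1 (\<lambda>m'. m' (L + 5) = W \<and> (\<forall>a. a \<notin> {L + 5, L + 10} \<longrightarrow> m' a = m1 a))"
proof -
  define fr where "fr = (\<lambda>m'. \<forall>a. a \<notin> {L + 5, L + 10} \<longrightarrow> m' a = m1 a)"
  define w where "w = (\<lambda>j. \<Prod>a<j. max 1 (m (a + 1)))"
  define Z where "Z = 3 + n + 4 * sum len {..<n}"
  have low: "m' a = m a" if "fr m'" "a \<le> L" for m' a
    using that assms(1)[of a] by (auto simp: fr_def)
  have c: "m1 0 = L" using fr m0 by simp
  have w_Suc: "w (Suc j) = w j * max 1 (m (j + 1))" for j by (simp add: w_def)
  have w_b: "w j < 2 ^ \<beta>" if "j \<le> Z" for j
  proof -
    \<comment> \<open>A partial product divides the full one, hence is at most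
      \<open>W\<close>.\<close>
    have "w j dvd w Z" unfolding w_def using that by (intro prod_dvd_prod_subset) auto
    moreover have "0 < w Z" unfolding w_def by (intro prod_pos) auto
    ultimately have "w j \<le> w Z" by (rule dvd_imp_le)
    also have "w Z = W" by (simp add: w_def W(1) Z_def)
    finally show ?thesis using W(2) by simp
  qed
  have Zb: "Z \<le> L" "Z \<le> X" "Z < 2 ^ \<beta>" using size by (auto simp: Z_def)
  let ?e = "Times (vr 5) (Plus (Ld (Plus (vr 10) (Cn 1))) (Minus (Cn 1) (Ld (Plus (vr 10) (Cn 1)))))"
  show ?thesis
    unfolding DENOM_def
  proof (rule runs_Then, rule runs_St, simp add: one_less[simplified], rule runs_For[where L = L and N = Z and
        I = "\<lambda>j m'. fr m' \<and> m' (L + 5) = w j"])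
    fix j m' assume j: "j < Z" and I: "fr m' \<and> m' (L + 5) = w j" and v: "m' (L + 10) = j"
    have l0: "m' 0 = L" using low[of m' 0] I m0 by simp
    have "m' (Suc j) = m (Suc j)" using low[of m' "Suc j"] I j Zb by simp
    then have r: "rval ?e m' = w (Suc j)" using I v l0 by (simp add: w_Suc max_def)
    show "runs \<beta> X (St (vl 5) ?e) m' (\<lambda>m''. m'' 0 = L \<and> m'' (L + 10) = j \<and>
        (fr (m''(L + 10 := Suc j)) \<and> (m''(L + 10 := Suc j)) (L + 5) = w (Suc j)))"
      by (rule runs_St; unfold r; use w_b[of "Suc j"] j I v l0 L in \<open>simp add: fr_def\<close>)
  next
    fix j m' assume I: "fr m' \<and> m' (L + 5) = w j"
    then show "m' 0 = L \<and> rval (Plus (Plus (Cn 3) (vr 8)) (Times (Cn 4) (vr 4))) m' = Z"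
      using low[of m' 0] m0 s by (simp add: fr_def Z_def lenG)
  next
    fix m' assume "fr m' \<and> m' (L + 5) = w Z"
    then show "m' (L + 5) = W \<and> (\<forall>a. a \<notin> {L + 5, L + 10} \<longrightarrow> m' a = m1 a)"
      unfolding fr_def by (simp add: w_def W(1) Z_def)
  qed (use Zb c L in \<open>simp_all add: fr_def w_def\<close>)
qed

definition partial :: "nat \<Rightarrow> mem \<Rightarrow> bool" where
  "partial f m' \<longleftrightarrow> m' (L + 4) = f \<and> (\<forall>e<f. m' (L + (40 + 3 * e)) = own G e \<and>
     m' (L + (41 + 3 * e)) = val G e \<and> m' (L + (42 + 3 * e)) = wgt G e)"

lemma runs_COPY:
  assumes i: "i < n" and j: "j < len i" and e: "e = sum len {..<i} + j"
    and low: "\<And>a. a \<le> L \<Longrightarrow> m1 a = m a" and s: "m1 (L + 5) = W" "m1 (L + 2) = i"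
    and part: "partial e m1"
  shows "runs \<beta> X COPY m1 (\<lambda>m'. partial (Suc e) m' \<and> (\<forall>a. a \<noteq> L + 4 \<and> a < L + 40 \<longrightarrow> m' a = m1 a))"
proof -
  have e_less: "e < length G" using fl_less[OF i] j lenG by (simp add: e)
  have bound: "8 + i + 4 * e \<le> L"
    using size(1) e_less lenG i by simp
  have c: "m1 0 = L" using low m0 by simp
  have f: "m1 (L + 4) = e" using part by (simp add: partial_def)
  have g: "own G e = i" "val G e = m (5 + i + 4 * e) * (W div m (6 + i + 4 * e))"
      "wgt G e = m (7 + i + 4 * e) * (W div m (8 + i + 4 * e))"
    using entry[OF i j e] by simp_all
  have wb: "wgt G e < 2 ^ \<beta>"
  proof -
    have "wgt G e \<le> (\<Sum>e<length G. wgt G e)" using e_less by (intro member_le_sum) auto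
    then show ?thesis using tot by simp
  qed
  define m2 where "m2 = m1(L + (40 + 3 * e) := own G e)"
  define m3 where "m3 = m2(L + (41 + 3 * e) := val G e)"
  define m4 where "m4 = m3(L + (42 + 3 * e) := wgt G e)"
  have l2: "m2 a = m1 a" "m3 a = m1 a" "m4 a = m1 a" if "a < L + 40" for a
    using that by (auto simp: m2_def m3_def m4_def)
  have low': "m2 a = m a" "m3 a = m a" if "a \<le> L" for a
    using l2[of a] low[OF that] that by auto
  have e0: "m1(rval (al 0 (vr 4)) m1 := rval (vr 2) m1) = m2" using c f s g by (simp add: m2_def)
  have r1: "rval (Times (ENTRY 0) (Quot (vr 5) (ENTRY 1))) m2 = val G e"
    using l2 low'[of "5 + i + 4 * e"] low'[of "6 + i + 4 * e"] low'[of 0] bound f s c g L m0 by (simp add: ENTRY_def)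
  have e1: "m2(rval (al 1 (vr 4)) m2 := rval (Times (ENTRY 0) (Quot (vr 5) (ENTRY 1))) m2) = m3"
    unfolding r1 m3_def using l2 f c L by simp
  have r2: "rval (Times (ENTRY 2) (Quot (vr 5) (ENTRY 3))) m3 = wgt G e"
    using l2 low'[of "7 + i + 4 * e"] low'[of "8 + i + 4 * e"] low'[of 0] bound f s c g L m0 by (simp add: ENTRY_def)
  have e2: "m3(rval (al 2 (vr 4)) m3 := rval (Times (ENTRY 2) (Quot (vr 5) (ENTRY 3))) m3) = m4"
    unfolding r2 m4_def using l2 f c L by simp
  have e3: "m4(rval (vl 4) m4 := rval (Plus (vr 4) (Cn 1)) m4) = m4(L + 4 := Suc e)"
    using l2 f c L by simp
  have "partial (Suc e) (m4(L + 4 := Suc e))"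
    unfolding partial_def
  proof (intro conjI allI impI)
    fix e' assume "e' < Suc e"
    then consider "e' = e" | "e' < e" by linarith
    then have "(m4(L + 4 := Suc e)) (L + (40 + 3 * e')) = own G e' \<and>
      (m4(L + 4 := Suc e)) (L + (41 + 3 * e')) = val G e' \<and> (m4(L + 4 := Suc e)) (L + (42 + 3 * e')) = wgt G e'"
    proof cases
      case 1
      have "L + (40 + 3 * e) \<noteq> L + (41 + 3 * e)" "L + (40 + 3 * e) \<noteq> L + (42 + 3 * e)"
          "L + (41 + 3 * e) \<noteq> L + (42 + 3 * e)" by presburger+
      with 1 show ?thesis by (simp add: m4_def m3_def m2_def)
    next
      case 2
      then have "L + (x + 3 * e') \<noteq> L + (y + 3 * e)" if "x \<in> {40, 41, 42}" "y \<in> {40, 41, 42}" for x y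
        using that by auto presburger+
      then have "m4 (L + (x + 3 * e')) = m1 (L + (x + 3 * e'))" if "x \<in> {40, 41, 42}" for x
        using that by (simp add: m4_def m3_def m2_def)
      with 2 part show ?thesis by (simp add: partial_def)
    qed
    then show "(m4(L + 4 := Suc e)) (L + (40 + 3 * e')) = own G e'"
      "(m4(L + 4 := Suc e)) (L + (41 + 3 * e')) = val G e'" "(m4(L + 4 := Suc e)) (L + (42 + 3 * e')) = wgt G e'"
      by blast+
  qed simp
  moreover have "\<forall>a. a \<noteq> L + 4 \<and> a < L + 40 \<longrightarrow> (m4(L + 4 := Suc e)) a = m1 a"
    using l2 by simp
  ultimately have Q: "partial (Suc e) (m4(L + 4 := Suc e)) \<and>
      (\<forall>a. a \<noteq> L + 4 \<and> a < L + 40 \<longrightarrow> (m4(L + 4 := Suc e)) a = m1 a)" by blast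
  show ?thesis
    unfolding COPY_def
  proof (rule runs_Then, rule runs_St)
    show "rval (vr 2) m1 < 2 ^ \<beta>" using c s i n by simp
    show "runs \<beta> X (Then (St (al 1 (vr 4)) (Times (ENTRY 0) (Quot (vr 5) (ENTRY 1))))
     (Then (St (al 2 (vr 4)) (Times (ENTRY 2) (Quot (vr 5) (ENTRY 3))))
        (St (vl 4) (Plus (vr 4) (Cn 1))))) (m1(rval (al 0 (vr 4)) m1 := rval (vr 2) m1))
       (\<lambda>m'. partial (Suc e) m' \<and> (\<forall>a. a \<noteq> L + 4 \<and> a < L + 40 \<longrightarrow> m' a = m1 a))"
      unfolding e0
    proof (rule runs_Then, rule runs_St)
      show "rval (Times (ENTRY 0) (Quot (vr 5) (ENTRY 1))) m2 < 2 ^ \<beta>" unfolding r1 by (rule val[OF e_less])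
      show "runs \<beta> X (Then (St (al 2 (vr 4)) (Times (ENTRY 2) (Quot (vr 5) (ENTRY 3))))
        (St (vl 4) (Plus (vr 4) (Cn 1)))) (m2(rval (al 1 (vr 4)) m2 := rval (Times (ENTRY 0) (Quot (vr 5) (ENTRY 1))) m2))
       (\<lambda>m'. partial (Suc e) m' \<and> (\<forall>a. a \<noteq> L + 4 \<and> a < L + 40 \<longrightarrow> m' a = m1 a))"
        unfolding e1
      proof (rule runs_Then, rule runs_St)
        show "rval (Times (ENTRY 2) (Quot (vr 5) (ENTRY 3))) m3 < 2 ^ \<beta>" unfolding r2 by (rule wb)
        show "runs \<beta> X (St (vl 4) (Plus (vr 4) (Cn 1))) (m3(rval (al 2 (vr 4)) m3 := rval (Times (ENTRY 2) (Quot (vr 5) (ENTRY 3))) m3))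
         (\<lambda>m'. partial (Suc e) m' \<and> (\<forall>a. a \<noteq> L + 4 \<and> a < L + 40 \<longrightarrow> m' a = m1 a))"
          unfolding e2
        proof (rule runs_St)
          show "rval (Plus (vr 4) (Cn 1)) m4 < 2 ^ \<beta>" using l2 f c e_less F L by simp
        qed (unfold e3, rule Q)
      qed
    qed
  qed
qed

lemma runs_FLAT:
  assumes low1: "\<And>a. a \<le> L \<Longrightarrow> m1 a = m a" and s: "m1 (L + 5) = W" "m1 (L + 8) = n"
  shows "runs \<beta> X FLAT m1 (\<lambda>m'. env L G m' \<and>
    (\<forall>a. a \<notin> {L + 2, L + 3, L + 4, L + 9} \<and> a < L + 40 \<longrightarrow> m' a = m1 a))"
proof -
  define fr where "fr = (\<lambda>m'. \<forall>a. a \<notin> {L + 2, L + 3, L + 4, L + 9} \<and> a < L + 40 \<longrightarrow> m' a = m1 a)"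
  have low: "m' a = m a" if "fr m'" "a \<le> L" for m' a
    using that low1[of a] by (auto simp: fr_def)
  have c: "m1 0 = L" using low1 m0 by simp
  have frs: "m' 0 = L" "m' (L + 5) = W" "m' (L + 8) = n" if "fr m'" for m'
    using that low[OF that, of 0] m0 s by (simp_all add: fr_def)
  have part_upd: "partial f (m'(L + v := x)) \<longleftrightarrow> partial f m'" if "v < 40" "v \<noteq> 4" for f m' v x
    using that by (simp add: partial_def)
  have fr_upd: "fr (m'(L + v := x))" if "fr m'" "v \<in> {2, 3, 4, 9}" for m' v x
    using that by (elim insertE emptyE) (simp_all add: fr_def)
  show ?thesis
    unfolding FLAT_def
  proof (rule runs_Then, rule runs_St, simp, rule runs_For[where L = L and N = n and
        I = "\<lambda>i m'. fr m' \<and> partial (sum len {..<i}) m'"])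
    fix i m' assume i: "i < n" and I: "fr m' \<and> partial (sum len {..<i}) m'" and v: "m' (L + 2) = i"
    have a: "4 + i + 4 * sum len {..<i} \<le> L" using fl_less[OF i] size(1) i by simp
    note fs = frs[OF conjunct1[OF I]]
    have p4: "m' (L + 4) = sum len {..<i}" using I by (simp add: partial_def)
    have r: "rval HEADER m' = len i"
      using p4 v fs low[of m' "4 + i + 4 * sum len {..<i}"] a header[OF i] I by (simp add: HEADER_def)
    have lb: "len i \<le> length G" using fl_less[OF i] lenG by simp
    define m2 where "m2 = m'(L + 9 := len i)"
    have e: "m'(rval (vl 9) m' := rval HEADER m') = m2" unfolding r m2_def using fs by simp
    let ?Q = "\<lambda>m''. m'' 0 = L \<and> m'' (L + 2) = i \<and>
        (fr (m''(L + 2 := Suc i)) \<and> partial (sum len {..<Suc i}) (m''(L + 2 := Suc i)))"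
    have "runs \<beta> X (For 3 (vr 9) COPY) m2 ?Q"
    proof (rule runs_For[where L = L and N = "len i" and
          I = "\<lambda>j m''. fr m'' \<and> m'' (L + 2) = i \<and> m'' (L + 9) = len i \<and> partial (sum len {..<i} + j) m''"])
      fix j m'' assume j: "j < len i" and v': "m'' (L + 3) = j"
        and I': "fr m'' \<and> m'' (L + 2) = i \<and> m'' (L + 9) = len i \<and> partial (sum len {..<i} + j) m''"
      note fs' = frs[OF conjunct1[OF I']]
      show "runs \<beta> X COPY m'' (\<lambda>m'. m' 0 = L \<and> m' (L + 3) = j \<and> (fr (m'(L + 3 := Suc j)) \<and>
        (m'(L + 3 := Suc j)) (L + 2) = i \<and> (m'(L + 3 := Suc j)) (L + 9) = len i \<and>
        partial (sum len {..<i} + Suc j) (m'(L + 3 := Suc j))))"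
      proof -
        have copy: "runs \<beta> X COPY m'' (\<lambda>m'. partial (Suc (sum len {..<i} + j)) m' \<and>
            (\<forall>a. a \<noteq> L + 4 \<and> a < L + 40 \<longrightarrow> m' a = m'' a))"
        proof (rule runs_COPY[OF i j refl])
          show "m'' a = m a" if "a \<le> L" for a using low[OF conjunct1[OF I'] that] .
        qed (use I' fs' in blast)+
        show ?thesis
        proof (rule runs_mono[OF copy])
        fix m3 assume q: "partial (Suc (sum len {..<i} + j)) m3 \<and> (\<forall>a. a \<noteq> L + 4 \<and> a < L + 40 \<longrightarrow> m3 a = m'' a)"
        then have "fr m3" using I' by (simp add: fr_def)
        then show "m3 0 = L \<and> m3 (L + 3) = j \<and> (fr (m3(L + 3 := Suc j)) \<and>
          (m3(L + 3 := Suc j)) (L + 2) = i \<and> (m3(L + 3 := Suc j)) (L + 9) = len i \<and>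
          partial (sum len {..<i} + Suc j) (m3(L + 3 := Suc j)))"
          using q I' v' frs[of m3] by (simp add: part_upd fr_upd)
        qed
      qed
    next
      fix m'' assume q: "fr m'' \<and> m'' (L + 2) = i \<and> m'' (L + 9) = len i \<and> partial (sum len {..<i} + len i) m''"
      then show "?Q m''" using frs[of m''] fr_upd[of m'' 2 "Suc i"] part_upd[of 2 "sum len {..<i} + len i" m'' "Suc i"]
        by (simp del: add_2_eq_Suc')
    next
      show "fr (m2(L + 3 := 0)) \<and> (m2(L + 3 := 0)) (L + 2) = i \<and> (m2(L + 3 := 0)) (L + 9) = len i \<and>
          partial (sum len {..<i} + 0) (m2(L + 3 := 0))"
        using I v by (simp add: m2_def part_upd fr_upd del: add_2_eq_Suc')
    qed (use lb F L fs frs in \<open>auto simp: m2_def\<close>)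
    then show "runs \<beta> X (Then (St (vl 9) HEADER) (For 3 (vr 9) COPY)) m' ?Q"
      by (intro runs_Then[of _ _ "St (vl 9) HEADER"] runs_St[of _ _ HEADER]) (use lb F r e in simp_all)
  next
    fix m' assume "fr m' \<and> partial (sum len {..<n}) m'"
    then show "env L G m' \<and> (\<forall>a. a \<notin> {L + 2, L + 3, L + 4, L + 9} \<and> a < L + 40 \<longrightarrow> m' a = m1 a)"
      using frs[of m'] by (simp add: env_def partial_def lenG fr_def)
  next
    fix i m' assume "fr m' \<and> partial (sum len {..<i}) m'"
    then show "m' 0 = L \<and> rval (vr 8) m' = n" using frs[of m'] by simp
  qed (use n L c s in \<open>simp_all add: fr_def partial_def\<close>)
qed

lemma M_le: "M \<le> n"
proof -
  have "M \<le> (n - 1) * K div K" unfolding M by (intro div_le_mono mult_le_mono2) simp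
  also have "\<dots> = n - 1" by (simp add: K)
  finally show ?thesis by simp
qed

lemma runs_SCALE:
  assumes env: "env L G m1" and s: "m1 (L + 5) = W" "m1 (L + 8) = n" "m1 1 = m 1" "m1 2 = m 2" and L2: "2 \<le> L"
  shows "runs \<beta> X SCALE m1 (\<lambda>m'. scal L G n W K N M m' \<and>
    (\<forall>a. a \<notin> {L + 6, L + 7, L + 17, L + 18} \<longrightarrow> m' a = m1 a))"
proof -
  note c = envD(1)[OF env]
  define fr where "fr = (\<lambda>m'. \<forall>a. a \<notin> {L + 6, L + 7, L + 17, L + 18} \<longrightarrow> m' a = m1 a)"
  have frs: "m' 0 = L" "m' 1 = m 1" "m' 2 = m 2" "m' (Suc 0) = m 1" "m' (L + 5) = W" "m' (L + 8) = n" if "fr m'" for m'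
    using that s c L2 by (simp_all add: fr_def)
  define loop where "loop = Loop (Minus (Plus (Ld (Cn 2)) (Cn 1)) (Times (Times (Cn 4) (vr 6)) (Ld (Cn 1))))
        (Then (St (vl 6) (Times (Cn 2) (vr 6))) (St (vl 7) (Plus (vr 7) (Cn 1))))"
  define fin where "fin = Then (St (vl 17) (Times (Times (Times (Cn 2) (vr 7)) (vr 6)) (vr 6)))
        (St (vl 18) (Quot (Times (Minus (vr 8) (Cn 1)) (Minus (vr 6) (Cn 1))) (vr 6)))"
  let ?Q = "\<lambda>m'. scal L G n W K N M m' \<and> (\<forall>a. a \<notin> {L + 6, L + 7, L + 17, L + 18} \<longrightarrow> m' a = m1 a)"
  have fin: "runs \<beta> X fin m' ?Q" if f: "fr m'" and k6: "m' (L + 6) = K" "m' (L + 7) = k" for m'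
  proof -
    let ?m2 = "m'(L + 17 := N)"
    have r1: "rval (Times (Times (Times (Cn 2) (vr 7)) (vr 6)) (vr 6)) m' = N"
      using frs[OF f] k6 by (simp add: N)
    have e1: "m'(rval (vl 17) m' := rval (Times (Times (Times (Cn 2) (vr 7)) (vr 6)) (vr 6)) m') = ?m2"
      unfolding r1 using frs[OF f] by simp
    have r2: "rval (Quot (Times (Minus (vr 8) (Cn 1)) (Minus (vr 6) (Cn 1))) (vr 6)) ?m2 = M"
      using frs[OF f] k6 L by (simp add: M)
    have e2: "?m2(rval (vl 18) ?m2 := rval (Quot (Times (Minus (vr 8) (Cn 1)) (Minus (vr 6) (Cn 1))) (vr 6)) ?m2)
      = m'(L + 17 := N, L + 18 := M)"
      unfolding r2 using frs[OF f] L by simp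
    have f': "fr (m'(L + 17 := N, L + 18 := M))" using f by (simp add: fr_def)
    have "env L G (m'(L + 17 := N, L + 18 := M))"
      by (rule env_frame[OF env, where V = "{L + 6, L + 7, L + 17, L + 18}"]) (use f' L in \<open>auto simp: fr_def\<close>)
    then have Q: "?Q (m'(L + 17 := N, L + 18 := M))"
      using frs[OF f] k6 f' by (simp add: scal_def fr_def)
    show ?thesis
      unfolding fin_def
    proof (rule runs_Then, rule runs_St, unfold r1, rule N(2))
      show "runs \<beta> X (St (vl 18) (Quot (Times (Minus (vr 8) (Cn 1)) (Minus (vr 6) (Cn 1))) (vr 6))) (m'(rval (vl 17) m' := N)) ?Q"
        using e1 unfolding r1
      proof (simp only:, intro runs_St)
        show "rval (Quot (Times (Minus (vr 8) (Cn 1)) (Minus (vr 6) (Cn 1))) (vr 6)) ?m2 < 2 ^ \<beta>"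
          unfolding r2 using M_le n by simp
      qed (unfold e2, rule Q)
    qed
  qed
  have loop: "runs \<beta> X loop m' (\<lambda>m''. runs \<beta> X fin m'' ?Q)" if f: "fr m'" "m' (L + 6) = 1" "m' (L + 7) = 0" for m'
    unfolding loop_def
  proof (rule runs_Loop[where N = k and Inv = "\<lambda>j m''. fr m'' \<and> m'' (L + 6) = 2 ^ j \<and> m'' (L + 7) = j"])
    fix j m'' assume j: "j < k" and I: "fr m'' \<and> m'' (L + 6) = 2 ^ j \<and> m'' (L + 7) = j"
    note fs = frs[OF conjunct1[OF I]]
    have "k < \<beta>" using K by simp
    then have b: "(2 :: nat) ^ Suc j < 2 ^ \<beta>"
      using j by (intro power_strict_increasing) auto
    have b': "Suc j < 2 ^ \<beta>" using j K(3) by linarith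
    let ?m2 = "m''(L + 6 := 2 ^ Suc j)"
    have r1: "rval (Times (Cn 2) (vr 6)) m'' = 2 ^ Suc j" using fs I by simp
    have e1: "m''(rval (vl 6) m'' := rval (Times (Cn 2) (vr 6)) m'') = ?m2" unfolding r1 using fs by simp
    have "runs \<beta> X (Then (St (vl 6) (Times (Cn 2) (vr 6))) (St (vl 7) (Plus (vr 7) (Cn 1)))) m''
      (\<lambda>m''. fr m'' \<and> m'' (L + 6) = 2 ^ Suc j \<and> m'' (L + 7) = Suc j)"
    proof (rule runs_Then, rule runs_St)
      show "rval (Times (Cn 2) (vr 6)) m'' < 2 ^ \<beta>" unfolding r1 by (rule b)
      show "runs \<beta> X (St (vl 7) (Plus (vr 7) (Cn 1))) (m''(rval (vl 6) m'' := rval (Times (Cn 2) (vr 6)) m''))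
        (\<lambda>m''. fr m'' \<and> m'' (L + 6) = 2 ^ Suc j \<and> m'' (L + 7) = Suc j)"
        unfolding e1 by (rule runs_St) (use b' fs I L in \<open>simp_all add: fr_def\<close>)
    qed
    moreover have "rval (Minus (Plus (Ld (Cn 2)) (Cn 1)) (Times (Times (Cn 4) (vr 6)) (Ld (Cn 1)))) m'' \<noteq> 0"
      using fs I k(1)[OF j] by simp
    ultimately show "rval (Minus (Plus (Ld (Cn 2)) (Cn 1)) (Times (Times (Cn 4) (vr 6)) (Ld (Cn 1)))) m'' \<noteq> 0 \<and>
      runs \<beta> X (Then (St (vl 6) (Times (Cn 2) (vr 6))) (St (vl 7) (Plus (vr 7) (Cn 1)))) m''
      (\<lambda>m''. fr m'' \<and> m'' (L + 6) = 2 ^ Suc j \<and> m'' (L + 7) = Suc j)" by blast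
  next
    fix m'' assume I: "fr m'' \<and> m'' (L + 6) = 2 ^ k \<and> m'' (L + 7) = k"
    have "rval (Minus (Plus (Ld (Cn 2)) (Cn 1)) (Times (Times (Cn 4) (vr 6)) (Ld (Cn 1)))) m'' = 0"
      using frs[OF conjunct1[OF I]] I k(2) by simp
    then show "rval (Minus (Plus (Ld (Cn 2)) (Cn 1)) (Times (Times (Cn 4) (vr 6)) (Ld (Cn 1)))) m'' = 0 \<and> runs \<beta> X fin m'' ?Q"
      using fin I K by blast
  qed (use f k in auto)
  have e1: "m1(rval (vl 6) m1 := rval (Cn 1) m1) = m1(L + 6 := 1)" using c by simp
  have e2: "(m1(L + 6 := 1))(rval (vl 7) (m1(L + 6 := 1)) := rval (Cn 0) (m1(L + 6 := 1))) = m1(L + 6 := 1, L + 7 := 0)"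
    using c L by simp
  show ?thesis
    unfolding SCALE_def loop_def[symmetric] fin_def[symmetric]
  proof (rule runs_Then, rule runs_St)
    show "rval (Cn 1) m1 < 2 ^ \<beta>" using one_less by simp
    show "runs \<beta> X (Then (St (vl 7) (Cn 0)) (Then loop fin)) (m1(rval (vl 6) m1 := rval (Cn 1) m1)) ?Q"
      unfolding e1
    proof (rule runs_Then, rule runs_St, simp)
      show "runs \<beta> X (Then loop fin) ((m1(L + 6 := 1))(rval (vl 7) (m1(L + 6 := 1)) := rval (Cn 0) (m1(L + 6 := 1)))) ?Q"
        unfolding e2 by (rule runs_Then, rule loop) (simp_all add: fr_def)
    qed
  qed
qed

lemma runs_PRE: "runs \<beta> X PRE m (\<lambda>m'. scal L G n W K N M m' \<and> (\<forall>a\<le>L. m' a = m a))"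
proof -
  have L3: "3 \<le> L" using size by simp
  have e: "m(rval (vl 8) m := rval (Ld (Cn 3)) m) = m(L + 8 := n)" using m0 m3 by simp
  show ?thesis
    unfolding PRE_def
  proof (rule runs_Then, rule runs_St)
    show "rval (Ld (Cn 3)) m < 2 ^ \<beta>" using m3 n by simp
    show "runs \<beta> X (Then COUNT (Then DENOM (Then FLAT SCALE))) (m(rval (vl 8) m := rval (Ld (Cn 3)) m))
      (\<lambda>m'. scal L G n W K N M m' \<and> (\<forall>a\<le>L. m' a = m a))"
      unfolding e
    proof (rule runs_Then, rule runs_mono[OF runs_COUNT])
      fix m1 assume q1: "m1 (L + 4) = length G \<and> (\<forall>a. a \<notin> {L + 2, L + 4} \<longrightarrow> m1 a = (m(L + 8 := n)) a)"
      have l1: "m1 a = m a" if "a \<le> L" for a using q1 that by simp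
      have s1: "m1 (L + 8) = n" "m1 (L + 4) = length G" using q1 by simp_all
      show "runs \<beta> X (Then DENOM (Then FLAT SCALE)) m1 (\<lambda>m'. scal L G n W K N M m' \<and> (\<forall>a\<le>L. m' a = m a))"
      proof (rule runs_Then, rule runs_mono[OF runs_DENOM[OF l1 s1]])
        fix m2 assume q2: "m2 (L + 5) = W \<and> (\<forall>a. a \<notin> {L + 5, L + 10} \<longrightarrow> m2 a = m1 a)"
        have l2: "m2 a = m a" if "a \<le> L" for a using q2 that l1[OF that] by simp
        have s2: "m2 (L + 5) = W" "m2 (L + 8) = n" using q2 s1 by simp_all
        show "runs \<beta> X (Then FLAT SCALE) m2 (\<lambda>m'. scal L G n W K N M m' \<and> (\<forall>a\<le>L. m' a = m a))"
        proof (rule runs_Then, rule runs_mono[OF runs_FLAT[OF l2 s2]])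
          fix m3 assume q3: "env L G m3 \<and> (\<forall>a. a \<notin> {L + 2, L + 3, L + 4, L + 9} \<and> a < L + 40 \<longrightarrow> m3 a = m2 a)"
          have l3: "m3 a = m a" if "a \<le> L" for a using q3 that l2[OF that] by simp
          have s3: "m3 (L + 5) = W" "m3 (L + 8) = n" using q3 s2 by simp_all
          show "runs \<beta> X SCALE m3 (\<lambda>m'. scal L G n W K N M m' \<and> (\<forall>a\<le>L. m' a = m a))"
          proof (rule runs_mono[OF runs_SCALE[OF conjunct1[OF q3] s3]])
            fix m4 assume q4: "scal L G n W K N M m4 \<and> (\<forall>a. a \<notin> {L + 6, L + 7, L + 17, L + 18} \<longrightarrow> m4 a = m3 a)"
            then show "scal L G n W K N M m4 \<and> (\<forall>a\<le>L. m4 a = m a)" using l3 by simp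
          qed (use l3 L3 in auto)
        qed
      qed
    qed (simp_all)
  qed
qed

end

section \<open>The two algorithms\<close>

text \<open>The output is written over input cells from cell \<open>1\<close> on, which are no
  longer read once the table is built. Cell \<open>0\<close>, the base of all addresses, is
  overwritten only at the end of \<open>KEEP_PROG\<close>.\<close>

definition KEEP_LOOP :: rcom where
  "KEEP_LOOP = Then (TAIL (vr 2) (Plus (vr 11) (Cn 1)))
     (Cond (Times (le (Times (vr 6) (vr 15)) (vr 5)) (le (vr 17) (vr 8)))
        (Then (St (vl 23) (Plus (vr 23) (Cn 1))) (St (vr 23) (vr 2))) Nop)"

definition KEEP_PROG :: rcom where
  "KEEP_PROG = Then PRE (Then TOP (Then (St (vl 23) (Cn 0)) (Then (For 2 (vr 8) KEEP_LOOP)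
     (St (Cn 0) (vr 23)))))"

text \<open>The case distinction of \<open>stopN\<close> as arithmetic on \<open>0\<close> and
  \<open>1\<close>; strict inequalities become weak ones by adding \<open>1\<close>.\<close>

definition ANSWER :: rexp where
  "ANSWER = Times (le (Cn 1) (vr 24)) (Plus
     (Times (Times (le (vr 24) (vr 18)) (le (Times (vr 6) (vr 15)) (vr 5)))
        (le (Plus (vr 19) (Cn 1)) (Times (vr 27) (vr 20))))
     (Times (le (Plus (vr 18) (Cn 1)) (vr 24)) (le (vr 11) (vr 27))))"

text \<open>The history is not parsed: the last arrival occupies the last three input cells, and its
  position follows from the history length, which is stored behind the instance and the seed. For an
  empty history these cells hold other data, but then the first factor of \<open>ANSWER\<close> is
  \<open>0\<close>.\<close>

definition STOP_PROG :: rcom where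
  "STOP_PROG = Then PRE (Then TOP
     (Then (St (vl 24) (Ld (Plus (Plus (Cn 5) (vr 8)) (Times (Cn 4) (vr 4)))))
     (Then (St (vl 26) (Minus (vr 18) (vr 24))) (Then DP
     (Then (St (vl 27) (Times (Ld (Minus bs (Cn 1))) (Quot (vr 5) (Ld bs))))
     (Then (St (vl 28) (Ld (Minus bs (Cn 2))))
     (Then (TAIL (vr 28) (Plus (vr 11) (Cn 1)))
     (Then (St (Cn 1) ANSWER) (St (Cn 0) (Cn 1))))))))))"

text \<open>\<open>h\<close> counts the current arrival, whose position is \<open>h - 1\<close>, so
  its threshold is the one after \<open>M - h\<close> backward steps. The value carries the factor
  \<open>W\<close>, the threshold the factor \<open>W * (M * W) ^ (M - h)\<close>; hence the power
  next to \<open>v\<close>.\<close>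

definition stopN :: "table \<Rightarrow> nat \<Rightarrow> nat \<Rightarrow> nat \<Rightarrow> nat \<Rightarrow> nat \<Rightarrow> nat \<Rightarrow> nat \<Rightarrow> bool" where
  "stopN G W K T M h i v \<longleftrightarrow> 1 \<le> h \<and> (if h \<le> M
     then keepN G W K T i \<and> dpN G W K T M (M - h) < v * (M * W) ^ (M - h) else T \<le> v)"

context parsed
begin

abbreviation kept :: "nat \<Rightarrow> bool" where
  "kept i \<equiv> keepN G W K T i \<and> N \<le> n"

lemma runs_KEEP_LOOP:
  assumes s: "scal L G n W K N M m1" and v: "m1 (L + 11) = T" "m1 (L + 2) = i" "m1 (L + 23) = c" and i: "i < n"
    and c: "c < n"
  shows "runs \<beta> X KEEP_LOOP m1 (\<lambda>m'. m' (L + 23) = (if kept i then Suc c else c) \<and>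
    (kept i \<longrightarrow> m' (Suc c) = i) \<and>
    (\<forall>a. a \<notin> {L + 14, L + 15, L + 23} \<and> (a \<noteq> Suc c \<or> \<not> kept i) \<longrightarrow> m' a = m1 a))"
    (is "runs _ _ _ _ ?Q")
  unfolding KEEP_LOOP_def
proof (rule runs_Then, rule runs_mono[OF runs_TAIL[OF scalD(1)[OF s] L F tot, where i = i and t = "T + 1"]])
  fix m2 assume q: "m2 (L + 15) = tailN G i (T + 1) \<and> (\<forall>a. a \<notin> {L + 14, L + 15} \<longrightarrow> m2 a = m1 a)"
  have s2: "scal L G n W K N M m2"
    by (rule scal_frame[OF s, where V = "{L + 14, L + 15}"]) (use q L in auto)
  note f = scalD[OF s2] envD(1)[OF scalD(1)[OF s2]]
  have nL: "n \<le> L" using size by simp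
  have m2: "m2 (L + 23) = c" "m2 (L + 2) = i" using q v by simp_all
  have cond: "rval (Times (le (Times (vr 6) (vr 15)) (vr 5)) (le (vr 17) (vr 8))) m2 = of_bool (kept i)"
    using f q by (auto simp: keepN_def)
  show "runs \<beta> X (Cond (Times (le (Times (vr 6) (vr 15)) (vr 5)) (le (vr 17) (vr 8)))
        (Then (St (vl 23) (Plus (vr 23) (Cn 1))) (St (vr 23) (vr 2))) Nop) m2 ?Q"
  proof (rule runs_Cond; unfold cond)
    assume "of_bool (kept i) \<noteq> (0 :: nat)"
    then have k: "kept i" by simp
    have e: "m2(rval (vl 23) m2 := rval (Plus (vr 23) (Cn 1)) m2) = m2(L + 23 := Suc c)"
      using f m2 by simp
    show "runs \<beta> X (Then (St (vl 23) (Plus (vr 23) (Cn 1))) (St (vr 23) (vr 2))) m2 ?Q"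
    proof (rule runs_Then, rule runs_St)
      show "rval (Plus (vr 23) (Cn 1)) m2 < 2 ^ \<beta>" using f m2 c n by simp
      show "runs \<beta> X (St (vr 23) (vr 2)) (m2(rval (vl 23) m2 := rval (Plus (vr 23) (Cn 1)) m2)) ?Q"
        unfolding e
      proof (rule runs_St)
        have e2: "(m2(L + 23 := Suc c))(rval (vr 23) (m2(L + 23 := Suc c)) := rval (vr 2) (m2(L + 23 := Suc c)))
          = m2(L + 23 := Suc c, Suc c := i)" using f m2 L by simp
        have Q: "?Q (m2(L + 23 := Suc c, Suc c := i))" using k q c nL by simp
        show "rval (vr 2) (m2(L + 23 := Suc c)) < 2 ^ \<beta>" using f m2 L i n by simp
        show "?Q ((m2(L + 23 := Suc c))(rval (vr 23) (m2(L + 23 := Suc c)) := rval (vr 2) (m2(L + 23 := Suc c))))"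
          unfolding e2 by (rule Q)
      qed
    qed
  next
    assume "of_bool (kept i) = (0 :: nat)"
    then have k: "\<not> kept i" by simp
    have Q: "?Q m2"
    proof (intro conjI allI)
      show "m2 (L + 23) = (if kept i then Suc c else c)" using m2(1) by (simp only: k if_False)
      show "kept i \<longrightarrow> m2 (Suc c) = i" using k by (rule notE[THEN impI])
    next
      fix a
      have "a \<notin> {L + 14, L + 15} \<Longrightarrow> m2 a = m1 a" using spec[OF conjunct2[OF q], of a] by (rule mp)
      then show "a \<notin> {L + 14, L + 15, L + 23} \<and> (a \<noteq> Suc c \<or> \<not> kept i) \<longrightarrow> m2 a = m1 a" by fast
    qed
    show "runs \<beta> X Nop m2 ?Q" by (rule runs_Nop, rule Q)
  qed
next
  fix m2 :: mem assume f: "\<And>a. a \<notin> {L + 14, L + 15} \<Longrightarrow> m2 a = m1 a"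
  have "m2 0 = L" "m2 (L + 2) = i" "m2 (L + 11) = T"
    using f[of 0] f[of "L + 2"] f[of "L + 11"] v envD(1)[OF scalD(1)[OF s]] L by auto
  then show "rval (vr 2) m2 = i" "rval (Plus (vr 11) (Cn 1)) m2 = T + 1" by simp_all
qed

lemma runs_KEEP_PROG:
  "runs \<beta> X KEEP_PROG m (\<lambda>m'. out_list m' = filter kept [0..<n])"
proof -
  define lst where "lst = (\<lambda>j. filter kept [0..<j])"
  have lst_Suc: "lst (Suc j) = (if kept j then lst j @ [j] else lst j)" for j by (simp add: lst_def)
  have lst_len: "length (lst j) \<le> j" for j unfolding lst_def by (rule order_trans[OF length_filter_le]) simp
  have nL: "n \<le> L" using size by simp
  define Inv where "Inv = (\<lambda>j m'. scal L G n W K N M m' \<and> m' (L + 11) = T \<and> m' (L + 23) = length (lst j) \<and>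
    (\<forall>c<length (lst j). m' (Suc c) = lst j ! c))"
  have Inv_upd: "Inv j (m'(L + 2 := x))" if "Inv j m'" "j \<le> n" for j m' x
  proof -
    have "scal L G n W K N M (m'(L + 2 := x))"
      by (rule scal_frame[where V = "{L + 2}" and m = m']) (use that L in \<open>auto simp: Inv_def\<close>)
    moreover have "(m'(L + 2 := x)) (Suc c) = m' (Suc c)" if "c < length (lst j)" for c
      using that lst_len[of j] nL \<open>j \<le> n\<close> by simp
    ultimately show ?thesis using that by (simp add: Inv_def)
  qed
  show ?thesis
    unfolding KEEP_PROG_def
  proof (rule runs_Then, rule runs_mono[OF runs_PRE])
    fix m1 assume q1: "scal L G n W K N M m1 \<and> (\<forall>a\<le>L. m1 a = m a)"
    show "runs \<beta> X (Then TOP (Then (St (vl 23) (Cn 0)) (Then (For 2 (vr 8) KEEP_LOOP)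
     (St (Cn 0) (vr 23))))) m1 (\<lambda>m'. out_list m' = filter kept [0..<n])"
    proof (rule runs_Then, rule runs_mono[OF runs_TOP[OF conjunct1[OF q1] val]])
      fix m2 assume q2: "m2 (L + 11) = T \<and>
        (\<forall>a. a \<notin> {L + 11, L + 12, L + 13, L + 14, L + 15, L + 16, L + 25} \<longrightarrow> m2 a = m1 a)"
      have "scal L G n W K N M m2"
        by (rule scal_frame[OF conjunct1[OF q1], where V = "{L + 11, L + 12, L + 13, L + 14, L + 15, L + 16, L + 25}"])
           (use q2 L in auto)
      then have "scal L G n W K N M (m2(L + 23 := 0))"
        by (rule scal_frame[where V = "{L + 23}"]) (use L in auto)
      then have I0: "Inv 0 (m2(L + 23 := 0))" using q2 by (simp add: Inv_def lst_def)
      note f2 = envD(1)[OF scalD(1)[OF \<open>scal L G n W K N M m2\<close>]]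
      have e: "m2(rval (vl 23) m2 := rval (Cn 0) m2) = m2(L + 23 := 0)" using f2 by simp
      show "runs \<beta> X (Then (St (vl 23) (Cn 0)) (Then (For 2 (vr 8) KEEP_LOOP) (St (Cn 0) (vr 23)))) m2
        (\<lambda>m'. out_list m' = filter kept [0..<n])"
      proof (rule runs_Then, rule runs_St, simp, unfold e, rule runs_Then, rule runs_For[where L = L and N = n and I = Inv])
        fix j m' assume "Inv j m'"
        then show "m' 0 = L \<and> rval (vr 8) m' = n"
          using scalD(2)[of L G n W K N M m'] envD(1)[OF scalD(1)[of L G n W K N M m']] by (simp add: Inv_def)
      next
        fix j m' assume j: "j < n" and I: "Inv j m'" and v: "m' (L + 2) = j"
        have I': "scal L G n W K N M m'" "m' (L + 11) = T" "m' (L + 23) = length (lst j)" using I by (auto simp: Inv_def)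
        have c: "length (lst j) < n" using lst_len[of j] j by simp
        show "runs \<beta> X KEEP_LOOP m' (\<lambda>m'. m' 0 = L \<and> m' (L + 2) = j \<and> Inv (Suc j) (m'(L + 2 := Suc j)))"
        proof (rule runs_mono[OF runs_KEEP_LOOP[OF I'(1,2) v I'(3) j c]])
          fix m3 assume q: "m3 (L + 23) = (if kept j then Suc (length (lst j)) else length (lst j)) \<and>
            (kept j \<longrightarrow> m3 (Suc (length (lst j))) = j) \<and>
            (\<forall>a. a \<notin> {L + 14, L + 15, L + 23} \<and> (a \<noteq> Suc (length (lst j)) \<or> \<not> kept j) \<longrightarrow> m3 a = m' a)"
          have s3: "scal L G n W K N M m3"
            by (rule scal_frame[OF I'(1), where V = "{L + 14, L + 15, L + 23, Suc (length (lst j))}"])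
               (use q L c nL in auto)
          have "m3 (Suc c') = lst (Suc j) ! c'" if "c' < length (lst (Suc j))" for c'
          proof (cases "c' = length (lst j)")
            case True
            then show ?thesis using q that by (auto simp: lst_Suc nth_append split: if_splits)
          next
            case False
            then have c': "c' < length (lst j)" using that by (auto simp: lst_Suc split: if_splits)
            then have "m3 (Suc c') = m' (Suc c')" using q c nL by simp
            with c' I show ?thesis by (simp add: Inv_def lst_Suc nth_append)
          qed
          moreover have "m3 (L + 11) = T" "m3 (L + 2) = j" using q I' v c nL by simp_all
          ultimately have "Inv (Suc j) m3" using s3 q by (simp add: Inv_def lst_Suc)
          then show "m3 0 = L \<and> m3 (L + 2) = j \<and> Inv (Suc j) (m3(L + 2 := Suc j))"
            using Inv_upd[of "Suc j"] j envD(1)[OF scalD(1)[OF s3]] \<open>m3 (L + 2) = j\<close> by simp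
        qed
      next
        fix m' assume I: "Inv n m'"
        then have f: "m' 0 = L" using envD(1)[OF scalD(1)[of L G n W K N M m']] by (simp add: Inv_def)
        show "runs \<beta> X (St (Cn 0) (vr 23)) m' (\<lambda>m'. out_list m' = filter kept [0..<n])"
        proof (rule runs_St)
          show "rval (vr 23) m' < 2 ^ \<beta>" using I f lst_len[of n] n by (simp add: Inv_def)
          have "m'(rval (Cn 0) m' := rval (vr 23) m') = m'(0 := length (lst n))" using I f by (simp add: Inv_def)
          moreover have "out_list (m'(0 := length (lst n))) = lst n"
            unfolding out_list_def by (rule nth_equalityI) (use I in \<open>auto simp: Inv_def nth_append simp del: upt_Suc\<close>)
          ultimately show "out_list (m'(rval (Cn 0) m' := rval (vr 23) m')) = filter kept [0..<n]"
            by (simp add: lst_def)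
        qed
      qed (use I0 Inv_upd f2 n L in auto)
    qed
  qed
qed

lemma runs_STOP_PROG:
  assumes h: "m (5 + n + 4 * length G) = h" "5 + n + 4 * length G \<le> L"
    and v: "m (L - 2) = i" "m (L - 1) * (W div m L) = v" "v < 2 ^ \<beta>"
    and b: "\<And>r. r \<le> M \<Longrightarrow> dpN G W K T M r < 2 ^ \<beta>" "\<And>r. r \<le> M \<Longrightarrow> (M * W) ^ r < 2 ^ \<beta>"
  shows "runs \<beta> X STOP_PROG m (\<lambda>m'. out_list m' = [of_bool (stopN G W K T M h i v)])"
proof -
  let ?Q = "\<lambda>m'. out_list m' = [of_bool (stopN G W K T M h i v)]"
  let ?R = "M - h"
  \<comment> \<open>The suffixes of the program are verified from the last to the first;
    \<open>st\<close> is what they all preserve.\<close>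
  define c6 where "c6 = Then (St (Cn 1) ANSWER) (St (Cn 0) (Cn 1))"
  define c5 where "c5 = Then (TAIL (vr 28) (Plus (vr 11) (Cn 1))) c6"
  define c4 where "c4 = Then (St (vl 27) (Times (Ld (Minus bs (Cn 1))) (Quot (vr 5) (Ld bs))))
     (Then (St (vl 28) (Ld (Minus bs (Cn 2)))) c5)"
  define c3 where "c3 = Then (St (vl 26) (Minus (vr 18) (vr 24))) (Then DP c4)"
  define c2 where "c2 = Then (St (vl 24) (Ld (Plus (Plus (Cn 5) (vr 8)) (Times (Cn 4) (vr 4))))) c3"
  define st where "st = (\<lambda>m'. scal L G n W K N M m' \<and> (\<forall>a\<le>L. m' a = m a) \<and> m' (L + 11) = T)"
  have st_frame: "st m''" if "st m'" "\<And>a. a \<notin> V \<Longrightarrow> m'' a = m' a" "V \<subseteq> {L + 12..L + 16} \<union> {L + 19..<L + 40}" for m' m'' V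
  proof -
    have "scal L G n W K N M m''"
      by (rule scal_frame[of _ _ _ _ _ _ _ m' V]) (use that L in \<open>auto simp: st_def dest!: subsetD[OF that(3)]\<close>)
    moreover have "m'' a = m' a" if "a \<le> L \<or> a = L + 11" for a
      using that \<open>V \<subseteq> _\<close> by (intro \<open>\<And>a. a \<notin> V \<Longrightarrow> m'' a = m' a\<close>) auto
    ultimately show ?thesis using that(1) by (simp add: st_def)
  qed
  have stD: "m' 0 = L" "m' (L + 4) = length G" "m' (L + 5) = W" "m' (L + 6) = K" "m' (L + 8) = n" "m' (L + 17) = N"
      "m' (L + 18) = M" "m' (L + 11) = T" "\<And>a. a \<le> L \<Longrightarrow> m' a = m a" if "st m'" for m'
    using that scalD[of L G n W K N M m'] envD[OF scalD(1)[of L G n W K N M m']] by (auto simp: st_def)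
  have L3: "3 \<le> L" using h by simp
  have Mb: "M \<le> X" "M < 2 ^ \<beta>" using M_le n by auto
  have r6: "runs \<beta> X c6 m' ?Q"
    if s: "st m'" "m' (L + 24) = h" "m' (L + 19) = dpN G W K T M ?R" "m' (L + 20) = (M * W) ^ ?R"
      "m' (L + 27) = v" "m' (L + 15) = tailN G i (T + 1)" for m'
  proof -
    have ans: "rval ANSWER m' = of_bool (stopN G W K T M h i v)"
      using stD[OF s(1)] s(2-) by (auto simp: ANSWER_def stopN_def keepN_def)
    show ?thesis
      unfolding c6_def
    proof (rule runs_Then, rule runs_St, unfold ans)
      show "of_bool (stopN G W K T M h i v) < (2 :: nat) ^ \<beta>" using one_less by auto
      show "runs \<beta> X (St (Cn 0) (Cn 1)) (m'(rval (Cn 1) m' := of_bool (stopN G W K T M h i v))) ?Q"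
        by (rule runs_St) (use one_less in \<open>auto simp: out_list_def\<close>)
    qed
  qed
  have r5: "runs \<beta> X c5 m' ?Q"
    if s: "st m'" "m' (L + 24) = h" "m' (L + 19) = dpN G W K T M ?R" "m' (L + 20) = (M * W) ^ ?R"
      "m' (L + 27) = v" "m' (L + 28) = i" for m'
    unfolding c5_def
  proof (rule runs_Then, rule runs_mono[OF runs_TAIL[of _ _ m', OF _ L F tot, where i = i and t = "T + 1"]])
    show "env L G m'" using s(1) scalD(1) by (auto simp: st_def)
  next
    fix m2 assume q: "m2 (L + 15) = tailN G i (T + 1) \<and> (\<forall>a. a \<notin> {L + 14, L + 15} \<longrightarrow> m2 a = m' a)"
    have "st m2" by (rule st_frame[OF s(1), where V = "{L + 14, L + 15}"]) (use q in auto)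
    then show "runs \<beta> X c6 m2 ?Q" by (rule r6) (use q s in simp_all)
  next
    fix m2 :: mem assume f: "\<And>a. a \<notin> {L + 14, L + 15} \<Longrightarrow> m2 a = m' a"
    have "m2 0 = L" "m2 (L + 28) = i" "m2 (L + 11) = T"
      using f[of 0] f[of "L + 28"] f[of "L + 11"] s stD(1,8)[OF s(1)] L by auto
    then show "rval (vr 28) m2 = i" "rval (Plus (vr 11) (Cn 1)) m2 = T + 1" by simp_all
  qed
  have r4: "runs \<beta> X c4 m' ?Q"
    if s: "st m'" "m' (L + 24) = h" "m' (L + 19) = dpN G W K T M ?R" "m' (L + 20) = (M * W) ^ ?R" for m'
  proof -
    note f = stD[OF s(1)]
    have e1: "m'(rval (vl 27) m' := rval (Times (Ld (Minus bs (Cn 1))) (Quot (vr 5) (Ld bs))) m') = m'(L + 27 := v)"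
      using f v by simp
    have e2: "(m'(L + 27 := v))(rval (vl 28) (m'(L + 27 := v)) := rval (Ld (Minus bs (Cn 2))) (m'(L + 27 := v)))
      = m'(L + 27 := v, L + 28 := i)"
    proof -
      have ne: "L - 2 \<noteq> L + 27" "L - 2 \<le> L" by arith+
      have x: "(m'(L + 27 := v)) (L - 2) = i"
        using f(9)[OF ne(2)] v(1) by (simp only: fun_upd_apply ne(1) if_False)
      have z: "(m'(L + 27 := v)) 0 = L" using f L by simp
      have r: "rval (Ld (Minus bs (Cn 2))) (m'(L + 27 := v)) = i"
        unfolding rval.simps z by (rule x)
      show ?thesis unfolding r using z by simp
    qed
    have "st (m'(L + 27 := v, L + 28 := i))"
      by (rule st_frame[OF s(1), where V = "{L + 27, L + 28}"]) auto
    then have r: "runs \<beta> X c5 (m'(L + 27 := v, L + 28 := i)) ?Q" by (rule r5) (use s in simp_all)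
    show ?thesis
      unfolding c4_def
    proof (rule runs_Then, rule runs_St)
      show "rval (Times (Ld (Minus bs (Cn 1))) (Quot (vr 5) (Ld bs))) m' < 2 ^ \<beta>" using f v by simp
      show "runs \<beta> X (Then (St (vl 28) (Ld (Minus bs (Cn 2)))) c5)
        (m'(rval (vl 27) m' := rval (Times (Ld (Minus bs (Cn 1))) (Quot (vr 5) (Ld bs))) m')) ?Q"
        unfolding e1
      proof (rule runs_Then, rule runs_St)
        assume "mem_bits \<beta> (m'(L + 27 := v))"
        then show "rval (Ld (Minus bs (Cn 2))) (m'(L + 27 := v)) < 2 ^ \<beta>" by (simp only: rval.simps mem_bits_def)
      qed (unfold e2, rule r)
    qed
  qed
  have r3: "runs \<beta> X c3 m' ?Q" if s: "st m'" "m' (L + 24) = h" for m'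
  proof -
    note f = stD[OF s(1)]
    have e: "m'(rval (vl 26) m' := rval (Minus (vr 18) (vr 24)) m') = m'(L + 26 := ?R)" using f s by simp
    have s2: "st (m'(L + 26 := ?R))" by (rule st_frame[OF s(1), where V = "{L + 26}"]) auto
    have sc: "scal L G n W K N M (m'(L + 26 := ?R))" using s2 by (simp add: st_def)
    have dp: "runs \<beta> X DP (m'(L + 26 := ?R)) (\<lambda>m''. m'' (L + 19) = dpN G W K T M ?R \<and> m'' (L + 20) = (M * W) ^ ?R \<and>
      (\<forall>a. a \<notin> {L + 12, L + 14, L + 15, L + 19, L + 20, L + 21, L + 22} \<longrightarrow> m'' a = (m'(L + 26 := ?R)) a))"
      by (rule runs_DP[OF sc]) (use f Mb b in auto)
    show ?thesis
      unfolding c3_def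
    proof (rule runs_Then, rule runs_St)
      show "rval (Minus (vr 18) (vr 24)) m' < 2 ^ \<beta>" using f s Mb by simp
      show "runs \<beta> X (Then DP c4) (m'(rval (vl 26) m' := rval (Minus (vr 18) (vr 24)) m')) ?Q"
        unfolding e
      proof (rule runs_Then, rule runs_mono[OF dp])
        fix m2 assume q: "m2 (L + 19) = dpN G W K T M ?R \<and> m2 (L + 20) = (M * W) ^ ?R \<and>
          (\<forall>a. a \<notin> {L + 12, L + 14, L + 15, L + 19, L + 20, L + 21, L + 22} \<longrightarrow> m2 a = (m'(L + 26 := ?R)) a)"
        have "st m2"
          by (rule st_frame[OF s2, where V = "{L + 12, L + 14, L + 15, L + 19, L + 20, L + 21, L + 22}"]) (use q in auto)
        then show "runs \<beta> X c4 m2 ?Q" by (rule r4) (use q s in simp_all)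
      qed
    qed
  qed
  have r2: "runs \<beta> X c2 m' ?Q" if s: "st m'" for m'
  proof -
    note f = stD[OF s]
    have e: "m'(rval (vl 24) m' := rval (Ld (Plus (Plus (Cn 5) (vr 8)) (Times (Cn 4) (vr 4)))) m') = m'(L + 24 := h)"
      using f h by simp
    have "st (m'(L + 24 := h))" by (rule st_frame[OF s, where V = "{L + 24}"]) auto
    then have r: "runs \<beta> X c3 (m'(L + 24 := h)) ?Q" by (rule r3) simp
    show ?thesis
      unfolding c2_def
    proof (rule runs_Then, rule runs_St)
      assume "mem_bits \<beta> m'"
      then show "rval (Ld (Plus (Plus (Cn 5) (vr 8)) (Times (Cn 4) (vr 4)))) m' < 2 ^ \<beta>"
        by (simp only: rval.simps mem_bits_def)
    qed (unfold e, rule r)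
  qed
  show ?thesis
    unfolding STOP_PROG_def c6_def[symmetric] c5_def[symmetric] c4_def[symmetric] c3_def[symmetric] c2_def[symmetric]
  proof (rule runs_Then, rule runs_mono[OF runs_PRE])
    fix m1 assume q1: "scal L G n W K N M m1 \<and> (\<forall>a\<le>L. m1 a = m a)"
    show "runs \<beta> X (Then TOP c2) m1 ?Q"
    proof (rule runs_Then, rule runs_mono[OF runs_TOP[OF conjunct1[OF q1] val]])
      fix m2 assume q2: "m2 (L + 11) = T \<and>
        (\<forall>a. a \<notin> {L + 11, L + 12, L + 13, L + 14, L + 15, L + 16, L + 25} \<longrightarrow> m2 a = m1 a)"
      have "scal L G n W K N M m2"
        by (rule scal_frame[OF conjunct1[OF q1], where V = "{L + 11, L + 12, L + 13, L + 14, L + 15, L + 16, L + 25}"])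
           (use q2 L in auto)
      then have "st m2" using q1 q2 by (simp add: st_def)
      then show "runs \<beta> X c2 m2 ?Q" by (rule r2)
    qed
  qed
qed

end

section \<open>Correctness of the integer data\<close>

definition num :: "rat \<Rightarrow> nat" where "num r = nat (fst (quotient_of r))"
definition den :: "rat \<Rightarrow> nat" where "den r = nat (snd (quotient_of r))"

definition scaled :: "nat \<Rightarrow> rat \<Rightarrow> nat" where
  "scaled W r = num r * (W div den r)"

definition flat :: "instance_data \<Rightarrow> (nat \<times> rat \<times> rat) list" where
  "flat E = concat (map (\<lambda>i. map (Pair i) (E ! i)) [0..<length E])"

definition tab :: "nat \<Rightarrow> instance_data \<Rightarrow> table" where
  "tab W E = map (\<lambda>(i, v, p). (i, scaled W v, scaled W p)) (flat E)"

lemma den_pos: "0 < den r"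
  using quotient_of_denom_pos[of r "fst (quotient_of r)" "snd (quotient_of r)"] by (simp add: den_def)

lemma real_of_rat_num_den:
  assumes "0 \<le> r"
  shows "real_of_rat r = real (num r) / real (den r)"
proof -
  obtain a b where ab: "quotient_of r = (a, b)" by (cases "quotient_of r") auto
  have r: "r = of_int a / of_int b" by (rule quotient_of_div[OF ab])
  have b: "0 < b" by (rule quotient_of_denom_pos[OF ab])
  have "0 \<le> a" using assms b unfolding r by (simp add: zero_le_divide_iff)
  then show ?thesis using b ab unfolding num_def den_def r by (simp add: of_rat_divide)
qed

lemma scaled_eq:
  assumes "0 \<le> r" "den r dvd W"
  shows "real (scaled W r) = real_of_rat r * real W"
  using assms(2) den_pos[of r] unfolding scaled_def real_of_rat_num_den[OF assms(1)]
  by (auto elim!: dvdE)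

lemma sum_list_map_concat:
  "sum_list (map g (concat xss)) = (\<Sum>xs\<leftarrow>xss. sum_list (map g xs))"
  by (induction xss) simp_all

locale scaled_instance =
  fixes E :: instance_data and W :: nat
  assumes valid: "valid_instance E" and W: "0 < W"
    and dens: "\<And>i v p. i < length E \<Longrightarrow> (v, p) \<in> set (E ! i) \<Longrightarrow> den v dvd W \<and> den p dvd W"
begin

abbreviation "G \<equiv> tab W E"
abbreviation "n \<equiv> length E"

lemma validD:
  assumes "i < n"
  shows "pmf_of_list_wf (map (map_prod real_of_rat real_of_rat) (E ! i))"
    and "(v, p) \<in> set (E ! i) \<Longrightarrow> 0 \<le> v" "(v, p) \<in> set (E ! i) \<Longrightarrow> 0 \<le> p"
proof -
  have E: "E ! i \<in> set E" using assms by simp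
  show wf: "pmf_of_list_wf (map (map_prod real_of_rat real_of_rat) (E ! i))"
    using valid E by (auto simp: valid_instance_def)
  show "(v, p) \<in> set (E ! i) \<Longrightarrow> 0 \<le> v" using valid E by (auto simp: valid_instance_def)
  assume "(v, p) \<in> set (E ! i)"
  then have "real_of_rat p \<in> set (map snd (map (map_prod real_of_rat real_of_rat) (E ! i)))"
    by (force simp: image_iff)
  with wf show "0 \<le> p" by (auto simp: pmf_of_list_wf_def simp del: set_map)
qed

lemma scaled_val:
  assumes "i < n" "(v, p) \<in> set (E ! i)"
  shows "real (scaled W v) = real_of_rat v * W" "real (scaled W p) = real_of_rat p * W"
  using scaled_eq[OF validD(2)[OF assms]] scaled_eq[OF validD(3)[OF assms]] dens[OF assms] by simp_all

lemma sum_tab: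
  fixes f :: "nat \<Rightarrow> nat \<Rightarrow> nat \<Rightarrow> real"
  shows "(\<Sum>e<length G. f (own G e) (val G e) (wgt G e))
    = (\<Sum>i<n. \<Sum>(v, p)\<leftarrow>E ! i. f i (scaled W v) (scaled W p))"
proof -
  have "(\<Sum>e<length G. f (own G e) (val G e) (wgt G e)) = (\<Sum>x\<leftarrow>G. f (fst x) (fst (snd x)) (snd (snd x)))"
    by (simp add: sum_list_sum_nth atLeast0LessThan)
  also have "\<dots> = (\<Sum>i\<leftarrow>[0..<n]. \<Sum>(v, p)\<leftarrow>E ! i. f i (scaled W v) (scaled W p))"
    unfolding tab_def flat_def map_map sum_list_map_concat by (simp add: comp_def case_prod_unfold)
  also have "\<dots> = (\<Sum>i<n. \<Sum>(v, p)\<leftarrow>E ! i. f i (scaled W v) (scaled W p))"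
    by (simp add: interv_sum_list_conv_sum_set_nat atLeast0LessThan)
  finally show ?thesis .
qed

lemma sum_tab_single:
  fixes f :: "nat \<Rightarrow> nat \<Rightarrow> real"
  assumes "i < n"
  shows "(\<Sum>e<length G. if own G e = i then f (val G e) (wgt G e) else 0)
    = (\<Sum>(v, p)\<leftarrow>E ! i. f (scaled W v) (scaled W p))"
proof -
  have "(\<Sum>e<length G. if own G e = i then f (val G e) (wgt G e) else 0)
    = (\<Sum>j<n. if j = i then (\<Sum>(v, p)\<leftarrow>E ! i. f (scaled W v) (scaled W p)) else 0)"
    unfolding sum_tab[of "\<lambda>j v p. if j = i then f v p else 0"]
    by (intro sum.cong refl) (auto simp: case_prod_unfold)
  then show ?thesis using assms by simp
qed

section \<open>Tails and expectations of explicitly given laws\<close>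

lemma measure_laws:
  assumes "i < n" "A \<in> sets borel"
  shows "measure (laws E i) A = (\<Sum>(v, p)\<leftarrow>E ! i. if real_of_rat v \<in> A then real_of_rat p else 0)"
proof -
  have "measure (laws E i) A = measure_pmf.prob (pmf_of_list (map (map_prod real_of_rat real_of_rat) (E ! i))) A"
    unfolding laws_def using assms(2) by (subst measure_distr) auto
  also have "\<dots> = (\<Sum>(v, p)\<leftarrow>E ! i. if real_of_rat v \<in> A then real_of_rat p else 0)"
    unfolding measure_pmf_of_list[OF validD(1)[OF assms(1)]] sum_list_map_filter'
    by (simp add: comp_def case_prod_unfold cong: if_cong)
  finally show ?thesis .
qed

lemma prob_space_laws: "prob_space (laws E i)"
  unfolding laws_def by (intro prob_space.prob_space_distr measure_pmf.prob_space_axioms) auto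

lemma sets_laws: "sets (laws E i) = sets borel"
  by (simp add: laws_def)

lemma tailN_eq:
  assumes "i < n"
  shows "real (tailN G i t) = (\<Sum>(v, p)\<leftarrow>E ! i. if t \<le> scaled W v then real_of_rat p else 0) * W"
proof -
  have "real (tailN G i t) = (\<Sum>e<length G. if own G e = i then (if t \<le> val G e then real (wgt G e) else 0) else 0)"
    unfolding tailN_def of_nat_sum by (intro sum.cong refl) auto
  also have "\<dots> = (\<Sum>(v, p)\<leftarrow>E ! i. if t \<le> scaled W v then real (scaled W p) else 0)"
    by (rule sum_tab_single[OF assms])
  also have "\<dots> = (\<Sum>(v, p)\<leftarrow>E ! i. (if t \<le> scaled W v then real_of_rat p else 0) * W)"
    using scaled_val(2)[OF assms] by (intro arg_cong[of _ _ sum_list] map_cong refl) auto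
  finally show ?thesis by (simp add: sum_list_mult_const case_prod_unfold)
qed

lemma tailN_tail_ge:
  assumes "i < n"
  shows "real (tailN G i t) = tail_ge (laws E i) (real t / W) * W"
proof -
  have "(real t / W \<le> real_of_rat v) = (t \<le> scaled W v)" if "(v, p) \<in> set (E ! i)" for v p
  proof -
    have "(real t / W \<le> real_of_rat v) = (real t \<le> real (scaled W v))"
      using W unfolding scaled_val(1)[OF assms that] by (simp add: pos_divide_le_eq)
    then show ?thesis by simp
  qed
  then have "(\<Sum>(v, p)\<leftarrow>E ! i. if t \<le> scaled W v then real_of_rat p else 0)
    = (\<Sum>(v, p)\<leftarrow>E ! i. if real_of_rat v \<in> {real t / W..} then real_of_rat p else 0)"
    by (intro arg_cong[of _ _ sum_list] map_cong refl) auto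
  then show ?thesis unfolding tailN_eq[OF assms] tail_ge_def by (simp only: measure_laws[OF assms] atLeast_borel)
qed

text \<open>Scaled values are integers, so exceeding \<open>t\<close> means reaching
  \<open>t + 1\<close>.\<close>

lemma tailN_tail_gt:
  assumes "i < n"
  shows "real (tailN G i (t + 1)) = tail_gt (laws E i) (real t / W) * W"
proof -
  have "(real t / W < real_of_rat v) = (t + 1 \<le> scaled W v)" if "(v, p) \<in> set (E ! i)" for v p
  proof -
    have "(real t / W < real_of_rat v) = (real t < real (scaled W v))"
      using W unfolding scaled_val(1)[OF assms that] by (simp add: pos_divide_less_eq)
    then show ?thesis by auto
  qed
  then have "(\<Sum>(v, p)\<leftarrow>E ! i. if t + 1 \<le> scaled W v then real_of_rat p else 0)
    = (\<Sum>(v, p)\<leftarrow>E ! i. if real_of_rat v \<in> {real t / W<..} then real_of_rat p else 0)"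
    by (intro arg_cong[of _ _ sum_list] map_cong refl) auto
  then show ?thesis unfolding tailN_eq[OF assms] tail_gt_def by (simp only: measure_laws[OF assms] greaterThan_borel)
qed

text \<open>The list may repeat a value, so the sum over the distinct values has to be regrouped
  into one over the entries.\<close>

lemma expectation_pmf_of_list:
  fixes f :: "real \<Rightarrow> real"
  assumes wf: "pmf_of_list_wf xs"
  shows "(\<integral>x. f x \<partial>measure_pmf (pmf_of_list xs)) = (\<Sum>(x, p)\<leftarrow>xs. p * f x)"
proof -
  define A where "A = set (map fst xs)"
  have A: "finite A" by (simp add: A_def)
  have "(\<integral>x. f x \<partial>measure_pmf (pmf_of_list xs)) = (\<Sum>x\<in>A. f x * pmf (pmf_of_list xs) x)"
    by (rule integral_measure_pmf_real[OF A]) (use set_pmf_of_list[OF wf] in \<open>auto simp: A_def\<close>)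
  also have "\<dots> = (\<Sum>x\<in>A. \<Sum>z\<leftarrow>xs. if fst z = x then snd z * f x else 0)"
  proof (intro sum.cong refl)
    fix x
    have "(\<Sum>z\<leftarrow>xs. if fst z = x then snd z * f x else 0) = (\<Sum>z\<leftarrow>xs. (if fst z = x then snd z else 0) * f x)"
      by (intro arg_cong[of _ _ sum_list] map_cong refl) auto
    also have "\<dots> = (\<Sum>z\<leftarrow>xs. if fst z = x then snd z else 0) * f x"
      by (rule sum_list_mult_const)
    also have "(\<Sum>z\<leftarrow>xs. if fst z = x then snd z else 0) = pmf (pmf_of_list xs) x"
      unfolding pmf_pmf_of_list[OF wf] sum_list_map_filter' ..
    finally show "f x * pmf (pmf_of_list xs) x = (\<Sum>z\<leftarrow>xs. if fst z = x then snd z * f x else 0)"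
      by simp
  qed
  also have "\<dots> = (\<Sum>z\<leftarrow>xs. \<Sum>x\<in>A. if fst z = x then snd z * f x else 0)"
    by (simp add: sum_list_sum_nth sum.swap[of _ A])
  also have "\<dots> = (\<Sum>z\<leftarrow>xs. snd z * f (fst z))"
    by (intro arg_cong[of _ _ sum_list] map_cong refl) (use A in \<open>auto simp: A_def\<close>)
  finally show ?thesis by (simp add: case_prod_unfold)
qed

text \<open>A truncation above all atoms is invisible; this is how the untruncated integer recursion
  matches the truncated dynamic program.\<close>

lemma excess_laws:
  assumes i: "i < n" and c: "\<And>v p. (v, p) \<in> set (E ! i) \<Longrightarrow> real_of_rat v \<le> c"
  shows "excess (laws E i) c u = (\<Sum>(v, p)\<leftarrow>E ! i. real_of_rat p * max 0 (real_of_rat v - u))"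
proof -
  have "excess (laws E i) c u
      = (\<integral>x. max 0 (min x c - u) \<partial>measure_pmf (pmf_of_list (map (map_prod real_of_rat real_of_rat) (E ! i))))"
    unfolding excess_def laws_def by (subst integral_distr) auto
  also have "\<dots> = (\<Sum>(x, p)\<leftarrow>map (map_prod real_of_rat real_of_rat) (E ! i). p * max 0 (min x c - u))"
    by (rule expectation_pmf_of_list[OF validD(1)[OF i]])
  also have "\<dots> = (\<Sum>(v, p)\<leftarrow>E ! i. real_of_rat p * max 0 (real_of_rat v - u))"
    by (auto simp: comp_def case_prod_unfold dest!: c intro!: arg_cong[of _ _ sum_list])
  finally show ?thesis .
qed

section \<open>The threshold and the removed variables in integers\<close>

lemma topN_cases:
  "j \<le> length G \<Longrightarrow> topN G W K n N j = 0 \<or>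
    (\<exists>e<length G. topN G W K n N j = val G e \<and> N \<le> cntN G W K n (val G e))"
proof (induction j)
  case (Suc j)
  show ?case
  proof (cases "N \<le> cntN G W K n (val G j) \<and> topN G W K n N j < val G j")
    case True
    then show ?thesis using Suc.prems by (intro disjI2 exI[of _ j]) auto
  next
    case False
    then have "topN G W K n N (Suc j) = topN G W K n N j" by auto
    with Suc show ?thesis by simp
  qed
qed simp

lemma topN_ge: "e < j \<Longrightarrow> N \<le> cntN G W K n (val G e) \<Longrightarrow> val G e \<le> topN G W K n N j"
proof (induction j)
  case (Suc j)
  then show ?case by (cases "e = j") (auto simp: less_Suc_eq)
qed simp

text \<open>Let \<open>t\<close> be the least table value above \<open>T\<close>. Tails beyond
  \<open>T\<close> are tails from \<open>t\<close> on, so if more than \<open>N\<close> variables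
  were removed, \<open>t\<close> would have been a candidate for the maximum
  \<open>T\<close>.\<close>

lemma card_removed:
  fixes K N :: nat
  defines "T \<equiv> topN G W K n N (length G)"
  shows "card {i. i < n \<and> \<not> keepN G W K T i} \<le> N"
proof (rule ccontr)
  define X where "X = {i. i < n \<and> \<not> keepN G W K T i}"
  assume "\<not> ?thesis"
  then have X: "N < card X" by (simp add: X_def)
  define V where "V = {val G e | e. e < length G \<and> T + 1 \<le> val G e}"
  have "finite V" unfolding V_def by simp
  have "X \<noteq> {}"
  proof
    assume "X = {}"
    with X show False by simp
  qed
  then obtain i where i: "i \<in> X" by blast
  then have "0 < tailN G i (T + 1)" by (simp add: X_def keepN_def) (metis mult_0_right neq0_conv not_le zero_le)
  then obtain e where e: "e < length G" "T + 1 \<le> val G e"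
  proof -
    have "\<exists>e<length G. T + 1 \<le> val G e"
    proof (rule ccontr)
      assume "\<not> ?thesis"
      then have "tailN G i (T + 1) = 0" unfolding tailN_def by (intro sum.neutral) auto
      with \<open>0 < tailN G i (T + 1)\<close> show False by simp
    qed
    with that show ?thesis by blast
  qed
  then have "V \<noteq> {}" by (auto simp: V_def)
  define t where "t = Min V"
  have t: "t \<in> V" unfolding t_def using \<open>finite V\<close> \<open>V \<noteq> {}\<close> by (rule Min_in)
  have t_le: "t \<le> val G e" if "e < length G" "T + 1 \<le> val G e" for e
    unfolding t_def using \<open>finite V\<close> that by (intro Min_le) (auto simp: V_def)
  have "(T + 1 \<le> val G e) = (t \<le> val G e)" if "e < length G" for e
    using t t_le[OF that] by (auto simp: V_def)
  then have tail: "tailN G i (T + 1) = tailN G i t" for i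
    unfolding tailN_def by (intro sum.cong refl) simp
  have "X \<subseteq> {i. i < n \<and> W \<le> K * tailN G i t}"
    unfolding X_def keepN_def tail by auto
  then have "card X \<le> card {i. i < n \<and> W \<le> K * tailN G i t}"
    by (intro card_mono) auto
  also have "\<dots> = cntN G W K n t"
    by (simp add: cntN_def Int_def lessThan_def conj_commute)
  finally have N: "N \<le> cntN G W K n t" using X by simp
  obtain e where e: "e < length G" "t = val G e" "T + 1 \<le> t" using t unfolding V_def by blast
  have "t \<le> T" using topN_ge[OF e(1), of N K] N unfolding T_def e(2) by simp
  with e(3) show False by simp
qed

text \<open>A \<open>T\<close> taken from the table has passed the count. If it is the initial
  \<open>0\<close>, every variable reaches it with probability one, and there are at least
  \<open>N\<close> of them.\<close>

lemma cntN_topN: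
  fixes K N :: nat
  defines "T \<equiv> topN G W K n N (length G)"
  assumes "0 < K" "N \<le> n"
  shows "N \<le> card {i. i < n \<and> 1 / K \<le> tail_ge (laws E i) (real T / W)}"
proof -
  have "N \<le> cntN G W K n T"
  proof (cases "T = 0")
    case True
    have "W \<le> K * tailN G i 0" if i: "i < n" for i
    proof -
      have "real (tailN G i 0) = (\<Sum>(v, p)\<leftarrow>E ! i. real_of_rat p) * W"
        unfolding tailN_eq[OF i] by simp
      also have "(\<Sum>(v, p)\<leftarrow>E ! i. real_of_rat p) = 1"
        using validD(1)[OF i] by (simp add: pmf_of_list_wf_def comp_def case_prod_unfold)
      finally have "tailN G i 0 = W" by simp
      then show ?thesis using \<open>0 < K\<close> by simp
    qed
    then have "cntN G W K n 0 = (\<Sum>i<n. 1)" unfolding cntN_def by (intro sum.cong refl) simp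
    then show ?thesis using True assms by simp
  next
    case False
    then show ?thesis using topN_cases[of "length G" K N] unfolding T_def by auto
  qed
  also have "cntN G W K n T = card {i. i < n \<and> W \<le> K * tailN G i T}"
    by (simp add: cntN_def Int_def lessThan_def conj_commute)
  also have "{i. i < n \<and> W \<le> K * tailN G i T} = {i. i < n \<and> 1 / K \<le> tail_ge (laws E i) (real T / W)}"
  proof (intro Collect_cong conj_cong refl)
    fix i assume i: "i < n"
    have "(W \<le> K * tailN G i T) = (real W \<le> real (K * tailN G i T))" by (rule of_nat_le_iff[symmetric])
    also have "\<dots> = (1 * real W \<le> (K * tail_ge (laws E i) (real T / W)) * W)"
      using tailN_tail_ge[OF i, of T] by (simp add: mult.assoc)
    also have "\<dots> = (1 / K \<le> tail_ge (laws E i) (real T / W))"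
      using W \<open>0 < K\<close> by (subst mult_le_cancel_right_pos) (auto simp: field_simps)
    finally show "(W \<le> K * tailN G i T) = (1 / K \<le> tail_ge (laws E i) (real T / W))" .
  qed
  finally show ?thesis .
qed

lemma keepN_iff:
  assumes "0 < K" "i < n"
  shows "keepN G W K T i \<longleftrightarrow> tail_gt (laws E i) (real T / W) \<le> 1 / K"
proof -
  have "keepN G W K T i = (real (K * tailN G i (T + 1)) \<le> real W)"
    unfolding keepN_def by (rule of_nat_le_iff[symmetric])
  also have "\<dots> = ((K * tail_gt (laws E i) (real T / W)) * W \<le> 1 * real W)"
    using tailN_tail_gt[OF assms(2), of T] by (simp add: mult.assoc)
  also have "\<dots> = (tail_gt (laws E i) (real T / W) \<le> 1 / K)"
    using W assms(1) by (subst mult_le_cancel_right_pos) (auto simp: field_simps)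
  finally show ?thesis .
qed

definition phi :: "nat set \<Rightarrow> nat \<Rightarrow> real \<Rightarrow> real \<Rightarrow> real" where
  "phi J M t z = (\<Sum>i\<in>J. \<Sum>(v, p)\<leftarrow>E ! i. real_of_rat p * max 0 (real_of_rat v - (t + z))) / M"

text \<open>Each step clears one denominator \<open>M\<close>, from the average, and one denominator
  \<open>W\<close>, from the probabilities. Subtraction of natural numbers is the positive part, so
  nothing is rounded.\<close>

lemma dpN_eq:
  assumes K: "0 < K" and M: "0 < M" and J: "J = {i. i < n \<and> keepN G W K T i}"
  shows "real (dpN G W K T M r) = real W * (real M * W) ^ r * (real T / W + dp_values (phi J M (real T / W)) r)"
proof (induction r)
  case (Suc r)
  define c where "c = real W * (real M * W) ^ r"
  define u where "u = real T / W + dp_values (phi J M (real T / W)) r"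
  have c: "0 < c" using W M by (simp add: c_def)
  have IH: "real (dpN G W K T M r) = c * u" using Suc by (simp add: c_def u_def)
  have summand: "real (of_bool (keepN G W K T i) * scaled W p * (scaled W v * (M * W) ^ r - dpN G W K T M r))
    = (if i \<in> J then c * W * (real_of_rat p * max 0 (real_of_rat v - u)) else 0)"
    if i: "i < n" and vp: "(v, p) \<in> set (E ! i)" for i v p
  proof -
    have "real (scaled W v * (M * W) ^ r - dpN G W K T M r) = max 0 (real (scaled W v * (M * W) ^ r) - real (dpN G W K T M r))"
      by (simp add: max_def of_nat_diff del: of_nat_mult of_nat_power)
    also have "\<dots> = max 0 (c * (real_of_rat v - u))"
      unfolding IH by (rule arg_cong[where f = "max 0"]) (simp add: scaled_val[OF i vp] c_def algebra_simps)
    also have "\<dots> = c * max 0 (real_of_rat v - u)"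
      using c by (simp add: max_def mult_le_0_iff zero_le_mult_iff)
    finally have *: "real (scaled W v * (M * W) ^ r - dpN G W K T M r) = c * max 0 (real_of_rat v - u)" .
    show ?thesis unfolding of_nat_mult * scaled_val(2)[OF i vp] using i by (simp add: J)
  qed
  have "real (\<Sum>e<length G. of_bool (keepN G W K T (own G e)) * wgt G e * (val G e * (M * W) ^ r - dpN G W K T M r))
    = (\<Sum>i<n. \<Sum>(v, p)\<leftarrow>E ! i. real (of_bool (keepN G W K T i) * scaled W p * (scaled W v * (M * W) ^ r - dpN G W K T M r)))"
    unfolding of_nat_sum by (rule sum_tab[of "\<lambda>i v p. real (of_bool (keepN G W K T i) * p * (v * (M * W) ^ r - dpN G W K T M r))"])
  also have "\<dots> = (\<Sum>i<n. if i \<in> J then c * W * (\<Sum>(v, p)\<leftarrow>E ! i. real_of_rat p * max 0 (real_of_rat v - u)) else 0)"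
  proof (intro sum.cong refl)
    fix i assume "i \<in> {..<n}"
    then have i: "i < n" by simp
    have "(\<Sum>(v, p)\<leftarrow>E ! i. real (of_bool (keepN G W K T i) * scaled W p * (scaled W v * (M * W) ^ r - dpN G W K T M r)))
      = (\<Sum>(v, p)\<leftarrow>E ! i. if i \<in> J then c * W * (real_of_rat p * max 0 (real_of_rat v - u)) else 0)"
      by (intro arg_cong[of _ _ sum_list] map_cong refl) (simp add: case_prod_unfold summand[OF i] del: of_nat_mult)
    then show "(\<Sum>(v, p)\<leftarrow>E ! i. real (of_bool (keepN G W K T i) * scaled W p * (scaled W v * (M * W) ^ r - dpN G W K T M r)))
      = (if i \<in> J then c * W * (\<Sum>(v, p)\<leftarrow>E ! i. real_of_rat p * max 0 (real_of_rat v - u)) else 0)"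
      by (simp add: case_prod_unfold sum_list_const_mult del: of_nat_mult)
  qed
  also have "\<dots> = (\<Sum>i\<in>J. c * W * (\<Sum>(v, p)\<leftarrow>E ! i. real_of_rat p * max 0 (real_of_rat v - u)))"
    unfolding J by (simp add: sum.If_cases Int_def lessThan_def conj_commute cong: if_cong)
  also have "\<dots> = c * W * (M * phi J M (real T / W) (dp_values (phi J M (real T / W)) r))"
  proof -
    have "M * phi J M (real T / W) z = (\<Sum>i\<in>J. \<Sum>(v, p)\<leftarrow>E ! i. real_of_rat p * max 0 (real_of_rat v - (real T / W + z)))" for z
      unfolding phi_def using M by simp
    then show ?thesis by (simp only: sum_distrib_left u_def)
  qed
  finally show ?case
    by (simp add: IH distrib_left) (simp add: c_def u_def algebra_simps)
qed (use W in simp)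

lemma reward_cong_support:
  assumes "\<And>h. h \<noteq> [] \<Longrightarrow> (\<forall>(i, y)\<in>set h. y \<in> S i) \<Longrightarrow> d1 h = d2 h"
  shows "(\<forall>(i, y)\<in>set h. y \<in> S i) \<Longrightarrow> (\<forall>(i, y)\<in>set xs. y \<in> S i) \<Longrightarrow> reward d1 h xs = reward d2 h xs"
proof (induction xs arbitrary: h)
  case (Cons a xs)
  have "d1 (h @ [a]) = d2 (h @ [a])" using Cons.prems by (intro assms) auto
  moreover have "reward d1 (h @ [a]) xs = reward d2 (h @ [a]) xs" using Cons.prems by (intro Cons.IH) auto
  ultimately show ?case by simp
qed simp

definition supp :: "nat \<Rightarrow> real set" where
  "supp i = real_of_rat ` fst ` set (E ! i)"

text \<open>A \<open>real_policy\<close> is meaningful at rational values only. Almost surely all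
  values lie in the supports, so agreement there suffices to compare it with a threshold policy on
  the reals.\<close>

lemma expected_reward_cong_support:
  fixes Q :: "'s measure"
  assumes "\<And>s h. h \<noteq> [] \<Longrightarrow> (\<forall>(i, y)\<in>set h. i < n \<and> y \<in> supp i) \<Longrightarrow> d1 s h = d2 s h"
  shows "expected_reward (laws E) {..<n} Q d1 = expected_reward (laws E) {..<n} Q d2"
  unfolding expected_reward_def
proof (rule nn_integral_cong_AE, unfold AE_measure_pmf_iff, rule ballI, rule nn_integral_cong)
  fix \<pi> s assume "\<pi> \<in> set_pmf (pmf_of_set (permutations_of_set {..<n}))"
  then have \<pi>: "set \<pi> = {..<n}" by (auto dest: permutations_of_setD)
  have 1: "AE y in laws E i. y \<in> supp i" if i: "i < n" for i
  proof -
    have "supp i \<in> sets borel" by (simp add: supp_def borel_closed finite_imp_closed)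
    then have "(AE y in laws E i. y \<in> supp i)
        = (AE y in measure_pmf (pmf_of_list (map (map_prod real_of_rat real_of_rat) (E ! i))). y \<in> supp i)"
      unfolding laws_def by (subst AE_distr_iff) auto
    then show ?thesis
      using set_pmf_of_list[OF validD(1)[OF i]] by (force simp: AE_measure_pmf_iff supp_def)
  qed
  have "AE x in (\<Pi>\<^sub>M i\<in>{..<n}. laws E i). \<forall>i\<in>{..<n}. x i \<in> supp i"
    by (intro AE_finite_allI AE_PiM_component prob_space_laws) (use 1 in auto)
  then show "(\<integral>\<^sup>+x. ennreal (reward (d1 s) [] (map (\<lambda>i. (i, x i)) \<pi>)) \<partial>(\<Pi>\<^sub>M i\<in>{..<n}. laws E i))
    = (\<integral>\<^sup>+x. ennreal (reward (d2 s) [] (map (\<lambda>i. (i, x i)) \<pi>)) \<partial>(\<Pi>\<^sub>M i\<in>{..<n}. laws E i))"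
  proof (intro nn_integral_cong_AE, eventually_elim)
    fix x assume x: "\<forall>i\<in>{..<n}. x i \<in> supp i"
    have "reward (d1 s) [] (map (\<lambda>i. (i, x i)) \<pi>) = reward (d2 s) [] (map (\<lambda>i. (i, x i)) \<pi>)"
      by (rule reward_cong_support[where S = "\<lambda>i. if i < n then supp i else {}"])
         (use x \<pi> in \<open>auto intro!: assms split: if_splits\<close>)
    then show "ennreal (reward (d1 s) [] (map (\<lambda>i. (i, x i)) \<pi>)) = ennreal (reward (d2 s) [] (map (\<lambda>i. (i, x i)) \<pi>))"
      by simp
  qed
qed

text \<open>The cases are those for arbitrary laws, with the tabulated \<open>T\<close>. Finite
  support lets one policy serve all truncations from \<open>b0\<close> on, so that an explicit
  policy, not only the supremum, attains the bound.\<close>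

theorem algorithm_guarantee:
  fixes \<epsilon> :: real and k :: nat and Q :: "'s measure"
  assumes \<epsilon>: "0 < \<epsilon>" and k: "1 < 2 ^ k * (4 * \<epsilon>)" "k = 0 \<or> 2 ^ (k - 1) * (4 * \<epsilon>) \<le> 1"
    and K: "K = 2 ^ k" and N: "N = 2 * k * K * K" and M: "M = (n - 1) * (K - 1) div K"
    and T: "T = topN G W K n N (length G)"
    and J: "J = {i. i < n \<and> keepN G W K T i \<and> N \<le> n}"
    and Q: "prob_space Q"
    and d: "\<And>s h i v. h \<noteq> [] \<Longrightarrow> \<forall>(i, y)\<in>set h. i < n \<and> y \<in> supp i \<Longrightarrow> last h = (i, real_of_rat v) \<Longrightarrow>
      v \<in> fst ` set (E ! i) \<Longrightarrow> d s h = stopN G W K T M (length h) i (scaled W v)"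
  shows "real (card ({..<n} - J)) \<le> removal_bound 1 \<epsilon>"
    and "ennreal (kertz - 20 * \<epsilon>) * EMAX (laws E) J \<le> expected_reward (laws E) {..<n} Q d"
proof -
  note params = removal_params[OF \<epsilon> k]
  have N': "N = 2 * k * K\<^sup>2" by (simp add: N power2_eq_square)
  have N_le: "real N \<le> removal_bound 1 \<epsilon>" using params(1) by (simp add: N' K)
  have K0: "0 < K" by (simp add: K)
  have "card ({..<n} - J) \<le> N"
  proof (cases "N \<le> n")
    case True
    then have "{..<n} - J = {i. i < n \<and> \<not> keepN G W K T i}" by (auto simp: J)
    then show ?thesis using card_removed[of K N] by (simp add: T)
  next
    case False
    have "card ({..<n} - J) \<le> card {..<n}" by (intro card_mono) auto
    with False show ?thesis by simp
  qed
  with N_le show "real (card ({..<n} - J)) \<le> removal_bound 1 \<epsilon>" by linarith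
  consider "k < 2" | "n < N" | "2 \<le> k" "N \<le> n" by linarith
  then show "ennreal (kertz - 20 * \<epsilon>) * EMAX (laws E) J \<le> expected_reward (laws E) {..<n} Q d"
  proof cases
    case 1
    then have "(2 :: real) ^ k \<le> 2 ^ 1" by (intro power_increasing) auto
    then have "5 / 2 \<le> 5 / (2 :: real) ^ k" by (intro divide_left_mono) auto
    then have "kertz - 20 * \<epsilon> < 0" using kertz_works params(2) by linarith
    then have "ennreal (kertz - 20 * \<epsilon>) = 0" by (intro ennreal_neg) simp
    then show ?thesis by simp
  next
    case 2
    then have "J = {}" by (auto simp: J)
    then show ?thesis by simp
  next
    case 3
    define t where "t = real T / W"
    have t: "0 \<le> t" by (simp add: t_def)
    have J': "J = {i. i < n \<and> tail_gt (laws E i) t \<le> 1 / K}"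
      using 3 keepN_iff[OF K0] by (auto simp: J t_def)
    have Jk: "J = {i. i < n \<and> keepN G W K T i}" using 3 by (auto simp: J)
    have R: "N \<le> card {i. i < n \<and> 1 / K \<le> tail_ge (laws E i) t}"
      using cntN_topN[OF K0 3(2)] by (simp add: t_def T)
    have M0: "0 < M"
    proof -
      have K4: "4 \<le> K" using power_increasing[of 2 k "2 :: nat"] 3(1) K by simp
      have "2 * 2 * 4 * 4 \<le> N" unfolding N using 3(1) K4 by (intro mult_le_mono) auto
      then have n: "64 \<le> n" using 3 by simp
      have "1 * K \<le> (n - 1) * (K - 1)"
      proof -
        have "K \<le> 2 * (K - 1)" using K4 by simp
        also have "\<dots> \<le> (n - 1) * (K - 1)" using n by (intro mult_le_mono1) simp
        finally show ?thesis by simp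
      qed
      then show ?thesis unfolding M using K0 by (simp add: div_greater_zero_iff)
    qed
    define Z where "Z = (\<lambda>m. dp_values (phi J M t) (M - m))"
    define acc where "acc = dp_acc M J t (\<lambda>m. t + Z (Suc m))"
    \<comment> \<open>At least \<open>t\<close> and every atom, so that the excesses do not change
      with \<open>b\<close> and \<open>b - t\<close> is nonnegative.\<close>
    define b0 where "b0 = Max (insert t (\<Union>i<n. supp i))"
    have fin: "finite (insert t (\<Union>i<n. supp i))" by (auto simp: supp_def)
    have tb: "t \<le> b0" unfolding b0_def by (intro Max_ge fin) simp
    have vb: "real_of_rat v \<le> b0" if "i < n" "(v, p) \<in> set (E ! i)" for i v p
      unfolding b0_def using that by (intro Max_ge fin) (force simp: supp_def)
    have le: "ennreal (kertz - 5 / K) * EMAXB b (laws E) J \<le> expected_reward (laws E) {..<n} Q (\<lambda>_. pos_policy acc)"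
      if b: "b0 \<le> b" for b
    proof -
      have "ennreal (kertz - 5 / K) * EMAXB (t + (b - t)) (laws E) J \<le>
          expected_reward (laws E) {..<n} Q (\<lambda>_. pos_policy acc)"
        unfolding acc_def
      proof (rule dp_policy_guarantee[OF prob_space_laws sets_laws K 3(1) N' 3(2) t _ R J' M])
        show "Z M = 0" by (simp add: Z_def)
        fix m assume m: "m < M"
        have "(\<Sum>i\<in>J. excess (laws E i) (t + (b - t)) (t + Z (Suc m))) / M = phi J M t (Z (Suc m))"
          unfolding phi_def
        proof (intro arg_cong2[of _ _ _ _ "(/)"] sum.cong refl)
          fix i assume "i \<in> J"
          then have "i < n" by (simp add: J)
          then show "excess (laws E i) (t + (b - t)) (t + Z (Suc m))
            = (\<Sum>(v, p)\<leftarrow>E ! i. real_of_rat p * max 0 (real_of_rat v - (t + Z (Suc m))))"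
            using vb b by (intro excess_laws) (auto intro: order_trans)
        qed
        moreover have "M - m = Suc (M - Suc m)" using m by simp
        ultimately show "Z m = Z (Suc m) + (\<Sum>i\<in>J. excess (laws E i) (t + (b - t)) (t + Z (Suc m))) / M"
          by (simp add: Z_def)
      qed (use b tb Q in auto)
      then show ?thesis by simp
    qed
    have "ennreal (kertz - 5 / K) * EMAX (laws E) J \<le> expected_reward (laws E) {..<n} Q (\<lambda>_. pos_policy acc)"
      by (rule EMAX_le_if_EMAXB_le[OF sets_laws _ le]) (simp_all add: J)
    also have "expected_reward (laws E) {..<n} Q (\<lambda>_. pos_policy acc) = expected_reward (laws E) {..<n} Q d"
    proof (rule expected_reward_cong_support)
      fix s :: 's and h :: "real history" assume h: "h \<noteq> []" "\<forall>(i, y)\<in>set h. i < n \<and> y \<in> supp i"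
      obtain i y where iy: "last h = (i, y)" by (cases "last h")
      then have "(i, y) \<in> set h" using h(1) last_in_set by metis
      then have i: "i < n" and "y \<in> supp i" using h(2) by auto
      then obtain v p where v: "(v, p) \<in> set (E ! i)" "y = real_of_rat v" by (auto simp: supp_def)
      have dh: "d s h = stopN G W K T M (length h) i (scaled W v)"
        by (rule d[OF h]) (use iy v in \<open>auto simp: image_iff intro!: bexI[of _ "(v, p)"]\<close>)
      have sv: "real (scaled W v) = real_of_rat v * W" using scaled_val(1)[OF i v(1)] .
      have len: "1 \<le> length h" using h(1) by (cases h) auto
      show "pos_policy acc h = d s h"
      proof (cases "length h \<le> M")
        case True
        then have m: "length h - 1 < M" "Suc (length h - 1) = length h" using len by auto
        let ?r = "M - length h"
        have c: "0 < real W * (real M * W) ^ ?r" using W M0 by simp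
        have "(dpN G W K T M ?r < scaled W v * (M * W) ^ ?r)
            = (real (dpN G W K T M ?r) < real (scaled W v * (M * W) ^ ?r))" by (rule of_nat_less_iff[symmetric])
        also have "\<dots> = (real W * (real M * W) ^ ?r * (t + Z (length h)) < real W * (real M * W) ^ ?r * real_of_rat v)"
          unfolding dpN_eq[OF K0 M0 Jk] by (simp add: sv Z_def t_def mult_ac)
        also have "\<dots> = (t + Z (length h) < y)" using mult_less_cancel_left_pos[OF c] v(2) by simp
        finally have "(dpN G W K T M ?r < scaled W v * (M * W) ^ ?r) = (t + Z (length h) < y)" .
        then show ?thesis
          unfolding dh using m(1) h(1) i iy by (simp add: True m(2) Suc_le_eq pos_policy_def acc_def dp_acc_def stopN_def Jk)
      next
        case False
        have "(T \<le> scaled W v) = (real T \<le> real (scaled W v))" by simp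
        also have "\<dots> = (t \<le> y)" unfolding sv t_def using W v(2) by (simp add: pos_divide_le_eq)
        finally have "(T \<le> scaled W v) = (t \<le> y)" .
        moreover have "\<not> length h - 1 < M" using False len by simp
        ultimately show ?thesis
          unfolding dh using False h(1) iy by (simp add: pos_policy_def acc_def dp_acc_def stopN_def)
      qed
    qed
    finally have "ennreal (kertz - 5 / K) * EMAX (laws E) J \<le> expected_reward (laws E) {..<n} Q d" .
    moreover have "ennreal (kertz - 20 * \<epsilon>) \<le> ennreal (kertz - 5 / K)"
      using params(2) by (intro ennreal_leI) (simp add: K)
    ultimately show ?thesis by (meson mult_right_mono order_trans zero_le)
  qed
qed

end

section \<open>Positions in the encoded input\<close>

lemma length_concat_take:
  "i \<le> length xss \<Longrightarrow> length (concat (take i xss)) = (\<Sum>j<i. length (xss ! j))"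
  by (induction i) (simp_all add: take_Suc_conv_app_nth)

lemma nth_concat:
  assumes "i < length xss" "j < length (xss ! i)"
  shows "(\<Sum>l<i. length (xss ! l)) + j < length (concat xss)"
    and "concat xss ! ((\<Sum>l<i. length (xss ! l)) + j) = xss ! i ! j"
proof -
  have e: "concat xss = concat (take i xss) @ xss ! i @ concat (drop (Suc i) xss)"
    by (subst id_take_nth_drop[OF assms(1)]) simp
  have l: "length (concat (take i xss)) = (\<Sum>l<i. length (xss ! l))"
    using assms(1) by (intro length_concat_take) simp
  show "(\<Sum>l<i. length (xss ! l)) + j < length (concat xss)"
    unfolding e using assms(2) l by simp
  show "concat xss ! ((\<Sum>l<i. length (xss ! l)) + j) = xss ! i ! j"
    unfolding e l[symmetric] using assms(2) by (simp add: nth_append del: concat_append)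
qed

lemma enc_rat_num_den: "enc_rat r = [num r, den r]"
  by (simp add: enc_rat_def num_def den_def)

definition enc_atoms :: "(rat \<times> rat) list \<Rightarrow> nat list" where
  "enc_atoms ps = concat (map (\<lambda>(v, p). [num v, den v, num p, den p]) ps)"

lemma length_enc_atoms: "length (enc_atoms ps) = 4 * length ps"
  unfolding enc_atoms_def by (induction ps) (auto simp: case_prod_unfold)

lemma nth_enc_atoms:
  assumes "j < length ps" "c < 4"
  shows "enc_atoms ps ! (4 * j + c) = [num (fst (ps ! j)), den (fst (ps ! j)), num (snd (ps ! j)), den (snd (ps ! j))] ! c"
proof -
  let ?xss = "map (\<lambda>(v, p). [num v, den v, num p, den p]) ps"
  have "(\<Sum>l<j. length (?xss ! l)) = (\<Sum>l<j. 4)"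
    using assms(1) by (intro sum.cong refl) (auto simp: case_prod_unfold)
  then have s: "(\<Sum>l<j. length (?xss ! l)) = 4 * j" by simp
  show ?thesis
    using nth_concat(2)[of j ?xss c] assms unfolding s by (simp add: enc_atoms_def case_prod_unfold)
qed

lemma enc_input_eq:
  "enc_input (\<epsilon>, E) = [num \<epsilon>, den \<epsilon>, length E] @ concat (map (\<lambda>ps. length ps # enc_atoms ps) E)"
  by (simp add: enc_input_def enc_list_def[abs_def] enc_rat_num_den enc_atoms_def case_prod_unfold)

lemma length_enc_input: "length (enc_input (\<epsilon>, E)) = 3 + length E + 4 * (\<Sum>i<length E. length (E ! i))"
proof -
  have "length (concat (map (\<lambda>ps. length ps # enc_atoms ps) E)) = (\<Sum>i<length E. Suc (4 * length (E ! i)))"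
    using length_concat_take[of "length E" "map (\<lambda>ps. length ps # enc_atoms ps) E"]
    by (simp add: length_enc_atoms)
  then show ?thesis by (simp add: enc_input_eq sum_Suc sum_distrib_left)
qed

lemma nth_enc_input:
  assumes "i < length E"
  shows "enc_input (\<epsilon>, E) ! (3 + i + 4 * (\<Sum>l<i. length (E ! l))) = length (E ! i)"
    and "j < length (E ! i) \<Longrightarrow> c < 4 \<Longrightarrow> enc_input (\<epsilon>, E) ! (4 + i + 4 * ((\<Sum>l<i. length (E ! l)) + j) + c)
      = [num (fst (E ! i ! j)), den (fst (E ! i ! j)), num (snd (E ! i ! j)), den (snd (E ! i ! j))] ! c"
proof -
  let ?xss = "map (\<lambda>ps. length ps # enc_atoms ps) E"
  have s: "(\<Sum>l<i. length (?xss ! l)) = i + 4 * (\<Sum>l<i. length (E ! l))"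
  proof -
    have "(\<Sum>l<i. length (?xss ! l)) = (\<Sum>l<i. Suc (4 * length (E ! l)))"
      using assms by (intro sum.cong refl) (simp add: length_enc_atoms)
    then show ?thesis by (simp add: sum_Suc sum_distrib_left)
  qed
  show "enc_input (\<epsilon>, E) ! (3 + i + 4 * (\<Sum>l<i. length (E ! l))) = length (E ! i)"
    using nth_concat(2)[of i ?xss 0] assms unfolding s by (simp add: enc_input_eq nth_append)
  assume j: "j < length (E ! i)" "c < 4"
  have "concat ?xss ! (i + 4 * (\<Sum>l<i. length (E ! l)) + Suc (4 * j + c)) = enc_atoms (E ! i) ! (4 * j + c)"
    using nth_concat(2)[of i ?xss "Suc (4 * j + c)"] assms j unfolding s by (simp add: length_enc_atoms)
  moreover have "4 + i + 4 * ((\<Sum>l<i. length (E ! l)) + j) + c = 3 + (i + 4 * (\<Sum>l<i. length (E ! l)) + Suc (4 * j + c))"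
    by simp
  ultimately show "enc_input (\<epsilon>, E) ! (4 + i + 4 * ((\<Sum>l<i. length (E ! l)) + j) + c)
      = [num (fst (E ! i ! j)), den (fst (E ! i ! j)), num (snd (E ! i ! j)), den (snd (E ! i ! j))] ! c"
    unfolding nth_enc_atoms[OF j, symmetric] by (simp only: enc_input_eq) (simp add: nth_append add.assoc)
qed

lemma nth_flat:
  assumes "i < length E" "j < length (E ! i)"
  shows "(\<Sum>l<i. length (E ! l)) + j < length (flat E)"
    and "flat E ! ((\<Sum>l<i. length (E ! l)) + j) = (i, E ! i ! j)"
proof -
  let ?xss = "map (\<lambda>i. map (Pair i) (E ! i)) [0..<length E]"
  have s: "(\<Sum>l<i. length (?xss ! l)) = (\<Sum>l<i. length (E ! l))"
    using assms by (intro sum.cong refl) simp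
  show "(\<Sum>l<i. length (E ! l)) + j < length (flat E)" "flat E ! ((\<Sum>l<i. length (E ! l)) + j) = (i, E ! i ! j)"
    using nth_concat[of i ?xss j] assms unfolding s flat_def by simp_all
qed

lemma length_flat: "length (flat E) = (\<Sum>i<length E. length (E ! i))"
  using length_concat_take[of "length E" "map (\<lambda>i. map (Pair i) (E ! i)) [0..<length E]"]
  by (simp add: flat_def)

section \<open>The algorithm\<close>

text \<open>
  The product of all input numbers is a common multiple of the denominators; \<open>max 1\<close> skips zeros.
\<close>

definition common_den :: "rat \<times> instance_data \<Rightarrow> nat" where
  "common_den inp = (\<Prod>a<length (enc_input inp). max 1 (enc_input inp ! a))"

text \<open>The least \<open>k\<close> with \<open>2 ^ k * (4 * \<epsilon>) > 1\<close>, expressed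
  in integers so that a program can test it.\<close>

definition level :: "rat \<Rightarrow> nat" where
  "level \<epsilon> = (LEAST k. den \<epsilon> < 4 * 2 ^ k * num \<epsilon>)"

definition count_bound :: "nat \<Rightarrow> nat" where
  "count_bound k = 2 * k * 2 ^ k * 2 ^ k"

definition phase_length :: "nat \<Rightarrow> nat \<Rightarrow> nat" where
  "phase_length n k = (n - 1) * (2 ^ k - 1) div 2 ^ k"

definition threshold :: "rat \<times> instance_data \<Rightarrow> nat" where
  "threshold = (\<lambda>(\<epsilon>, E). let G = tab (common_den (\<epsilon>, E)) E in
     topN G (common_den (\<epsilon>, E)) (2 ^ level \<epsilon>) (length E) (count_bound (level \<epsilon>)) (length G))"

definition keep :: "rat \<times> instance_data \<Rightarrow> nat set" where
  "keep = (\<lambda>(\<epsilon>, E). {i. i < length E \<and>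
     keepN (tab (common_den (\<epsilon>, E)) E) (common_den (\<epsilon>, E)) (2 ^ level \<epsilon>) (threshold (\<epsilon>, E)) i \<and>
     count_bound (level \<epsilon>) \<le> length E})"

definition stop :: "(rat \<times> instance_data) \<times> nat \<times> rat history \<Rightarrow> bool" where
  "stop = (\<lambda>((\<epsilon>, E), s, h). stopN (tab (common_den (\<epsilon>, E)) E) (common_den (\<epsilon>, E)) (2 ^ level \<epsilon>)
     (threshold (\<epsilon>, E)) (phase_length (length E) (level \<epsilon>)) (length h) (fst (last h))
     (scaled (common_den (\<epsilon>, E)) (snd (last h))))"

lemma num_pos: "0 < \<epsilon> \<Longrightarrow> 0 < num \<epsilon>"
  using real_of_rat_num_den[of \<epsilon>] by (cases "num \<epsilon> = 0") auto

lemma level: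
  assumes "0 < \<epsilon>"
  shows "den \<epsilon> < 4 * 2 ^ level \<epsilon> * num \<epsilon>" "j < level \<epsilon> \<Longrightarrow> 4 * 2 ^ j * num \<epsilon> \<le> den \<epsilon>"
proof -
  have "den \<epsilon> < 2 ^ den \<epsilon> * 1" by simp
  also have "\<dots> \<le> (4 * 2 ^ den \<epsilon>) * num \<epsilon>" using num_pos[OF assms] by (intro mult_le_mono) auto
  finally show "den \<epsilon> < 4 * 2 ^ level \<epsilon> * num \<epsilon>" unfolding level_def by (rule LeastI)
  show "4 * 2 ^ j * num \<epsilon> \<le> den \<epsilon>" if "j < level \<epsilon>"
    using not_less_Least[of j "\<lambda>k. den \<epsilon> < 4 * 2 ^ k * num \<epsilon>"] that unfolding level_def by simp
qed

lemma scaled_instance_common_den: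
  assumes "valid_instance E"
  shows "scaled_instance E (common_den (\<epsilon>, E))"
proof
  show "0 < common_den (\<epsilon>, E)" unfolding common_den_def by (intro prod_pos) simp
  fix i v p assume i: "i < length E" and vp: "(v, p) \<in> set (E ! i)"
  then obtain j where j: "j < length (E ! i)" "E ! i ! j = (v, p)" by (auto simp: in_set_conv_nth)
  have dvd: "den r dvd common_den (\<epsilon>, E)"
    if "a < length (enc_input (\<epsilon>, E))" "enc_input (\<epsilon>, E) ! a = den r" for a r
  proof -
    have "max 1 (enc_input (\<epsilon>, E) ! a) dvd common_den (\<epsilon>, E)"
      unfolding common_den_def using that by (intro dvd_prodI) auto
    then show ?thesis using that den_pos[of r] by (simp add: max_def split: if_splits)
  qed
  let ?F = "\<lambda>i. \<Sum>l<i. length (E ! l)"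
  have "?F i + length (E ! i) \<le> ?F (length E)"
    using sum_mono2[of "{..<length E}" "{..<Suc i}" "\<lambda>l. length (E ! l)"] i by auto
  then have a: "4 + i + 4 * (?F i + j) + c < length (enc_input (\<epsilon>, E))" if "c < 4" for c
    using that i j(1) by (simp add: length_enc_input)
  show "den v dvd common_den (\<epsilon>, E) \<and> den p dvd common_den (\<epsilon>, E)"
    using dvd[OF a[of 1], of v] dvd[OF a[of 3], of p] nth_enc_input(2)[OF i j(1), of 1 \<epsilon>]
      nth_enc_input(2)[OF i j(1), of 3 \<epsilon>] j(2) by simp
qed (use assms in simp)

theorem keep_stop_guarantee:
  assumes \<epsilon>: "0 < \<epsilon>" and E: "valid_instance E" and Q: "prob_space Q"
  shows "real (card ({..<length E} - keep (\<epsilon>, E))) \<le> removal_bound 1 (real_of_rat \<epsilon>)"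
    and "ennreal (kertz - 20 * real_of_rat \<epsilon>) * EMAX (laws E) (keep (\<epsilon>, E))
      \<le> expected_reward (laws E) {..<length E} Q (\<lambda>s. real_policy (\<lambda>h. stop ((\<epsilon>, E), s, h)))"
proof -
  interpret scaled_instance E "common_den (\<epsilon>, E)" by (rule scaled_instance_common_den[OF E])
  let ?W = "common_den (\<epsilon>, E)"
  let ?k = "level \<epsilon>"
  have e: "real_of_rat \<epsilon> = real (num \<epsilon>) / real (den \<epsilon>)" using \<epsilon> by (intro real_of_rat_num_den) simp
  have d: "0 < real (den \<epsilon>)" using den_pos[of \<epsilon>] by simp
  have k1: "1 < 2 ^ ?k * (4 * real_of_rat \<epsilon>)"
  proof -
    have "real (den \<epsilon>) < real (4 * 2 ^ ?k * num \<epsilon>)" using level(1)[OF \<epsilon>] by (simp only: of_nat_less_iff)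
    then show ?thesis unfolding e using d by (simp add: field_simps)
  qed
  have k2: "?k = 0 \<or> 2 ^ (?k - 1) * (4 * real_of_rat \<epsilon>) \<le> 1"
  proof (cases "?k = 0")
    case False
    then have "4 * 2 ^ (?k - 1) * num \<epsilon> \<le> den \<epsilon>" using level(2)[OF \<epsilon>, of "?k - 1"] by simp
    then have "real (4 * 2 ^ (?k - 1) * num \<epsilon>) \<le> real (den \<epsilon>)" by (simp only: of_nat_le_iff)
    then show ?thesis unfolding e using d by (simp add: field_simps)
  qed simp
  have T: "threshold (\<epsilon>, E) = topN G ?W (2 ^ ?k) n (count_bound ?k) (length G)"
    by (simp add: threshold_def Let_def)
  have J: "keep (\<epsilon>, E) = {i. i < n \<and> keepN G ?W (2 ^ ?k) (threshold (\<epsilon>, E)) i \<and> count_bound ?k \<le> n}"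
    by (simp add: keep_def)
  have stop: "real_policy (\<lambda>h. stop ((\<epsilon>, E), s, h)) h
      = stopN G ?W (2 ^ ?k) (threshold (\<epsilon>, E)) (phase_length n ?k) (length h) i (scaled ?W v)"
    if h: "h \<noteq> []" and iv: "last h = (i, real_of_rat v)" for s h i v
  proof -
    have "inv real_of_rat (real_of_rat v) = v" by (intro inv_f_f injI) simp
    then show ?thesis using h iv by (simp add: real_policy_def stop_def last_map)
  qed
  have pos: "0 < real_of_rat \<epsilon>" using \<epsilon> by simp
  note g = algorithm_guarantee[OF pos k1 k2 refl count_bound_def phase_length_def T J Q, OF stop]
  show "real (card ({..<length E} - keep (\<epsilon>, E))) \<le> removal_bound 1 (real_of_rat \<epsilon>)" by (rule g(1))
  show "ennreal (kertz - 20 * real_of_rat \<epsilon>) * EMAX (laws E) (keep (\<epsilon>, E))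
      \<le> expected_reward (laws E) {..<length E} Q (\<lambda>s. real_policy (\<lambda>h. stop ((\<epsilon>, E), s, h)))" by (rule g(2))
qed

section \<open>Polynomial running time\<close>

text \<open>
  For inputs of size \<open>s\<close> the largest numbers are those of the dynamic program, with up to
  \<open>2 s + (3 s + 1) s\<close> bits.
\<close>

definition word_length :: "nat \<Rightarrow> nat" where
  "word_length s = (3 * s + 1) * (s + 1)"

lemma word_length_ge: "a \<le> 3 * s + 1 \<Longrightarrow> x < 2 ^ a \<Longrightarrow> x < (2 :: nat) ^ word_length s"
proof -
  assume "a \<le> 3 * s + 1" "x < 2 ^ a"
  moreover have "3 * s + 1 \<le> word_length s" by (simp add: word_length_def)
  ultimately show ?thesis using power_increasing[of a "word_length s" "2 :: nat"] by linarith
qed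

text \<open>The loop bound is the input size and the word length a polynomial in it; the two linear
  factors in the proof multiply to \<open>word_length\<close>.\<close>

lemma polytime_onI:
  assumes "\<And>x. x \<in> A \<Longrightarrow> runs (word_length (input_size (enc_in x))) (input_size (enc_in x)) c
    (input_mem (enc_in x)) (\<lambda>m. out_list m = enc_out (f x))"
    and "\<And>x. x \<in> A \<Longrightarrow> mem_bits (word_length (input_size (enc_in x))) (input_mem (enc_in x))"
  shows "polytime_on A enc_in enc_out f"
proof -
  obtain p :: "nat poly" where p: "\<And>X. ccom X c = poly p X" using ccom_poly by blast
  show ?thesis
    unfolding polytime_on_def
  proof (intro exI[of _ c] exI[of _ "p * ([:1, 3:] * [:1, 1:] + 1)"] ballI)
    fix x assume "x \<in> A"
    from assms[OF this] obtain m t where "exec c (input_mem (enc_in x)) t m" "out_list m = enc_out (f x)"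
        "t \<le> ccom (input_size (enc_in x)) c * (word_length (input_size (enc_in x)) + 1)"
      unfolding runs_def by blast
    then show "\<exists>t m. exec c (input_mem (enc_in x)) t m \<and> out_list m = enc_out (f x) \<and>
        t \<le> poly (p * ([:1, 3:] * [:1, 1:] + 1)) (input_size (enc_in x))"
      by (intro exI[of _ t] exI[of _ m]) (simp add: p word_length_def algebra_simps)
  qed
qed

section \<open>Sizes of encoded inputs\<close>

lemma input_size_eq: "input_size xs = (\<Sum>x\<leftarrow>xs. bits x) + length xs"
  unfolding input_size_def by (induction xs) auto

lemma length_le_input_size: "length xs \<le> input_size xs"
  by (simp add: input_size_eq)

lemma bits_le_input_size: "x \<in> set xs \<Longrightarrow> bits x < input_size xs"
  unfolding input_size_def by (induction xs) auto

lemma less_power_input_size: "x \<in> set xs \<Longrightarrow> x < 2 ^ input_size xs"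
  using bits_le_input_size[of x xs] by (simp add: bits_le_iff[symmetric])

lemma input_mem_less:
  assumes "xs \<noteq> []"
  shows "input_mem xs a < 2 ^ input_size xs"
  using less_power_input_size[of "xs ! (a - 1)" xs] assms
    less_le_trans[OF less_exp power_increasing[OF length_le_input_size[of xs], of 2]]
  by (auto simp: input_mem_def)

text \<open>Multiplication adds bit lengths, which keeps the common denominator within the size of
  the input.\<close>

lemma prod_max_le: "(\<Prod>a<length xs. max 1 (xs ! a)) \<le> (2 :: nat) ^ (\<Sum>x\<leftarrow>xs. bits x)"
proof -
  have "max 1 x \<le> 2 ^ bits x" for x using less_power_bits[of x] by (simp add: max_def)
  then have "(\<Prod>a<length xs. max 1 (xs ! a)) \<le> (\<Prod>a<length xs. 2 ^ bits (xs ! a))"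
    by (intro prod_mono) auto
  also have "\<dots> = 2 ^ (\<Sum>x\<leftarrow>xs. bits x)"
    by (simp add: sum_list_sum_nth atLeast0LessThan power_sum)
  finally show ?thesis .
qed

text \<open>\<open>ys\<close> is empty for the removal program and holds seed and history for a
  query; all bounds are in terms of the size of the whole input.\<close>

locale encoded =
  fixes \<epsilon> :: rat and E :: instance_data and ys :: "nat list"
  assumes \<epsilon>: "0 < \<epsilon>"
begin

abbreviation "xs \<equiv> enc_input (\<epsilon>, E) @ ys"
abbreviation "s \<equiv> input_size xs"
abbreviation "W \<equiv> common_den (\<epsilon>, E)"
abbreviation "G \<equiv> tab W E"
abbreviation "n \<equiv> length E"
abbreviation "m \<equiv> input_mem xs"
abbreviation "fl i \<equiv> \<Sum>l<i. length (E ! l)"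

lemma length_le: "3 + n + 4 * fl n \<le> length xs" "length xs \<le> s"
  using length_le_input_size[of xs] by (simp_all add: length_enc_input)

lemma m_Suc: "a < 3 + n + 4 * fl n \<Longrightarrow> m (Suc a) = enc_input (\<epsilon>, E) ! a"
  by (simp add: input_mem_def nth_append length_enc_input)

lemma m_params: "m 1 = num \<epsilon>" "m 2 = den \<epsilon>" "m 3 = n"
  by (simp_all add: input_mem_def enc_input_eq)

lemma fl_add_le: "i < n \<Longrightarrow> fl i + length (E ! i) \<le> fl n"
  using sum_mono2[of "{..<n}" "{..<Suc i}" "\<lambda>l. length (E ! l)"] by auto

lemma mem_bits_m: "mem_bits (word_length s) m"
  unfolding mem_bits_def using input_mem_less[of xs]
  by (auto simp: enc_input_eq intro!: word_length_ge[of s])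

lemma W_less: "W < 2 ^ s"
proof -
  have "W \<le> 2 ^ (\<Sum>x\<leftarrow>enc_input (\<epsilon>, E). bits x)" unfolding common_den_def by (rule prod_max_le)
  also have "\<dots> < 2 ^ s"
    by (intro power_strict_increasing) (simp_all add: input_size_eq length_enc_input)
  finally show ?thesis .
qed

lemma scaled_less:
  assumes "num r < 2 ^ s"
  shows "scaled W r < 2 ^ (2 * s)"
proof -
  have "scaled W r \<le> num r * W" unfolding scaled_def by (intro mult_le_mono2 div_le_dividend)
  also have "\<dots> < 2 ^ s * 2 ^ s" using assms W_less by (intro mult_strict_mono) auto
  finally show ?thesis by (simp add: mult_2 power_add)
qed

lemma length_G: "length G = fl n"
  by (simp add: tab_def length_flat)

lemma flat_index:
  assumes "e < fl n"
  obtains i j where "i < n" "j < length (E ! i)" "e = fl i + j"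
proof -
  have "\<exists>i j. i < b \<and> j < length (E ! i) \<and> e = fl i + j" if "e < fl b" for b
    using that
  proof (induction b)
    case (Suc b)
    show ?case
    proof (cases "e < fl b")
      case True
      with Suc.IH show ?thesis using less_SucI by blast
    next
      case False
      with Suc.prems show ?thesis by (intro exI[of _ b] exI[of _ "e - fl b"]) auto
    qed
  qed simp
  with assms that show ?thesis by blast
qed

lemma cell:
  assumes "i < n" "j < length (E ! i)" "c < 4"
  shows "m (5 + i + 4 * (fl i + j) + c)
      = [num (fst (E ! i ! j)), den (fst (E ! i ! j)), num (snd (E ! i ! j)), den (snd (E ! i ! j))] ! c"
proof -
  have "4 + i + 4 * (fl i + j) + c < 3 + n + 4 * fl n" using fl_add_le[OF assms(1)] assms by simp
  moreover have "5 + i + 4 * (fl i + j) + c = Suc (4 + i + 4 * (fl i + j) + c)" by simp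
  ultimately show ?thesis using m_Suc nth_enc_input(2)[OF assms, of \<epsilon>] by (simp only:)
qed

lemma G_nth:
  assumes "i < n" "j < length (E ! i)"
  shows "G ! (fl i + j) = (i, scaled W (fst (E ! i ! j)), scaled W (snd (E ! i ! j)))"
  using nth_flat[OF assms] by (simp add: tab_def case_prod_unfold)

lemma val_wgt_less:
  assumes "e < length G"
  shows "val G e < 2 ^ (2 * s)" "wgt G e < 2 ^ (2 * s)"
proof -
  obtain i j where ij: "i < n" "j < length (E ! i)" "e = fl i + j" using assms flat_index by (auto simp: length_G)
  have c: "m a < 2 ^ s" for a by (rule input_mem_less) (simp add: enc_input_eq)
  have "num (fst (E ! i ! j)) = m (5 + i + 4 * (fl i + j) + 0)" "num (snd (E ! i ! j)) = m (5 + i + 4 * (fl i + j) + 2)"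
    by (subst cell[OF ij(1,2)]; simp)+
  then have "num (fst (E ! i ! j)) < 2 ^ s" "num (snd (E ! i ! j)) < 2 ^ s" by (simp_all only: c)
  then show "val G e < 2 ^ (2 * s)" "wgt G e < 2 ^ (2 * s)"
    unfolding ij(3) G_nth[OF ij(1,2)] by (simp_all add: scaled_less)
qed

lemma length_G_less: "length G < s"
  using length_le by (simp add: length_G)

lemma sum_wgt_less: "(\<Sum>e<length G. wgt G e) < 2 ^ (3 * s)"
proof -
  have "(\<Sum>e<length G. wgt G e) \<le> (\<Sum>e<length G. 2 ^ (2 * s))"
    using val_wgt_less(2) by (intro sum_mono) (auto intro: less_imp_le)
  also have "\<dots> = length G * 2 ^ (2 * s)" by simp
  also have "\<dots> < 2 ^ s * 2 ^ (2 * s)"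
    using less_trans[OF length_G_less less_exp[of s]] by (intro mult_strict_right_mono) simp_all
  also have "\<dots> = 2 ^ (3 * s)" by (simp flip: power_add)
  finally show ?thesis .
qed

text \<open>\<open>2 ^ level \<epsilon>\<close> may be exponential in the input size. Only its
  exponent bounds a loop; the power itself merely has to fit into a word.\<close>

lemma level_less: "level \<epsilon> < s" "(2 :: nat) ^ level \<epsilon> < 2 ^ s"
proof -
  show *: "(2 :: nat) ^ level \<epsilon> < 2 ^ s"
  proof (cases "level \<epsilon>")
    case 0
    have "0 < s" using length_le by simp
    with 0 show ?thesis using power_strict_increasing[of 0 s "2 :: nat"] by simp
  next
    case (Suc k)
    have "4 * 2 ^ k * 1 \<le> 4 * 2 ^ k * num \<epsilon>" using num_pos[OF \<epsilon>] by (intro mult_le_mono2) simp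
    also have "\<dots> \<le> den \<epsilon>" using level(2)[OF \<epsilon>, of k] Suc by simp
    also have "den \<epsilon> < 2 ^ s" by (intro less_power_input_size) (simp add: enc_input_eq)
    finally show ?thesis unfolding Suc by simp
  qed
  then show "level \<epsilon> < s" by simp
qed

lemma count_bound_less: "count_bound (level \<epsilon>) < 2 ^ (3 * s + 1)"
proof -
  have "level \<epsilon> * (2 ^ level \<epsilon> * 2 ^ level \<epsilon>) < 2 ^ s * (2 ^ s * 2 ^ s)"
    using level_less less_trans[OF level_less(1) less_exp[of s]] by (intro mult_strict_mono) auto
  also have "\<dots> = 2 ^ (3 * s)" by (simp flip: power_add)
  finally show ?thesis by (simp add: count_bound_def mult.assoc)
qed

sublocale parsed "word_length s" s "length xs" G n W "2 ^ level \<epsilon>" "count_bound (level \<epsilon>)"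
  "phase_length n (level \<epsilon>)" m "\<lambda>i. length (E ! i)" "level \<epsilon>"
proof
  have *: "x < 2 ^ word_length s" if "x < s" for x
    by (rule word_length_ge[of s]) (use that less_exp[of s] in linarith)+
  show "length G \<le> s" "length G < 2 ^ word_length s" "n \<le> s" "n < 2 ^ word_length s"
    using length_le length_G_less by (auto intro!: *)
  show "0 < length xs" by (simp add: enc_input_eq)
  show "(\<Sum>e<length G. wgt G e) < 2 ^ word_length s" by (rule word_length_ge[OF _ sum_wgt_less]) simp
  show "m 0 = length xs" by (simp add: input_mem_def)
  show "m 3 = n" by (rule m_params)
  show "m (4 + i + 4 * fl i) = length (E ! i)" if "i < n" for i
  proof -
    have "3 + i + 4 * fl i < 3 + n + 4 * fl n" using fl_add_le[OF that] that by simp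
    moreover have "4 + i + 4 * fl i = Suc (3 + i + 4 * fl i)" by simp
    ultimately show ?thesis using m_Suc nth_enc_input(1)[OF that, of \<epsilon>] by (simp only:)
  qed
  show "3 + n + 4 * fl n \<le> length xs" "3 + n + 4 * fl n \<le> s" using length_le by simp_all
  show "length xs < 2 ^ word_length s"
    by (rule word_length_ge[of s]) (use length_le less_exp[of s] in linarith)+
  show "length G = fl n" by (rule length_G)
  show "G ! e = (i, m (5 + i + 4 * e) * (W div m (6 + i + 4 * e)), m (7 + i + 4 * e) * (W div m (8 + i + 4 * e)))"
    if "i < n" "j < length (E ! i)" "e = fl i + j" for i j e
    unfolding that(3) using G_nth[OF that(1,2)] cell[OF that(1,2), of 0] cell[OF that(1,2), of 1]
      cell[OF that(1,2), of 2] cell[OF that(1,2), of 3]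
    by (simp add: scaled_def add.assoc)
  show "W = (\<Prod>a<3 + n + 4 * fl n. max 1 (m (a + 1)))"
    unfolding common_den_def length_enc_input by (intro prod.cong refl) (simp add: m_Suc)
  show "W < 2 ^ word_length s" by (rule word_length_ge[OF _ W_less]) simp
  show "val G e < 2 ^ word_length s" if "e < length G" for e
    by (rule word_length_ge[OF _ val_wgt_less(1)[OF that]]) simp
  show "4 * 2 ^ j * m 1 \<le> m 2" if "j < level \<epsilon>" for j unfolding m_params by (rule level(2)[OF \<epsilon> that])
  show "m 2 < 4 * 2 ^ level \<epsilon> * m 1" unfolding m_params by (rule level(1)[OF \<epsilon>])
  show "level \<epsilon> \<le> s" using level_less by simp
  show "(2 :: nat) ^ level \<epsilon> < 2 ^ word_length s" by (rule word_length_ge[OF _ level_less(2)]) simp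
  show "level \<epsilon> < 2 ^ word_length s" by (rule *[OF level_less(1)])
  show "count_bound (level \<epsilon>) < 2 ^ word_length s" by (rule word_length_ge[OF _ count_bound_less]) simp
qed (simp_all add: count_bound_def phase_length_def)

lemma threshold_eq: "T = threshold (\<epsilon>, E)"
  by (simp add: threshold_def Let_def)

lemma runs_keep: "runs (word_length s) s KEEP_PROG m (\<lambda>m'. out_list m' = sorted_list_of_set (keep (\<epsilon>, E)))"
proof -
  have "filter kept [0..<n] = sorted_list_of_set (set (filter kept [0..<n]))"
    by (rule sorted_list_of_set.idem_if_sorted_distinct[symmetric]) (simp_all add: sorted_wrt_filter)
  also have "set (filter kept [0..<n]) = keep (\<epsilon>, E)"
    unfolding threshold_eq by (auto simp: keep_def)
  finally have e: "filter kept [0..<n] = sorted_list_of_set (keep (\<epsilon>, E))" .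
  show ?thesis using runs_KEEP_PROG unfolding e .
qed

lemma MW_le: "phase_length n (level \<epsilon>) * W \<le> 2 ^ (2 * s)"
proof -
  have "phase_length n (level \<epsilon>) * W \<le> 2 ^ s * 2 ^ s"
    using W_less M_le length_le less_exp[of s] by (intro mult_le_mono) linarith+
  then show ?thesis by (simp add: mult_2 power_add)
qed

lemma topN_le_if:
  assumes "\<And>e. e < length G \<Longrightarrow> val G e \<le> b" "j \<le> length G"
  shows "topN G w K c N j \<le> b"
  using assms(2)
proof (induction j)
  case (Suc j)
  then have "topN G w K c N j \<le> b" "val G j \<le> b" using assms(1) by simp_all
  then show ?case by (auto simp: of_bool_def)
qed simp

lemma MW_power_le: "(phase_length n (level \<epsilon>) * W) ^ r \<le> 2 ^ (2 * s * r)"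
  using power_mono[OF MW_le, of r] by (simp add: power_mult)

text \<open>Each of the two summands of a step exceeds the previous bound by at most
  \<open>3 * s\<close> bits, their sum by one more. With at most \<open>s\<close> steps the length
  stays quadratic in \<open>s\<close>.\<close>

lemma dpN_le:
  "dpN G W (2 ^ level \<epsilon>) T (phase_length n (level \<epsilon>)) r \<le> 2 ^ (2 * s) * 2 ^ ((3 * s + 1) * r)"
proof (induction r)
  case 0
  have "T \<le> 2 ^ (2 * s)" using val_wgt_less(1) by (intro topN_le_if) (auto intro: less_imp_le)
  then show ?case by simp
next
  case (Suc r)
  let ?M = "phase_length n (level \<epsilon>)"
  let ?B = "2 ^ ((3 * s + 1) * r) :: nat"
  have pow: "(?M * W) ^ r \<le> ?B"
  proof -
    have "(2 :: nat) ^ (2 * s * r) \<le> ?B" by (intro power_increasing mult_le_mono1) auto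
    then show ?thesis using MW_power_le[of r] by (rule order_trans[rotated])
  qed
  have "(\<Sum>e<length G. of_bool (keepN G W (2 ^ level \<epsilon>) T (own G e)) * wgt G e *
      (val G e * (?M * W) ^ r - dpN G W (2 ^ level \<epsilon>) T ?M r)) \<le> (\<Sum>e<length G. wgt G e * (2 ^ (2 * s) * ?B))"
  proof (intro sum_mono mult_le_mono)
    fix e assume "e \<in> {..<length G}"
    then have "val G e * (?M * W) ^ r \<le> 2 ^ (2 * s) * ?B"
      using val_wgt_less(1)[of e] pow by (intro mult_le_mono) auto
    then show "val G e * (?M * W) ^ r - dpN G W (2 ^ level \<epsilon>) T ?M r \<le> 2 ^ (2 * s) * ?B" by linarith
  qed simp
  also have "\<dots> = (\<Sum>e<length G. wgt G e) * (2 ^ (2 * s) * ?B)" by (rule sum_distrib_right[symmetric])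
  also have "\<dots> \<le> 2 ^ (3 * s) * (2 ^ (2 * s) * ?B)" using sum_wgt_less by (intro mult_le_mono1) simp
  finally have 1: "(\<Sum>e<length G. of_bool (keepN G W (2 ^ level \<epsilon>) T (own G e)) * wgt G e *
      (val G e * (?M * W) ^ r - dpN G W (2 ^ level \<epsilon>) T ?M r)) \<le> 2 ^ (3 * s) * (2 ^ (2 * s) * ?B)" .
  have "?M * W \<le> 2 ^ (3 * s)"
    by (rule order_trans[OF MW_le power_increasing]) auto
  then have 2: "?M * W * dpN G W (2 ^ level \<epsilon>) T ?M r \<le> 2 ^ (3 * s) * (2 ^ (2 * s) * ?B)"
    using Suc.IH by (intro mult_le_mono)
  have "2 ^ (3 * s) * (2 ^ (2 * s) * ?B) + 2 ^ (3 * s) * (2 ^ (2 * s) * ?B) = 2 ^ (2 * s) * 2 ^ ((3 * s + 1) * Suc r)"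
    by (simp add: power_add algebra_simps)
  with add_mono[OF 2 1] show ?case unfolding dpN.simps by simp
qed

lemma phase_length_le: "phase_length n (level \<epsilon>) \<le> s"
  using M_le length_le by linarith

lemma dpN_less:
  assumes "r \<le> phase_length n (level \<epsilon>)"
  shows "dpN G W (2 ^ level \<epsilon>) T (phase_length n (level \<epsilon>)) r < 2 ^ word_length s"
proof -
  have "(3 * s + 1) * r \<le> (3 * s + 1) * s" using assms phase_length_le by (intro mult_le_mono2) simp
  then have "2 * s + (3 * s + 1) * r < word_length s" by (simp add: word_length_def)
  then have "(2 :: nat) ^ (2 * s) * 2 ^ ((3 * s + 1) * r) < 2 ^ word_length s"
    unfolding power_add[symmetric] by (intro power_strict_increasing) auto
  with dpN_le[of r] show ?thesis by (rule le_less_trans)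
qed

lemma MW_power_less:
  assumes "r \<le> phase_length n (level \<epsilon>)"
  shows "(phase_length n (level \<epsilon>) * W) ^ r < 2 ^ word_length s"
proof -
  have "2 * s * r \<le> 2 * s * s" using assms phase_length_le by (intro mult_le_mono2) simp
  also have "\<dots> < word_length s" by (simp add: word_length_def)
  finally have "2 * s * r < word_length s" .
  then have "(2 :: nat) ^ (2 * s * r) < 2 ^ word_length s" by (intro power_strict_increasing) auto
  with MW_power_le[of r] show ?thesis by (rule le_less_trans)
qed

end

lemma length_concat_const: "(\<And>x. x \<in> set xs \<Longrightarrow> length (f x) = c) \<Longrightarrow> length (concat (map f xs)) = c * length xs"
  by (induction xs) auto

lemma runs_stop:
  fixes E :: instance_data and r :: nat and h :: "rat history"
  assumes "0 < \<epsilon>"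
  defines "xs \<equiv> enc_query ((\<epsilon>, E), r, h)"
  shows "runs (word_length (input_size xs)) (input_size xs) STOP_PROG (input_mem xs)
    (\<lambda>m'. out_list m' = [of_bool (stop ((\<epsilon>, E), r, h))])"
proof -
  define ys where "ys = r # length h # concat (map (\<lambda>(i, v). [i, num v, den v]) h)"
  interpret encoded \<epsilon> E ys by unfold_locales fact
  have xs: "xs = enc_input (\<epsilon>, E) @ ys"
    by (simp add: xs_def ys_def enc_query_def enc_list_def enc_rat_num_den case_prod_unfold)
  have ly: "length ys = 2 + 3 * length h"
    using length_concat_const[of h "\<lambda>(i, v). [i, num v, den v]" 3] by (auto simp: ys_def)
  have L: "length (enc_input (\<epsilon>, E) @ ys) = 5 + n + 4 * length G + 3 * length h"
    by (simp add: length_enc_input ly length_G)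
  let ?L = "length (enc_input (\<epsilon>, E) @ ys)"
  have hist: "m (5 + n + 4 * length G) = length h"
    using L by (simp add: input_mem_def nth_append length_enc_input length_G ys_def)
  have tail: "stopN G W (2 ^ level \<epsilon>) T (phase_length n (level \<epsilon>)) (length h) (m (?L - 2)) (m (?L - 1) * (W div m ?L))
      = stop ((\<epsilon>, E), r, h) \<and> m (?L - 1) * (W div m ?L) < 2 ^ word_length s"
  proof (cases h rule: rev_cases)
    case Nil
    \<comment> \<open>For an empty history the last input cell holds the history length
      \<open>0\<close>; division by it gives \<open>0\<close>, so the supposed value still fits into
      a word.\<close>
    then have "m ?L = 0" using hist L by simp
    then show ?thesis using Nil by (simp add: stopN_def stop_def)
  next
    case (snoc h' a)
    define zs where "zs = enc_input (\<epsilon>, E) @ r # length h # concat (map (\<lambda>(i, v). [i, num v, den v]) h')"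
    have e: "enc_input (\<epsilon>, E) @ ys = zs @ [fst a, num (snd a), den (snd a)]"
      by (simp add: ys_def zs_def snoc case_prod_unfold)
    have c: "m (?L - 2) = fst a" "m (?L - 1) = num (snd a)" "m ?L = den (snd a)"
      unfolding e by (simp_all add: input_mem_def nth_append)
    have "num (snd a) < 2 ^ s" unfolding c(2)[symmetric] by (rule input_mem_less) (simp add: enc_input_eq)
    then have "scaled W (snd a) < 2 ^ word_length s" by (intro word_length_ge[OF _ scaled_less]) simp_all
    then show ?thesis
      unfolding c using snoc by (simp add: stop_def scaled_def flip: threshold_eq)
  qed
  show ?thesis
    unfolding xs
    using runs_STOP_PROG[OF hist _ refl refl conjunct2[OF tail] dpN_less MW_power_less] L
    unfolding conjunct1[OF tail] by simp
qed

theorem polytime_keep: "polytime_on inputs enc_input sorted_list_of_set keep"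
proof (rule polytime_onI[where c = KEEP_PROG])
  fix x assume "x \<in> inputs"
  then obtain \<epsilon> E where x: "x = (\<epsilon>, E)" "0 < \<epsilon>" by (auto simp: inputs_def)
  interpret encoded \<epsilon> E "[]" by unfold_locales fact
  show "runs (word_length (input_size (enc_input x))) (input_size (enc_input x)) KEEP_PROG
      (input_mem (enc_input x)) (\<lambda>m. out_list m = sorted_list_of_set (keep x))"
    "mem_bits (word_length (input_size (enc_input x))) (input_mem (enc_input x))"
    using runs_keep mem_bits_m by (simp_all add: x)
qed

theorem polytime_stop: "polytime_on (queries q) enc_query (\<lambda>b. [of_bool b]) stop"
proof (rule polytime_onI[where c = STOP_PROG])
  fix x assume "x \<in> queries q"
  then obtain \<epsilon> E r h where x: "x = ((\<epsilon>, E), r, h)" "0 < \<epsilon>" by (auto simp: queries_def inputs_def)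
  show "runs (word_length (input_size (enc_query x))) (input_size (enc_query x)) STOP_PROG
      (input_mem (enc_query x)) (\<lambda>m. out_list m = [of_bool (stop x)])"
    unfolding x(1) by (rule runs_stop) fact
  obtain ys where ys: "enc_query x = enc_input (\<epsilon>, E) @ ys" by (simp add: x(1) enc_query_def)
  interpret encoded \<epsilon> E ys by unfold_locales fact
  show "mem_bits (word_length (input_size (enc_query x))) (input_mem (enc_query x))"
    using mem_bits_m by (simp add: ys)
qed

theorem theorem5:
  shows "\<exists>C1 > 0. \<exists>C2 > 0.
    (\<forall>(n :: nat) (D :: nat \<Rightarrow> real measure) (\<epsilon> :: real).
       0 < \<epsilon> \<longrightarrow> (\<forall>i<n. real_distribution (D i) \<and> (AE x in D i. 0 \<le> x)) \<longrightarrow>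
       (\<exists>J \<subseteq> {..<n}. real (card ({..<n} - J)) \<le> removal_bound C1 \<epsilon> \<and>
          OPT D {..<n} \<ge> ennreal (kertz - C2 * \<epsilon>) * EMAX D J)) \<and>
    (\<exists>(keep :: rat \<times> instance_data \<Rightarrow> nat set)
      (stop :: (rat \<times> instance_data) \<times> nat \<times> rat history \<Rightarrow> bool) (q :: nat poly).
       polytime_on inputs enc_input sorted_list_of_set keep \<and>
       polytime_on (queries q) enc_query (\<lambda>b. [of_bool b]) stop \<and>
       (\<forall>(\<epsilon>, E) \<in> inputs.
          let n = length E; J = keep (\<epsilon>, E) in
          J \<subseteq> {..<n} \<and>
          real (card ({..<n} - J)) \<le> removal_bound C1 (real_of_rat \<epsilon>) \<and>
          expected_reward (laws E) {..<n} (bit_seed (seed_bits q (\<epsilon>, E)))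
              (\<lambda>s. real_policy (\<lambda>h. stop ((\<epsilon>, E), s, h)))
            \<ge> ennreal (kertz - C2 * real_of_rat \<epsilon>) * EMAX (laws E) J))"
proof (rule exI[of _ 1], rule conjI, simp, rule exI[of _ 20], rule conjI, simp, rule conjI)
  \<comment> \<open>The constants \<open>1\<close> and \<open>20\<close> are those of
    \<open>removal_params\<close>.\<close>
  show "\<forall>(n :: nat) (D :: nat \<Rightarrow> real measure) \<epsilon>. 0 < \<epsilon> \<longrightarrow>
      (\<forall>i<n. real_distribution (D i) \<and> (AE x in D i. 0 \<le> x)) \<longrightarrow>
      (\<exists>J\<subseteq>{..<n}. real (card ({..<n} - J)) \<le> removal_bound 1 \<epsilon> \<and>
        ennreal (kertz - 20 * \<epsilon>) * EMAX D J \<le> OPT D {..<n})"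
    by (intro allI impI OPT_ge_after_removal) auto
next
  have guarantee: "case x of (\<epsilon>, E) \<Rightarrow> let n = length E; J = keep (\<epsilon>, E) in
      J \<subseteq> {..<n} \<and> real (card ({..<n} - J)) \<le> removal_bound 1 (real_of_rat \<epsilon>) \<and>
      ennreal (kertz - 20 * real_of_rat \<epsilon>) * EMAX (laws E) J
        \<le> expected_reward (laws E) {..<n} (bit_seed (seed_bits 0 (\<epsilon>, E))) (\<lambda>s. real_policy (\<lambda>h. stop ((\<epsilon>, E), s, h)))"
    if "x \<in> inputs" for x
  proof -
    obtain \<epsilon> E where x: "x = (\<epsilon>, E)" "0 < \<epsilon>" "valid_instance E" using \<open>x \<in> inputs\<close> by (auto simp: inputs_def)
    have Q: "prob_space (bit_seed l)" for l
      unfolding bit_seed_def by (rule measure_pmf.prob_space_axioms)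
    have "keep (\<epsilon>, E) \<subseteq> {..<length E}" by (auto simp: keep_def)
    then show ?thesis
      unfolding x(1) Let_def prod.case using keep_stop_guarantee[OF x(2,3) Q] by blast
  qed
  show "\<exists>keep stop q. polytime_on inputs enc_input sorted_list_of_set keep \<and>
      polytime_on (queries q) enc_query (\<lambda>b. [of_bool b]) stop \<and>
      (\<forall>(\<epsilon>, E)\<in>inputs. let n = length E; J = keep (\<epsilon>, E) in
        J \<subseteq> {..<n} \<and> real (card ({..<n} - J)) \<le> removal_bound 1 (real_of_rat \<epsilon>) \<and>
        ennreal (kertz - 20 * real_of_rat \<epsilon>) * EMAX (laws E) J
          \<le> expected_reward (laws E) {..<n} (bit_seed (seed_bits q (\<epsilon>, E))) (\<lambda>s. real_policy (\<lambda>h. stop ((\<epsilon>, E), s, h))))"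
    \<comment> \<open>The polynomial \<open>0\<close> grants no random bits; the seed is then always
      \<open>0\<close>.\<close>
    by (intro exI[of _ keep] exI[of _ stop] exI[of _ 0] conjI ballI polytime_keep polytime_stop guarantee)
qed

end
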